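(* Let $A$ be a unital C*-algebra with real rank zero and without tracial states such that its primitive ideal space $\mathrm{Prim}(A)$ is Hausdorff and totally disconnected, and let $B$ be a unital C*-algebra. Let $T\colon A\to B$ be a unital spectral isometry from $A$ onto $B$. Then $T$ is a Jordan isomorphism.
   Context: $r(x)$ denotes the spectral radius. A linear map $T\colon A\to B$ is a spectral isometry if $r(Tx)=r(x)$ for all $x\in A$; unital means $T1=1$. $\mathrm{Prim}(A)$ is the set of primitive ideals of $A$ (kernels of irreducible representations) equipped with the Jacobson (hull-kernel) topology. A Jordan isomorphism is a bijective linear map $S$ with $S(x\circ y)=Sx\circ Sy$ for all $x,y$, where $x\circ y=\tfrac12(xy+yx)$. *)

theory Defs
  imports "HOL-Analysis.Analysis"
begin

text \<open>A (complex, unital) C*-algebra is modelled on a type 'a of class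
  real_normed_algebra_1 and banach (so it is a unital real Banach algebra with
  norm 1 = 1), together with a complex scalar multiplication cs extending the
  real one, and an involution st.\<close>

definition cstar_algebra ::
  "(complex \<Rightarrow> 'a::{real_normed_algebra_1,banach} \<Rightarrow> 'a) \<Rightarrow> ('a \<Rightarrow> 'a) \<Rightarrow> bool" where
  "cstar_algebra cs st \<longleftrightarrow>
     (\<forall>r x. cs (complex_of_real r) x = scaleR r x) \<and>
     (\<forall>c x y. cs c (x + y) = cs c x + cs c y) \<and>
     (\<forall>c d x. cs (c + d) x = cs c x + cs d x) \<and>
     (\<forall>c d x. cs (c * d) x = cs c (cs d x)) \<and>
     (\<forall>c x y. cs c (x * y) = cs c x * y \<and> cs c (x * y) = x * cs c y) \<and>
     (\<forall>c x. norm (cs c x) = cmod c * norm x) \<and>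
     (\<forall>x y. st (x + y) = st x + st y) \<and>
     (\<forall>c x. st (cs c x) = cs (cnj c) (st x)) \<and>
     (\<forall>x y. st (x * y) = st y * st x) \<and>
     (\<forall>x. st (st x) = x) \<and>
     (\<forall>x. norm (st x * x) = (norm x)\<^sup>2)"

definition alg_invertible :: "'a::ring_1 \<Rightarrow> bool" where
  "alg_invertible x \<longleftrightarrow> (\<exists>y. x * y = 1 \<and> y * x = 1)"

definition spec :: "(complex \<Rightarrow> 'a::real_normed_algebra_1 \<Rightarrow> 'a) \<Rightarrow> 'a \<Rightarrow> complex set" where
  "spec cs x = {z. \<not> alg_invertible (x - cs z 1)}"

definition spec_radius :: "(complex \<Rightarrow> 'a::real_normed_algebra_1 \<Rightarrow> 'a) \<Rightarrow> 'a \<Rightarrow> real" where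
  "spec_radius cs x = Sup (cmod ` spec cs x)"

definition complex_linear ::
  "(complex \<Rightarrow> 'a \<Rightarrow> 'a) \<Rightarrow> (complex \<Rightarrow> 'b \<Rightarrow> 'b) \<Rightarrow> ('a::plus \<Rightarrow> 'b::plus) \<Rightarrow> bool" where
  "complex_linear csA csB T \<longleftrightarrow>
     (\<forall>x y. T (x + y) = T x + T y) \<and> (\<forall>c x. T (csA c x) = csB c (T x))"

definition spectral_isometry ::
  "(complex \<Rightarrow> 'a::real_normed_algebra_1 \<Rightarrow> 'a) \<Rightarrow> (complex \<Rightarrow> 'b::real_normed_algebra_1 \<Rightarrow> 'b)
     \<Rightarrow> ('a \<Rightarrow> 'b) \<Rightarrow> bool" where
  "spectral_isometry csA csB T \<longleftrightarrow>
     complex_linear csA csB T \<and> (\<forall>x. spec_radius csB (T x) = spec_radius csA x)"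

definition jprod :: "'a::real_algebra \<Rightarrow> 'a \<Rightarrow> 'a" where
  "jprod x y = scaleR (1/2) (x * y + y * x)"

definition jordan_isomorphism ::
  "(complex \<Rightarrow> 'a::real_algebra \<Rightarrow> 'a) \<Rightarrow> (complex \<Rightarrow> 'b::real_algebra \<Rightarrow> 'b)
     \<Rightarrow> ('a \<Rightarrow> 'b) \<Rightarrow> bool" where
  "jordan_isomorphism csA csB S \<longleftrightarrow>
     bij S \<and> complex_linear csA csB S \<and> (\<forall>x y. S (jprod x y) = jprod (S x) (S y))"

definition real_rank_zero :: "('a::real_normed_algebra_1 \<Rightarrow> 'a) \<Rightarrow> bool" where
  "real_rank_zero st \<longleftrightarrow>
     (\<forall>a. st a = a \<longrightarrow> (\<forall>e>0. \<exists>b. st b = b \<and> alg_invertible b \<and> norm (a - b) < e))"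

definition tracial_state ::
  "(complex \<Rightarrow> 'a::real_normed_algebra_1 \<Rightarrow> 'a) \<Rightarrow> ('a \<Rightarrow> 'a) \<Rightarrow> ('a \<Rightarrow> complex) \<Rightarrow> bool" where
  "tracial_state cs st \<tau> \<longleftrightarrow>
     complex_linear cs (*) \<tau> \<and>
     (\<forall>x. Im (\<tau> (st x * x)) = 0 \<and> Re (\<tau> (st x * x)) \<ge> 0) \<and>
     \<tau> 1 = 1 \<and>
     (\<forall>x y. \<tau> (x * y) = \<tau> (y * x))"

text \<open>Left ideals, maximal (proper) left ideals and primitive ideals
  (annihilators of simple left modules A/L).\<close>
definition left_ideal :: "(complex \<Rightarrow> 'a::ring_1 \<Rightarrow> 'a) \<Rightarrow> 'a set \<Rightarrow> bool" where
  "left_ideal cs L \<longleftrightarrow> 0 \<in> L \<and> (\<forall>x\<in>L. \<forall>y\<in>L. x + y \<in> L) \<and>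
     (\<forall>x\<in>L. \<forall>c. cs c x \<in> L) \<and> (\<forall>x\<in>L. \<forall>a. a * x \<in> L)"

definition maximal_left_ideal :: "(complex \<Rightarrow> 'a::ring_1 \<Rightarrow> 'a) \<Rightarrow> 'a set \<Rightarrow> bool" where
  "maximal_left_ideal cs L \<longleftrightarrow> left_ideal cs L \<and> 1 \<notin> L \<and>
     (\<forall>L'. left_ideal cs L' \<and> L \<subseteq> L' \<longrightarrow> L' = L \<or> 1 \<in> L')"

definition Prim :: "(complex \<Rightarrow> 'a::ring_1 \<Rightarrow> 'a) \<Rightarrow> 'a set set" where
  "Prim cs = {P. \<exists>L. maximal_left_ideal cs L \<and> P = {a. \<forall>b. a * b \<in> L}}"

text \<open>Jacobson (hull-kernel) topology on Prim: closed sets are the hulls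
  hull(J) = {P \<in> Prim. J \<subseteq> P}; we take the topology whose open sets are
  generated by the complements of hulls.\<close>
definition jacobson_topology :: "(complex \<Rightarrow> 'a::ring_1 \<Rightarrow> 'a) \<Rightarrow> 'a set topology" where
  "jacobson_topology cs =
     topology_generated_by {Prim cs - {P \<in> Prim cs. J \<subseteq> P} | J. True}"

definition totally_disconnected_space :: "'a topology \<Rightarrow> bool" where
  "totally_disconnected_space X \<longleftrightarrow> (\<forall>S. connectedin X S \<longrightarrow> (\<exists>a. S \<subseteq> {a}))"

end

theory Submission
  imports Defs "HOL-Computational_Algebra.Fundamental_Theorem_Algebra"
begin

text \<open>
  Let \<open>T\<close> be a unital spectral isometry from \<open>A\<close> onto \<open>B\<close>. A three circles estimate for the spectral
  radius shows that \<open>T\<close> has closed graph, so \<open>T\<close> and \<open>T\<inverse>\<close> are bounded. If \<open>a\<^sup>2 = 0\<close> and \<open>b = T a\<close>, then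
  comparing spectra of \<open>(1 - u b)\<inverse> y\<close> and of elements \<open>z u a + T\<inverse> y\<close>, with \<open>y\<close> the adjoint of the
  resolvent, shows that \<open>(1 - u b)\<inverse>\<close> grows at most linearly in \<open>u\<close>; hence \<open>b\<^sup>2 = 0\<close>.

  Without tracial states, \<open>A\<close> is the closed span of its commutators: a bounded hermitian functional
  \<open>g\<close> vanishing on commutators has an approximate Hahn decomposition given by projections \<open>p\<^sub>n\<close>
  almost maximizing \<open>g\<close>, and a generalized limit of \<open>g (p\<^sub>n x)\<close> is a positive trace. Because the
  primitive ideal space is compact, Hausdorff and totally disconnected, every projection \<open>p\<close> has a
  central support lying in the algebraic ideal \<open>A p A\<close>; so each corner \<open>p A p\<close> is also the closed span
  of its commutators, and by real rank zero of its elements of square zero.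

  Elements of square zero from \<open>p A p\<close> and from \<open>(1 - p) A (1 - p)\<close> have a sum of square zero, so
  their images anticommute. By density \<open>T p\<close> anticommutes with \<open>T (1 - p) = 1 - T p\<close>, that is, \<open>T p\<close> is
  idempotent, and real rank zero gives \<open>T (h\<^sup>2) = (T h)\<^sup>2\<close> for self-adjoint \<open>h\<close>.
\<close>

section \<open>Invertible elements and the spectral radius\<close>

text \<open>\<open>T\<close> controls only spectral radii, so idempotency is not visibly preserved,
  whereas squaring to zero turns out to be; projections are therefore reached through square-zero
  elements. The adjoint enters because, for a resolvent E, the element E E* is self-adjoint: its
  spectral radius is the square of the norm of E, which converts spectral information in
  \<open>B\<close> into a norm estimate. The resolvent is an entire function of u with coefficients
  b^k, so linear growth leaves no room for the coefficient b^2. The obstacle is that a corner can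
  carry a trace although the algebra carries none: for a rank one projection p in B(H), with H
  infinite-dimensional, the corner is the field of complex numbers. The hypothesis on the primitive
  ideals excludes this. It makes the central support of p a finite sum of elements x_i p y_i, and
  such a sum yields a bounded map that carries commutators of \<open>A\<close> to commutators of the
  corner.\<close>

lemma alg_invertible_1 [simp]: "alg_invertible 1"
  by (auto simp: alg_invertible_def intro: exI[of _ 1])

lemma alg_invertible_mult: "alg_invertible x \<Longrightarrow> alg_invertible y \<Longrightarrow> alg_invertible (x * y)"
  unfolding alg_invertible_def by (metis mult.assoc mult_1_left)

lemma alg_invertible_left_right:
  fixes x :: "'a::ring_1"
  assumes "y * x = 1" "x * z = 1"
  shows "alg_invertible x"
  using assms unfolding alg_invertible_def by (metis mult.assoc mult_1_left mult_1_right)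

text \<open>Commutation turns an inverse of the product into both a left and a right inverse of
  \<open>x\<close>. The intended factor is \<open>x - z\<close> in
  \<open>x ^ n - z ^ n\<close>.\<close>

lemma alg_invertible_factor:
  fixes x y :: "'a::ring_1"
  assumes "alg_invertible (x * y)" "x * y = y * x"
  shows "alg_invertible x"
proof -
  obtain w where "(x * y) * w = 1" "w * (x * y) = 1"
    using assms(1) by (auto simp: alg_invertible_def)
  then have "x * (y * w) = 1" "(w * y) * x = 1"
    using assms(2) by (metis mult.assoc)+
  then show ?thesis
    using alg_invertible_left_right by blast
qed

lemma alg_invertible_minus: "alg_invertible (- x) \<longleftrightarrow> alg_invertible (x::'a::ring_1)"
  unfolding alg_invertible_def by (metis minus_mult_minus minus_minus)

lemma alg_invertible_diff_commute: "alg_invertible (x - y) \<longleftrightarrow> alg_invertible (y - (x::'a::ring_1))"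
  using alg_invertible_minus[of "x - y"] by simp

definition ainv :: "'a::ring_1 \<Rightarrow> 'a" where
  "ainv x = (THE y. x * y = 1 \<and> y * x = 1)"

lemma ainv_eqI:
  assumes "x * y = 1" "y * x = 1"
  shows "ainv x = y"
  unfolding ainv_def using assms by (intro the_equality) (auto, metis mult.assoc mult_1_left mult_1_right)

lemma ainv_right: "alg_invertible x \<Longrightarrow> x * ainv x = 1"
  and ainv_left: "alg_invertible x \<Longrightarrow> ainv x * x = 1"
  unfolding alg_invertible_def using ainv_eqI by auto

lemma one_diff_mult_geometric:
  fixes x :: "'a::ring_1"
  shows "(1 - x) * (\<Sum>l<n. x ^ l) = 1 - x ^ n"
proof (induction n)
  case (Suc n)
  have "(1 - x) * (\<Sum>l<Suc n. x ^ l) = (1 - x) * (\<Sum>l<n. x ^ l) + (1 - x) * x ^ n"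
    by (simp add: distrib_left)
  then show ?case unfolding Suc.IH by (simp add: left_diff_distrib)
qed simp

lemma neumann:
  fixes x :: "'a::{real_normed_algebra_1,banach}"
  assumes "norm x < 1"
  shows "alg_invertible (1 - x)"
proof -
  have s: "summable (\<lambda>n. x ^ n)"
    using assms by (rule complete_algebra_summable_geometric)
  have e: "suminf (\<lambda>n. x ^ n) = 1 + suminf (\<lambda>n. x ^ Suc n)"
    using suminf_split_head[OF s] by simp
  have "suminf (\<lambda>n. x ^ Suc n) = x * suminf (\<lambda>n. x ^ n)"
    using s by (simp add: suminf_mult)
  moreover have "suminf (\<lambda>n. x ^ Suc n) = suminf (\<lambda>n. x ^ n) * x"
    using s by (simp add: suminf_mult2 power_commutes)
  ultimately have "(1 - x) * suminf (\<lambda>n. x ^ n) = 1" "suminf (\<lambda>n. x ^ n) * (1 - x) = 1"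
    using e by (simp_all add: algebra_simps)
  then show ?thesis unfolding alg_invertible_def by blast
qed

lemma alg_invertible_near:
  fixes x :: "'a::{real_normed_algebra_1,banach}"
  assumes "alg_invertible x" "norm (y - x) * norm (ainv x) < 1"
  shows "alg_invertible y"
proof -
  have "norm (ainv x * (x - y)) \<le> norm (y - x) * norm (ainv x)"
    using norm_mult_ineq[of "ainv x" "x - y"] by (simp add: norm_minus_commute mult.commute)
  then have "alg_invertible (1 - ainv x * (x - y))"
    using assms(2) by (intro neumann) simp
  then have "alg_invertible (x * (1 - ainv x * (x - y)))"
    by (rule alg_invertible_mult[OF assms(1)])
  also have "x * (1 - ainv x * (x - y)) = x - (x * ainv x) * (x - y)"
    by (simp add: algebra_simps)
  also have "\<dots> = y"
    by (simp add: ainv_right[OF assms(1)])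
  finally show ?thesis .
qed

lemma open_alg_invertible: "open {x::'a::{real_normed_algebra_1,banach}. alg_invertible x}"
proof (rule openI)
  fix x :: 'a assume x: "x \<in> {x. alg_invertible x}"
  define e where "e = 1 / (norm (ainv x) + 1)"
  have e: "e > 0" by (simp add: e_def add_nonneg_pos)
  have "alg_invertible y" if "norm (y - x) < e" for y
  proof (rule alg_invertible_near)
    show "alg_invertible x" using x by simp
    have "norm (y - x) * norm (ainv x) \<le> norm (y - x) * (norm (ainv x) + 1)"
      by (intro mult_left_mono) auto
    also have "\<dots> < e * (norm (ainv x) + 1)"
      using that by (intro mult_strict_right_mono) (auto simp: add_nonneg_pos)
    also have "\<dots> = 1"
    proof -
      have "norm (ainv x) + 1 > 0" by (simp add: add_nonneg_pos)
      then show ?thesis by (simp add: e_def)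
    qed
    finally show "norm (y - x) * norm (ainv x) < 1" .
  qed
  then show "\<exists>T>0. ball x T \<subseteq> {x. alg_invertible x}"
    using e by (intro exI[of _ e]) (auto simp: dist_norm norm_minus_commute)
qed

lemma continuous_on_ainv:
  "continuous_on {x::'a::{real_normed_algebra_1,banach}. alg_invertible x} ainv"
proof (unfold continuous_on_iff, intro ballI allI impI)
  fix x :: 'a and e :: real
  assume x: "x \<in> {x. alg_invertible x}" and e: "e > 0"
  let ?X = "norm (ainv x) + 1"
  have X: "?X > 0" by (simp add: add_nonneg_pos)
  \<comment> \<open>The first bound makes the coefficient of \<open>?n\<close> at most 1/2, so that
    \<open>?n\<close> is absorbed on the left; the second keeps the remaining term below
    \<open>e / 2\<close>.\<close>
  define d where "d = min (1 / (2 * ?X)) (e / (2 * ?X * ?X))"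
  have d: "d > 0" using e X by (simp add: d_def)
  have "dist (ainv y) (ainv x) < e" if y: "y \<in> {x. alg_invertible x}" "dist y x < d" for y
  proof -
    let ?n = "norm (ainv y - ainv x)"
    have "ainv y * (x - y) * ainv x = ainv y * (x * ainv x) - (ainv y * y) * ainv x"
      by (simp add: algebra_simps)
    then have eq: "ainv y - ainv x = ainv y * (x - y) * ainv x"
      using x y by (simp add: ainv_left ainv_right)
    have h: "norm (x - y) < d" using y by (simp add: dist_norm norm_minus_commute)
    have nx: "norm (x - y) * ?X \<le> 1/2" "norm (x - y) * (?X * ?X) < e/2"
    proof -
      have "norm (x - y) * ?X \<le> (1 / (2 * ?X)) * ?X"
        using h X by (intro mult_right_mono) (auto simp: d_def)
      also have "\<dots> = 1/2" using X by (simp add: divide_simps)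
      finally show "norm (x - y) * ?X \<le> 1/2" .
      have "norm (x - y) * (?X * ?X) < (e / (2 * ?X * ?X)) * (?X * ?X)"
        using h X by (intro mult_strict_right_mono) (auto simp: d_def)
      also have "\<dots> = e/2" using X by (simp add: divide_simps)
      finally show "norm (x - y) * (?X * ?X) < e/2" .
    qed
    have "norm (ainv y * (x - y) * ainv x) \<le> norm (ainv y) * norm (x - y) * norm (ainv x)"
      by (meson norm_mult_ineq order_trans mult_right_mono norm_ge_zero)
    also have "\<dots> \<le> (?n + norm (ainv x)) * norm (x - y) * norm (ainv x)"
      using norm_triangle_sub[of "ainv y" "ainv x"] by (intro mult_right_mono) auto
    also have "\<dots> \<le> (?n + ?X) * norm (x - y) * ?X"
      by (intro mult_mono) auto
    also have "\<dots> = ?n * (norm (x - y) * ?X) + norm (x - y) * (?X * ?X)"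
      by (simp add: algebra_simps)
    also have "\<dots> < ?n * (1/2) + e / 2"
      using nx by (intro add_le_less_mono mult_left_mono) auto
    finally have "?n < e" using eq by simp
    then show ?thesis by (simp add: dist_norm)
  qed
  then show "\<exists>d>0. \<forall>x'\<in>{x. alg_invertible x}. dist x' x < d \<longrightarrow> dist (ainv x') (ainv x) < e"
    using d by blast
qed

section \<open>Roots of unity\<close>

definition unity_roots :: "nat \<Rightarrow> complex set" where
  "unity_roots n = {z. z ^ n = 1}"

lemma card_unity_roots: "n > 0 \<Longrightarrow> card (unity_roots n) = n"
  by (simp add: unity_roots_def card_roots_unity_eq)

lemma norm_unity_roots:
  assumes "n > 0" "z \<in> unity_roots n"
  shows "cmod z = 1"
proof -
  have "cmod z ^ n = 1 ^ n"
    using assms by (simp add: unity_roots_def flip: norm_power)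
  then show ?thesis
    using assms(1) by (intro power_eq_imp_eq_base[of _ n 1]) auto
qed

text \<open>For distinct exponents, multiplication by a primitive root permutes the roots and
  multiplies the sum by a factor other than 1, so the sum vanishes.\<close>

lemma unity_roots_orthogonality:
  assumes "i < n" "l < n"
  shows "(\<Sum>z\<in>unity_roots n. inverse z ^ i * z ^ l) = (if i = l then of_nat n else 0)"
proof -
  have n: "n > 0" using assms by simp
  let ?F = "\<lambda>z::complex. inverse z ^ i * z ^ l"
  have nz: "z \<noteq> 0" if "z \<in> unity_roots n" for z
    using norm_unity_roots[OF n that] by auto
  show ?thesis
  proof (cases "i = l")
    case True
    have "?F z = 1" if "z \<in> unity_roots n" for z
      using nz[OF that] True by (simp flip: power_mult_distrib)
    then show ?thesis using True card_unity_roots[OF n] by simp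
  next
    case False
    define w where "w = cis (2 * pi * real 1 / real n)"
    have wk: "w ^ k = cis (2 * pi * real k / real n)" for k
      unfolding w_def Complex.DeMoivre by (rule arg_cong[of _ _ cis]) simp
    have w: "w \<in> unity_roots n"
      using wk[of n] n by (simp add: unity_roots_def)
    have "w ^ i \<noteq> w ^ l"
      using Complex.bij_betw_roots_unity[OF n] False assms unfolding bij_betw_def inj_on_def wk by auto
    then have ne: "?F w \<noteq> 1"
      using nz[OF w] by (simp add: field_simps)
    have "bij_betw ((*) w) (unity_roots n) (unity_roots n)"
    proof (rule bij_betwI[where g = "(*) (inverse w)"])
      have "w ^ n = 1" using w by (simp add: unity_roots_def)
      then show "(*) w \<in> unity_roots n \<rightarrow> unity_roots n"
        "(*) (inverse w) \<in> unity_roots n \<rightarrow> unity_roots n"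
        by (auto simp: unity_roots_def power_mult_distrib power_inverse)
    qed (use nz[OF w] in auto)
    then have "sum ?F (unity_roots n) = (\<Sum>z\<in>unity_roots n. ?F (w * z))"
      by (rule sum.reindex_bij_betw[symmetric])
    also have "\<dots> = ?F w * sum ?F (unity_roots n)"
      by (simp add: sum_distrib_left power_mult_distrib mult_ac)
    finally have "(1 - ?F w) * sum ?F (unity_roots n) = 0"
      by (simp add: left_diff_distrib)
    then show ?thesis using ne False by simp
  qed
qed

section \<open>C*-algebras: scalars and involution\<close>

locale cstar =
  fixes cs :: "complex \<Rightarrow> 'a::{real_normed_algebra_1,banach} \<Rightarrow> 'a" and st :: "'a \<Rightarrow> 'a"
  assumes cstar: "cstar_algebra cs st"
begin

text \<open>Complex scalars become central elements, so scalar multiplication is handled by the ring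
  laws alone; the type class itself supplies only real scalars.\<close>

definition emb :: "complex \<Rightarrow> 'a" where "emb c = cs c 1"

lemma cs_emb: "cs c x = emb c * x"
  using cstar unfolding cstar_algebra_def emb_def by (metis mult_1_left)

lemma emb_commute: "x * emb c = emb c * x"
  using cstar unfolding cstar_algebra_def emb_def by (metis mult_1_left mult_1_right)

lemma emb_left_commute: "x * (emb c * y) = emb c * (x * y)"
  by (metis emb_commute mult.assoc)

lemma emb_add: "emb (c + d) = emb c + emb d"
  using cstar unfolding cstar_algebra_def emb_def by blast

lemma emb_mult: "emb (c * d) = emb c * emb d"
  using cstar unfolding cstar_algebra_def emb_def by (metis mult_1_left)

lemma emb_of_real: "emb (of_real r) = r *\<^sub>R 1"
  using cstar unfolding cstar_algebra_def emb_def by simp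

lemma emb_1 [simp]: "emb 1 = 1" and emb_0 [simp]: "emb 0 = 0"
  using emb_of_real[of 1] emb_of_real[of 0] by simp_all

lemma emb_minus: "emb (- c) = - emb c"
  using emb_add[of c "- c"] by (simp add: eq_neg_iff_add_eq_0 add.commute)

lemma emb_diff: "emb (c - d) = emb c - emb d"
  using emb_add[of c "- d"] emb_minus by simp

lemma emb_power: "emb (c ^ n) = emb c ^ n"
  by (induction n) (simp_all add: emb_mult)

lemma emb_mult_power: "(emb c * x) ^ n = emb (c ^ n) * x ^ n"
  by (induction n) (simp_all add: emb_mult mult.assoc emb_left_commute[of x])

lemma emb_sum: "emb (sum f S) = (\<Sum>i\<in>S. emb (f i))"
  by (induction S rule: infinite_finite_induct) (simp_all add: emb_add)

lemma norm_emb_mult: "norm (emb c * x) = cmod c * norm x"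
  using cstar unfolding cstar_algebra_def by (metis cs_emb)

lemma norm_emb [simp]: "norm (emb c) = cmod c"
  using norm_emb_mult[of c 1] by simp

lemma emb_inverse: "c \<noteq> 0 \<Longrightarrow> emb c * emb (inverse c) = 1"
  by (simp flip: emb_mult)

lemma alg_invertible_emb: "c \<noteq> 0 \<Longrightarrow> alg_invertible (emb c)"
  unfolding alg_invertible_def using emb_inverse emb_commute by metis

lemma emb_of_real_mult: "emb (of_real r) * x = r *\<^sub>R x"
  by (simp add: emb_of_real)

lemma continuous_on_emb [continuous_intros]:
  "continuous_on S f \<Longrightarrow> continuous_on S (\<lambda>x. emb (f x))"
proof -
  have "bounded_linear emb"
  proof (rule bounded_linear_intro[where K = 1])
    show "emb (r *\<^sub>R x) = r *\<^sub>R emb x" for r x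
      by (simp add: scaleR_conv_of_real emb_mult emb_of_real)
  qed (simp_all add: emb_add)
  then show "continuous_on S f \<Longrightarrow> continuous_on S (\<lambda>x. emb (f x))"
    by (rule bounded_linear.continuous_on)
qed

lemma st_add: "st (x + y) = st x + st y"
  and st_mult: "st (x * y) = st y * st x"
  and st_st [simp]: "st (st x) = x"
  and norm_st_mult: "norm (st x * x) = (norm x)\<^sup>2"
  using cstar unfolding cstar_algebra_def by blast+

lemma st_1 [simp]: "st 1 = 1"
  by (metis mult_1_right st_mult st_st)

lemma st_emb: "st (emb c) = emb (cnj c)"
  using cstar unfolding cstar_algebra_def emb_def by (metis st_1)

lemma st_0 [simp]: "st 0 = 0"
  using st_emb[of 0] by simp

lemma st_scaleR: "st (r *\<^sub>R x) = r *\<^sub>R st x"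
  by (metis emb_of_real_mult emb_commute complex_cnj_complex_of_real st_emb st_mult)

lemma st_minus: "st (- x) = - st x"
  using st_scaleR[of "-1" x] by simp

lemma st_diff: "st (x - y) = st x - st y"
  using st_add[of x "- y"] by (simp add: st_minus)

lemma st_power: "st (x ^ n) = st x ^ n"
  by (induction n) (simp_all add: st_mult power_commutes)

lemma st_sum: "st (sum f S) = (\<Sum>i\<in>S. st (f i))"
  by (induction S rule: infinite_finite_induct) (simp_all add: st_add)

lemma norm_st [simp]: "norm (st x) = norm x"
proof -
  have le: "norm x \<le> norm (st x)" for x
  proof (cases "x = 0")
    case False
    have "norm x * norm x \<le> norm (st x) * norm x"
      using norm_mult_ineq[of "st x" x] by (simp add: norm_st_mult power2_eq_square)
    then show ?thesis using False by simp
  qed simp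
  show ?thesis using le[of x] le[of "st x"] by simp
qed

lemma norm_mult_st: "norm (x * st x) = (norm x)\<^sup>2"
  using norm_st_mult[of "st x"] by simp

lemma bounded_linear_st: "bounded_linear st"
  by (rule bounded_linear_intro[where K = 1]) (simp_all add: st_add st_scaleR)

text \<open>Discrete Fourier inversion for polynomials with coefficients in the algebra; the degree
  stays below \<open>n\<close>, so no two coefficients are confused.\<close>

lemma emb_unity_average:
  assumes "i < n"
  shows "(\<Sum>z\<in>unity_roots n. emb (inverse z ^ i) * (\<Sum>l<n. emb (z ^ l) * c l)) = real n *\<^sub>R c i"
proof -
  have "(\<Sum>z\<in>unity_roots n. emb (inverse z ^ i) * (\<Sum>l<n. emb (z ^ l) * c l))
      = (\<Sum>z\<in>unity_roots n. \<Sum>l<n. emb (inverse z ^ i * z ^ l) * c l)"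
    by (simp only: sum_distrib_left emb_mult mult.assoc)
  also have "\<dots> = (\<Sum>l<n. \<Sum>z\<in>unity_roots n. emb (inverse z ^ i * z ^ l) * c l)"
    by (rule sum.swap)
  also have "\<dots> = (\<Sum>l<n. emb (\<Sum>z\<in>unity_roots n. inverse z ^ i * z ^ l) * c l)"
    by (simp only: emb_sum sum_distrib_right)
  also have "\<dots> = (\<Sum>l<n. if l = i then real n *\<^sub>R c i else 0)"
  proof (intro sum.cong refl)
    fix l assume "l \<in> {..<n}"
    moreover have "emb (of_nat n) * c i = real n *\<^sub>R c i"
      using emb_of_real_mult[of "real n" "c i"] by simp
    ultimately show "emb (\<Sum>z\<in>unity_roots n. inverse z ^ i * z ^ l) * c l = (if l = i then real n *\<^sub>R c i else 0)"
      using assms unity_roots_orthogonality[of i n l] by simp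
  qed
  also have "\<dots> = real n *\<^sub>R c i"
    using assms by simp
  finally show ?thesis .
qed

text \<open>Averaging over roots of unity replaces Cauchy's integral formula.\<close>

lemma coefficient_bound:
  assumes R: "R > 0" and M: "\<And>z. cmod z = R \<Longrightarrow> norm (\<Sum>l<n. emb (z ^ l) * c l) \<le> M" and i: "i < n"
  shows "R ^ i * norm (c i) \<le> M"
proof -
  have n: "n > 0" using i by simp
  let ?d = "\<lambda>l. emb (of_real R ^ l) * c l"
  have "real n * norm (?d i) = norm (\<Sum>z\<in>unity_roots n. emb (inverse z ^ i) * (\<Sum>l<n. emb (z ^ l) * ?d l))"
    by (simp add: emb_unity_average[OF i])
  also have "\<dots> \<le> (\<Sum>z\<in>unity_roots n. M)"
  proof (rule sum_norm_le)
    fix z assume z: "z \<in> unity_roots n"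
    have "norm (\<Sum>l<n. emb ((z * of_real R) ^ l) * c l) \<le> M"
      using R norm_unity_roots[OF n z] by (intro M) (simp add: norm_mult)
    then show "norm (emb (inverse z ^ i) * (\<Sum>l<n. emb (z ^ l) * ?d l)) \<le> M"
      using norm_unity_roots[OF n z]
      by (simp add: norm_emb_mult norm_power norm_inverse power_mult_distrib emb_mult mult.assoc)
  qed
  also have "\<dots> = real n * M" by (simp add: card_unity_roots[OF n])
  finally have "norm (?d i) \<le> M" using n by simp
  then show ?thesis using R by (simp add: norm_emb_mult norm_power)
qed

text \<open>Since \<open>z ^ n = 1\<close>, the factor \<open>1 - (z u w) ^ n\<close> does not
  depend on \<open>z\<close>. It turns each resolvent into a geometric sum of degree below
  \<open>n\<close>, from which Fourier inversion extracts one power.\<close>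

lemma resolvent_average:
  assumes n: "n > 0" and inv: "\<And>z. z \<in> unity_roots n \<Longrightarrow> alg_invertible (1 - emb (z * u) * w)" and i: "i < n"
  shows "(\<Sum>z\<in>unity_roots n. emb (inverse z ^ i) * ainv (1 - emb (z * u) * w)) * (1 - (emb u * w) ^ n)
     = real n *\<^sub>R (emb u * w) ^ i"
proof -
  let ?v = "emb u * w"
  have "ainv (1 - emb (z * u) * w) * (1 - ?v ^ n) = (\<Sum>l<n. emb (z ^ l) * ?v ^ l)"
    if z: "z \<in> unity_roots n" for z
  proof -
    let ?y = "emb z * ?v"
    have pw: "(emb z * ?v) ^ l = emb (z ^ l) * ?v ^ l" for l
      by (rule emb_mult_power)
    have y: "emb (z * u) * w = ?y" by (simp add: emb_mult mult.assoc)
    have "z ^ n = 1" using z by (simp add: unity_roots_def)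
    then have yn: "?y ^ n = ?v ^ n" by (simp add: pw)
    have "(1 - ?y) * (\<Sum>l<n. ?y ^ l) = 1 - ?y ^ n"
      by (rule one_diff_mult_geometric)
    then have "ainv (1 - ?y) * (1 - ?y ^ n) = (ainv (1 - ?y) * (1 - ?y)) * (\<Sum>l<n. ?y ^ l)"
      by (simp add: mult.assoc)
    also have "\<dots> = (\<Sum>l<n. ?y ^ l)"
      using inv[OF z] by (simp add: ainv_left y)
    finally have "ainv (1 - ?y) * (1 - ?v ^ n) = (\<Sum>l<n. ?y ^ l)"
      unfolding yn .
    then show ?thesis by (simp only: y pw)
  qed
  then have "(\<Sum>z\<in>unity_roots n. emb (inverse z ^ i) * ainv (1 - emb (z * u) * w)) * (1 - ?v ^ n)
     = (\<Sum>z\<in>unity_roots n. emb (inverse z ^ i) * (\<Sum>l<n. emb (z ^ l) * ?v ^ l))"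
    by (simp add: sum_distrib_right mult.assoc)
  also have "\<dots> = real n *\<^sub>R ?v ^ i" by (rule emb_unity_average[OF i])
  finally show ?thesis .
qed

text \<open>An elementary Gelfand formula. The average of \<open>(1 - z t w)\<inverse>\<close> over the roots of unity \<open>z\<close> is
  \<open>(1 - (t w)\<^sup>n)\<inverse>\<close>; by uniform continuity of the resolvent, boundedness of \<open>(t w)\<^sup>n\<close> in \<open>n\<close> therefore
  passes from \<open>t = 0\<close> to \<open>t = 1 / m\<close> in finitely many steps.\<close>

lemma power_growth:
  assumes m: "m > 0" and inv: "\<And>z. cmod z \<ge> m \<Longrightarrow> alg_invertible (emb z - w)"
  shows "\<exists>C. \<forall>n. norm (w ^ n) \<le> C * m ^ n"
proof -
  define r where "r = 1 / m"
  have r: "r > 0" using m by (simp add: r_def)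
  have inv': "alg_invertible (1 - emb z * w)" if "cmod z \<le> r" for z
  proof (cases "z = 0")
    case False
    have "cmod (inverse z) \<ge> m"
      using that m False by (simp add: r_def norm_inverse norm_divide divide_simps mult.commute)
    then have "alg_invertible (emb z * (emb (inverse z) - w))"
      by (intro alg_invertible_mult alg_invertible_emb inv False)
    moreover have "emb z * (emb (inverse z) - w) = 1 - emb z * w"
      using emb_inverse[OF False] by (simp add: right_diff_distrib)
    ultimately show ?thesis by simp
  qed simp
  define f where "f z = ainv (1 - emb z * w)" for z
  have "continuous_on (cball 0 r) f"
    unfolding f_def
    by (rule continuous_on_compose2[OF continuous_on_ainv])
       (auto intro!: continuous_intros inv')
  then have "uniformly_continuous_on (cball 0 r) f"
    by (intro compact_uniformly_continuous) auto
  then obtain d where d: "d > 0"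
    "\<And>z z'. z \<in> cball 0 r \<Longrightarrow> z' \<in> cball 0 r \<Longrightarrow> dist z' z < d \<Longrightarrow> dist (f z') (f z) < 1/6"
    unfolding uniformly_continuous_on_def by (metis zero_less_divide_1_iff zero_less_numeral)
  define g where "g n t = (1 / real n) *\<^sub>R (\<Sum>z\<in>unity_roots n. f (z * of_real t))" for n t
  have g: "g n t * (1 - t ^ n *\<^sub>R w ^ n) = 1" if n: "n > 0" and t: "0 \<le> t" "t \<le> r" for n t
  proof -
    have "(\<Sum>z\<in>unity_roots n. f (z * of_real t)) * (1 - (emb (of_real t) * w) ^ n) = real n *\<^sub>R 1"
      using resolvent_average[OF n, of "of_real t" w 0] n t inv'
      by (simp add: f_def norm_mult norm_unity_roots)
    moreover have "(emb (of_real t) * w) ^ n = t ^ n *\<^sub>R w ^ n"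
      unfolding emb_mult_power by (simp flip: of_real_power add: emb_of_real_mult)
    ultimately show ?thesis using n by (simp add: g_def)
  qed
  define B where "B t \<longleftrightarrow> (\<exists>C. \<forall>n. t ^ n * norm (w ^ n) \<le> C)" for t
  \<comment> \<open>The value 1/4 puts \<open>g n s\<close> within 1/3 of 1. Moving from
    \<open>s\<close> to \<open>t\<close> costs 1/6, so \<open>g n t\<close> is within 1/2 of 1, and
    half of \<open>norm (1 - ?z)\<close> can be absorbed: it is at most 2, hence
    \<open>norm ?z\<close> at most 3.\<close>
  have step: "B t" if s: "0 \<le> s" "s \<le> t" "t \<le> r" "t - s < d"
    and lim: "(\<lambda>n. s ^ n * norm (w ^ n)) \<longlonglongrightarrow> 0" for s t
  proof -
    have "eventually (\<lambda>n. s ^ n * norm (w ^ n) < 1/4 \<and> n > 0) sequentially"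
      by (intro eventually_conj order_tendstoD(2)[OF lim] eventually_gt_at_top) simp
    then obtain n0 where n0: "\<And>n. n \<ge> n0 \<Longrightarrow> s ^ n * norm (w ^ n) < 1/4 \<and> n > 0"
      unfolding eventually_sequentially by blast
    have big: "t ^ n * norm (w ^ n) \<le> 3" if "n \<ge> n0" for n
    proof -
      have n: "n > 0" and y: "norm (s ^ n *\<^sub>R w ^ n) \<le> 1/4"
        using n0[OF that] s by auto
      let ?y = "s ^ n *\<^sub>R w ^ n" and ?z = "t ^ n *\<^sub>R w ^ n"
      have e: "g n s - 1 = g n s * ?y"
        using g[OF n, of s] s by (simp add: right_diff_distrib algebra_simps)
      have a: "norm (g n s * ?y) \<le> norm (g n s) * (1/4)"
        by (rule order_trans[OF norm_mult_ineq mult_left_mono[OF y]]) simp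
      have "norm (g n s) \<le> norm (g n s - 1) + 1"
        using norm_triangle_ineq[of "g n s - 1" 1] by simp
      with a have "norm (g n s) \<le> 4/3" unfolding e by simp
      with a have b: "norm (g n s - 1) \<le> 1/3" unfolding e by simp
      have "norm ((\<Sum>z\<in>unity_roots n. f (z * of_real t)) - (\<Sum>z\<in>unity_roots n. f (z * of_real s)))
         \<le> (\<Sum>z\<in>unity_roots n. 1/6)"
        unfolding sum_subtractf[symmetric]
      proof (rule sum_norm_le)
        fix z assume "z \<in> unity_roots n"
        then have z: "cmod z = 1" by (rule norm_unity_roots[OF n])
        have "cmod (z * of_real t - z * of_real s) = \<bar>t - s\<bar>"
          using z by (simp add: norm_mult flip: right_diff_distrib of_real_diff)
        then have "dist (f (z * of_real t)) (f (z * of_real s)) < 1/6"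
          using s z by (intro d) (auto simp: norm_mult dist_norm)
        then show "norm (f (z * of_real t) - f (z * of_real s)) \<le> 1/6"
          by (simp add: dist_norm)
      qed
      then have "norm (g n t - g n s) \<le> 1/6"
        using n unfolding g_def scaleR_diff_right[symmetric]
        by (simp add: card_unity_roots divide_simps mult.commute)
      then have c: "norm (g n t - 1) \<le> 1/2"
        using b norm_triangle_ineq[of "g n t - g n s" "g n s - 1"] by simp
      have "1 - ?z = 1 - (g n t - 1) * (1 - ?z)"
        using g[OF n, of t] s by (simp add: left_diff_distrib)
      then have "norm (1 - ?z) \<le> 1 + norm ((g n t - 1) * (1 - ?z))"
        using norm_triangle_ineq4[of 1 "(g n t - 1) * (1 - ?z)"] by simp
      also have "norm ((g n t - 1) * (1 - ?z)) \<le> (1/2) * norm (1 - ?z)"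
        by (rule order_trans[OF norm_mult_ineq mult_right_mono[OF c]]) simp
      finally have "norm (1 - ?z) \<le> 2" by simp
      then have "norm ?z \<le> 3"
        using norm_triangle_sub[of ?z 1] by (simp add: norm_minus_commute)
      then show ?thesis using s by simp
    qed
    have "t ^ n * norm (w ^ n) \<le> 3 + (\<Sum>k<n0. t ^ k * norm (w ^ k))" for n
    proof (cases "n < n0")
      case True
      then have "t ^ n * norm (w ^ n) \<le> (\<Sum>k<n0. t ^ k * norm (w ^ k))"
        using s by (intro member_le_sum) auto
      then show ?thesis by simp
    next
      case False
      moreover have "(\<Sum>k<n0. t ^ k * norm (w ^ k)) \<ge> 0"
        using s by (intro sum_nonneg) auto
      ultimately show ?thesis using big[of n] by simp
    qed
    then show "B t" unfolding B_def by blast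
  qed
  have "B (min (real k * (d / 2)) r)" for k
  proof (induction k)
    case 0
    have "0 ^ n * norm (w ^ n) \<le> 1" for n by (cases n) auto
    then show ?case using r unfolding B_def by auto
  next
    case (Suc k)
    let ?s = "min (real k * (d / 2)) r" and ?t = "min (real (Suc k) * (d / 2)) r"
    \<comment> \<open>Boundedness at \<open>?s\<close> gives geometric decay only strictly below
      \<open>?s\<close>. Stepping back by \<open>d / 4\<close> provides it and still leaves
      \<open>?t - s\<close> below \<open>d\<close>.\<close>
    define s where "s = max 0 (?s - d / 4)"
    have s0: "0 \<le> ?s" using r d(1) by simp
    have st: "?s \<le> ?t" "?t \<le> ?s + d / 2"
      using d(1) by (auto simp: min_def algebra_simps)
    show ?case
    proof (rule step[of s])
      have "0 \<le> s" "s \<le> ?s" "?s - d / 4 \<le> s"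
        unfolding s_def using s0 d(1) by linarith+
      then show "0 \<le> s" "s \<le> ?t" "?t \<le> r" "?t - s < d"
        using st d(1) by linarith+
      show "(\<lambda>n. s ^ n * norm (w ^ n)) \<longlonglongrightarrow> 0"
      proof (cases "s = 0")
        case True
        have "eventually (\<lambda>n. s ^ n * norm (w ^ n) = 0) sequentially"
          using eventually_gt_at_top[of 0] by eventually_elim (simp add: True)
        then show ?thesis by (rule tendsto_eventually)
      next
        case False
        then have ss: "0 < s" "s < ?s" using s0 d(1) unfolding s_def by linarith+
        obtain C where C: "\<And>n. ?s ^ n * norm (w ^ n) \<le> C"
          using Suc.IH unfolding B_def by blast
        show ?thesis
        proof (rule Lim_null_comparison)
          show "\<forall>\<^sub>F n in sequentially. norm (s ^ n * norm (w ^ n)) \<le> C * (s / ?s) ^ n"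
          proof (intro always_eventually allI)
            fix n
            have "s ^ n * norm (w ^ n) = (v ^ n * norm (w ^ n)) * (s / v) ^ n" if "v > 0" for v
              using that by (simp add: power_divide)
            then have "s ^ n * norm (w ^ n) = (?s ^ n * norm (w ^ n)) * (s / ?s) ^ n"
              using ss by (meson less_trans)
            also have "\<dots> \<le> C * (s / ?s) ^ n"
              using ss by (intro mult_right_mono C) auto
            finally show "norm (s ^ n * norm (w ^ n)) \<le> C * (s / ?s) ^ n"
              using ss by simp
          qed
          have "(\<lambda>n. (s / ?s) ^ n) \<longlonglongrightarrow> 0"
            using ss by (intro LIMSEQ_realpow_zero) auto
          then show "(\<lambda>n. C * (s / ?s) ^ n) \<longlonglongrightarrow> 0"
            by (rule tendsto_mult_right_zero)
        qed
      qed
    qed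
  qed
  moreover obtain k :: nat where "real k * (d / 2) \<ge> r"
    using d(1) by (metis real_arch_simple pos_divide_le_eq half_gt_zero)
  ultimately have "B r" by (metis min_absorb2)
  then obtain C where C: "\<And>n. r ^ n * norm (w ^ n) \<le> C" unfolding B_def by blast
  have "norm (w ^ n) \<le> C * m ^ n" for n
    using C[of n] m by (simp add: r_def power_divide divide_simps)
  then show ?thesis by blast
qed

section \<open>The spectrum and the spectral radius\<close>

abbreviation sr :: "'a \<Rightarrow> real" where "sr \<equiv> spec_radius cs"

lemma spec_iff: "z \<in> spec cs x \<longleftrightarrow> \<not> alg_invertible (x - emb z)"
  by (simp add: spec_def emb_def)

lemma norm_ge_spec:
  assumes "z \<in> spec cs x"
  shows "cmod z \<le> norm x"
proof (rule ccontr)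
  assume a: "\<not> cmod z \<le> norm x"
  then have z: "z \<noteq> 0" by auto
  have "norm (emb (inverse z) * x) < 1"
    using a z by (simp add: norm_emb_mult norm_inverse norm_divide divide_simps)
  then have "alg_invertible (emb z * (1 - emb (inverse z) * x))"
    by (intro alg_invertible_mult alg_invertible_emb z neumann)
  moreover have "emb z * (1 - emb (inverse z) * x) = emb z - x"
    using emb_inverse[OF z] by (simp add: right_diff_distrib flip: mult.assoc)
  ultimately show False
    using assms by (simp add: spec_iff alg_invertible_diff_commute)
qed

text \<open>With empty spectrum, \<open>x\<close> has an inverse \<open>y\<close>, and
  \<open>power_growth\<close> holds for every rate. A rate \<open>m\<close> with
  \<open>m * norm y\<close> at most 1/2 contradicts \<open>x ^ n * y ^ n = 1\<close> for large
  \<open>n\<close>.\<close>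

lemma spec_nonempty: "spec cs x \<noteq> {}"
proof
  assume "spec cs x = {}"
  then have inv: "alg_invertible (emb z - x)" for z
    by (metis alg_invertible_diff_commute empty_iff spec_iff)
  have "alg_invertible x" using inv[of 0] by (simp add: alg_invertible_minus)
  then obtain y where y: "x * y = 1" "y * x = 1"
    unfolding alg_invertible_def by blast
  define m where "m = 1 / (2 * (norm y + 1))"
  have yp: "norm y + 1 > 0" by (simp add: add_nonneg_pos)
  then have m: "m > 0" "m * norm y \<le> 1/2" by (auto simp: m_def field_simps)
  obtain C where C: "\<And>n. norm (x ^ n) \<le> C * m ^ n"
    using power_growth[OF m(1)] inv by blast
  have C0: "C \<ge> 1" using C[of 0] by simp
  have bd: "1 \<le> C * (1/2) ^ n" for n
  proof -
    have "x ^ n * y ^ n = 1"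
    proof (induction n)
      case (Suc n)
      have "x ^ Suc n * y ^ Suc n = x ^ n * (x * y) * y ^ n"
        by (metis mult.assoc power_Suc power_Suc2)
      then show ?case using Suc y by simp
    qed simp
    then have "1 \<le> norm (x ^ n) * norm (y ^ n)"
      using norm_mult_ineq[of "x ^ n" "y ^ n"] by simp
    also have "\<dots> \<le> (C * m ^ n) * norm y ^ n"
      using C m C0 by (intro mult_mono norm_power_ineq) auto
    also have "\<dots> = C * (m * norm y) ^ n" by (simp add: power_mult_distrib)
    also have "\<dots> \<le> C * (1/2) ^ n"
      using m C0 by (intro mult_left_mono power_mono) auto
    finally show ?thesis .
  qed
  have "(\<lambda>n. C * (1/2::real) ^ n) \<longlonglongrightarrow> 0"
    by (intro tendsto_mult_right_zero LIMSEQ_realpow_zero) auto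
  then have "1 \<le> (0::real)"
    using bd by (intro LIMSEQ_le_const) auto
  then show False by simp
qed

lemma sr_upper: "z \<in> spec cs x \<Longrightarrow> cmod z \<le> sr x"
  unfolding spec_radius_def
  by (intro cSup_upper) (auto simp: bdd_above_def intro: norm_ge_spec)

lemma sr_least: "(\<And>z. z \<in> spec cs x \<Longrightarrow> cmod z \<le> c) \<Longrightarrow> sr x \<le> c"
  unfolding spec_radius_def using spec_nonempty by (intro cSup_least) auto

lemma sr_nonneg: "sr x \<ge> 0"
  using spec_nonempty[of x] sr_upper by (metis norm_ge_zero order_trans ex_in_conv)

lemma sr_le_norm: "sr x \<le> norm x"
  by (rule sr_least) (rule norm_ge_spec)

lemma sr_growth:
  assumes "sr x < m"
  shows "\<exists>C. \<forall>n. norm (x ^ n) \<le> C * m ^ n"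
proof (rule power_growth)
  show "m > 0" using assms sr_nonneg[of x] by simp
  show "alg_invertible (emb z - x)" if "cmod z \<ge> m" for z
    using sr_upper[of z x] that assms by (auto simp: spec_iff alg_invertible_diff_commute)
qed

text \<open>The cofactor of \<open>x - z\<close> in \<open>x ^ n - z ^ n\<close> commutes with
  \<open>x - z\<close>, so invertibility of the difference of powers passes to
  \<open>x - z\<close>.\<close>

lemma spec_power:
  assumes "z \<in> spec cs x"
  shows "z ^ n \<in> spec cs (x ^ n)"
proof -
  have "\<exists>s. x ^ n - emb z ^ n = (x - emb z) * s \<and> (x - emb z) * s = s * (x - emb z)"
  proof (induction n)
    case 0
    show ?case by (rule exI[of _ 0]) simp
  next
    case (Suc n)
    let ?c = "emb z"
    obtain s where s: "x ^ n - ?c ^ n = (x - ?c) * s" "(x - ?c) * s = s * (x - ?c)"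
      using Suc by blast
    have cx: "?c * y = y * ?c" for y by (simp add: emb_commute)
    have cn: "?c ^ n * y = y * ?c ^ n" for y by (metis emb_commute emb_power)
    have xc: "x * (x - ?c) = (x - ?c) * x" by (simp add: algebra_simps cx)
    have "x ^ Suc n - ?c ^ Suc n = x * (x ^ n - ?c ^ n) + (x - ?c) * ?c ^ n"
      by (simp add: algebra_simps)
    also have "\<dots> = (x - ?c) * (x * s + ?c ^ n)"
      unfolding s(1) by (simp add: distrib_left xc flip: mult.assoc)
    finally have 1: "x ^ Suc n - ?c ^ Suc n = (x - ?c) * (x * s + ?c ^ n)" .
    have "(x * s + ?c ^ n) * (x - ?c) = x * (s * (x - ?c)) + ?c ^ n * (x - ?c)"
      by (simp add: distrib_right mult.assoc)
    also have "\<dots> = (x - ?c) * (x * s) + (x - ?c) * ?c ^ n"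
      unfolding s(2)[symmetric] cn[of "x - ?c"] by (simp add: xc flip: mult.assoc)
    finally show ?case using 1 by (intro exI[of _ "x * s + ?c ^ n"]) (simp add: distrib_left)
  qed
  then show ?thesis
    using assms unfolding spec_iff emb_power by (metis alg_invertible_factor)
qed

lemma sr_le_of_power:
  assumes "norm (x ^ n) \<le> c ^ n" "n > 0" "c \<ge> 0"
  shows "sr x \<le> c"
proof (rule sr_least)
  fix z assume "z \<in> spec cs x"
  from norm_ge_spec[OF spec_power[OF this, of n]] have "cmod z ^ n \<le> c ^ n"
    using assms(1) unfolding norm_power by (rule order_trans)
  then show "cmod z \<le> c"
    using power_strict_mono[of c "cmod z" n] assms(2,3) by (meson not_le)
qed

text \<open>The factor \<open>n + 1\<close> is allowed because \<open>three_circles\<close> sums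
  that many coefficients; it is lost against the geometric decay of
  \<open>(m / cmod z) ^ n\<close>.\<close>

lemma sr_le_of_growth:
  assumes C: "\<And>n. norm (x ^ n) \<le> C * (real n + 1) * m ^ n" and m: "m \<ge> 0"
  shows "sr x \<le> m"
proof (rule sr_least, rule ccontr)
  fix z assume z: "z \<in> spec cs x" and "\<not> cmod z \<le> m"
  then have zm: "m < cmod z" by simp
  then have z0: "0 < cmod z" using m by linarith
  let ?q = "m / cmod z"
  have q: "0 \<le> ?q" "?q < 1" using zm z0 m by (auto simp: field_simps)
  have bd: "1 \<le> C * (real n * ?q ^ n + ?q ^ n)" for n
  proof -
    have "cmod z ^ n \<le> C * (real n + 1) * m ^ n"
      using norm_ge_spec[OF spec_power[OF z, of n]] C[of n] by (simp add: norm_power)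
    then have "1 \<le> (C * (real n + 1) * m ^ n) / cmod z ^ n"
      using z0 by (simp add: field_simps)
    also have "\<dots> = C * (real n * ?q ^ n + ?q ^ n)"
      by (simp add: power_divide algebra_simps add_divide_distrib)
    finally show ?thesis .
  qed
  have "(\<lambda>n. C * (real n * ?q ^ n + ?q ^ n)) \<longlonglongrightarrow> C * (0 + 0)"
    using q powser_times_n_limit_0[of ?q]
    by (intro tendsto_intros LIMSEQ_realpow_zero) auto
  then have "1 \<le> C * (0 + 0)"
    using bd by (intro LIMSEQ_le_const) auto
  then show False by simp
qed

text \<open>Growth of powers determines the spectral radius. This covers the adjoint and
  multiplication by -1 or i at once.\<close>

lemma sr_le_of_norm_power_eq:
  assumes "\<And>n. norm (y ^ n) = norm (x ^ n)"
  shows "sr y \<le> sr x"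
proof (rule dense_ge)
  fix m assume "sr x < m"
  then obtain C where C: "\<And>n. norm (x ^ n) \<le> C * m ^ n" using sr_growth by blast
  have m: "m > 0" using \<open>sr x < m\<close> sr_nonneg[of x] by simp
  have C0: "C \<ge> 0" using order_trans[OF norm_ge_zero C[of 0]] by simp
  show "sr y \<le> m"
  proof (rule sr_le_of_growth[where C = C])
    fix n
    have "norm (y ^ n) \<le> C * 1 * m ^ n" using C assms by simp
    also have "\<dots> \<le> C * (real n + 1) * m ^ n"
      using C0 m by (intro mult_right_mono mult_left_mono) auto
    finally show "norm (y ^ n) \<le> C * (real n + 1) * m ^ n" .
  qed (use m in simp)
qed

lemma sr_st: "sr (st x) \<le> sr x"
  by (rule sr_le_of_norm_power_eq) (simp flip: st_power)

text \<open>The C*-identity makes the norm exactly multiplicative along the powers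
  \<open>x ^ (2 ^ k)\<close>, which rules out any growth rate below \<open>norm x\<close>.\<close>

lemma sr_hermitian:
  assumes "st x = x"
  shows "sr x = norm x"
proof (rule antisym[OF sr_le_norm], rule ccontr)
  assume "\<not> norm x \<le> sr x"
  then obtain m where m: "sr x < m" "m < norm x" using dense[of "sr x" "norm x"] by auto
  obtain C where C: "\<And>n. norm (x ^ n) \<le> C * m ^ n" using sr_growth[OF m(1)] by blast
  have m0: "m > 0" using m sr_nonneg[of x] by simp
  have e: "norm (x ^ (2 ^ k)) = norm x ^ (2 ^ k)" for k
  proof (induction k)
    case (Suc k)
    have "norm (x ^ (2 ^ Suc k)) = norm (st (x ^ (2 ^ k)) * x ^ (2 ^ k))"
      using assms by (simp add: st_power mult_2 power_add)
    also have "\<dots> = (norm x ^ (2 ^ k))\<^sup>2" by (simp only: norm_st_mult Suc)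
    also have "\<dots> = norm x ^ (2 ^ Suc k)" by (simp add: mult.commute flip: power_mult)
    finally show ?case .
  qed simp
  let ?q = "norm x / m"
  have q: "?q > 1" using m m0 by simp
  obtain n where n: "?q ^ n > C" using real_arch_pow[OF q] by blast
  have "?q ^ n \<le> ?q ^ (2 ^ n)"
    using q by (intro power_increasing less_imp_le[OF less_exp]) auto
  also have "\<dots> \<le> C"
    using C[of "2 ^ n"] m0 unfolding e by (simp add: power_divide divide_simps)
  finally show False using n by simp
qed

lemma sr_zero_selfadjoint:
  assumes "sr x = 0" "st x = x \<or> st x = - x"
  shows "x = 0"
proof (cases "st x = x")
  case True
  then show ?thesis using sr_hermitian assms by simp
next
  case False
  let ?y = "emb \<i> * x"
  have "st ?y = - (x * emb (- \<i>))" using assms False by (simp add: st_mult st_emb)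
  then have "st ?y = ?y" by (simp add: emb_minus emb_commute)
  moreover have "sr ?y \<le> sr x"
    by (rule sr_le_of_norm_power_eq) (simp add: emb_mult_power norm_emb_mult norm_power)
  ultimately have "norm ?y \<le> 0" using sr_hermitian assms by simp
  then show ?thesis by (simp add: norm_emb_mult)
qed

text \<open>One inequality \<open>norm (x ^ n) < c ^ n\<close> bounds the spectral radius and is an
  open condition on \<open>x\<close>. The last conclusion exports such an exponent for the
  compactness argument below.\<close>

lemma sr_upper_semicontinuous:
  assumes "sr x < m"
  obtains e where "e > 0" "\<And>y. norm (y - x) < e \<Longrightarrow> sr y < m"
    "\<exists>n>0. norm (x ^ n) < m ^ n"
proof -
  obtain c where c: "sr x < c" "c < m" using dense assms by blast
  then obtain b where b: "sr x < b" "b < c" using dense by blast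
  have b0: "b > 0" using b sr_nonneg[of x] by simp
  obtain C where C: "\<And>n. norm (x ^ n) \<le> C * b ^ n" using sr_growth[OF b(1)] by blast
  have "1 < c / b" using b b0 by simp
  then obtain n0 where n0: "(c / b) ^ n0 > C" using real_arch_pow by blast
  define n where "n = Suc n0"
  have "C < (c / b) ^ n"
    using n0 power_increasing[of n0 n "c / b"] \<open>1 < c / b\<close> by (simp add: n_def)
  then have "C * b ^ n < c ^ n" using b0 by (simp add: power_divide field_simps)
  then have n: "norm (x ^ n) < c ^ n" using C[of n] by simp
  have "open {y::'a. norm (y ^ n) < c ^ n}"
    by (intro open_Collect_less continuous_on_norm continuous_on_power continuous_on_const continuous_on_id)
  then obtain e where e: "e > 0" "ball x e \<subseteq> {y. norm (y ^ n) < c ^ n}"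
    using n open_contains_ball by blast
  show thesis
  proof
    show "e > 0" by fact
    show "sr y < m" if "norm (y - x) < e" for y
    proof -
      have "norm (y ^ n) < c ^ n"
        using e(2) that by (auto simp: dist_norm norm_minus_commute)
      then have "sr y \<le> c"
        using b b0 by (intro sr_le_of_power[where n = n]) (auto simp: n_def)
      then show ?thesis using c by simp
    qed
    have "c ^ n < m ^ n" using c b b0 by (intro power_strict_mono) (auto simp: n_def)
    then show "\<exists>n>0. norm (x ^ n) < m ^ n"
      using n by (intro exI[of _ n]) (auto simp: n_def)
  qed
qed

text \<open>By compactness finitely many exponents serve all of \<open>K\<close>. Dividing
  \<open>N\<close> by the one that fits \<open>w\<close> leaves a bounded remainder, which costs the
  constant factor \<open>(M / m) ^ L\<close>.\<close>

lemma sr_uniform_growth: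
  assumes K: "compact K" and m: "m > 0" and sr: "\<And>w. w \<in> K \<Longrightarrow> sr w < m"
  obtains C where "\<And>w N. w \<in> K \<Longrightarrow> norm (w ^ N) \<le> C * m ^ N"
proof -
  define U where "U n = {w::'a. norm (w ^ n) < m ^ n}" for n
  have "K \<subseteq> (\<Union>n\<in>{0<..}. U n)"
    using sr sr_upper_semicontinuous unfolding U_def by blast
  moreover have "open (U n)" for n
    unfolding U_def by (intro open_Collect_less continuous_on_norm continuous_on_power continuous_on_const continuous_on_id)
  ultimately obtain F where F: "F \<subseteq> {0<..}" "finite F" "K \<subseteq> (\<Union>n\<in>F. U n)"
    using compactE_image[OF K, of "{0<..}" U] by metis
  obtain b where b: "\<And>w. w \<in> K \<Longrightarrow> norm w \<le> b"
    using compact_imp_bounded[OF K] by (auto simp: bounded_iff)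
  define M where "M = max m b"
  have M: "m \<le> M" "\<And>w. w \<in> K \<Longrightarrow> norm w \<le> M" using b by (force simp: M_def)+
  define L where "L = Max F"
  have "norm (w ^ N) \<le> (M / m) ^ L * m ^ N" if w: "w \<in> K" for w N
  proof -
    obtain n where n: "n \<in> F" "norm (w ^ n) < m ^ n" using F(3) w by (auto simp: U_def)
    have n0: "n > 0" "n \<le> L" using F n by (auto simp: L_def)
    let ?q = "N div n" and ?s = "N mod n"
    have "w ^ N = (w ^ n) ^ ?q * w ^ ?s"
      by (simp flip: power_mult power_add)
    then have "norm (w ^ N) \<le> norm ((w ^ n) ^ ?q) * norm (w ^ ?s)"
      by (simp add: norm_mult_ineq)
    also have "\<dots> \<le> norm (w ^ n) ^ ?q * norm w ^ ?s"
      by (intro mult_mono norm_power_ineq) auto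
    also have "\<dots> \<le> (m ^ n) ^ ?q * M ^ ?s"
      using n M(2)[OF w] m by (intro mult_mono power_mono) auto
    also have "M ^ ?s = (M / m) ^ ?s * m ^ ?s"
      using m by (simp add: power_divide)
    also have "(m ^ n) ^ ?q * ((M / m) ^ ?s * m ^ ?s) = (M / m) ^ ?s * m ^ N"
      by (simp add: mult.left_commute flip: power_mult power_add)
    also have "\<dots> \<le> (M / m) ^ L * m ^ N"
    proof (intro mult_right_mono power_increasing)
      show "?s \<le> L" using n0 mod_less_divisor[of n N] by linarith
    qed (use M(1) m in auto)
    finally show ?thesis .
  qed
  then show thesis by (rule that)
qed

end

section \<open>Bounded spectral isometries\<close>

text \<open>Baire category gives a dense image of a ball; the halving iteration below upgrades density
  to a bound.\<close>

theorem closed_graph_bounded: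
  fixes T :: "'a::banach \<Rightarrow> 'b::banach"
  assumes lin: "linear T"
    and closed: "\<And>x b. x \<longlonglongrightarrow> 0 \<Longrightarrow> (\<lambda>n. T (x n)) \<longlonglongrightarrow> b \<Longrightarrow> b = 0"
  shows "bounded_linear T"
proof -
  define V where "V n = {x. norm (T x) \<le> real n}" for n :: nat
  have "\<exists>n. interior (closure (V n)) \<noteq> {}"
  proof (rule ccontr)
    assume "\<not> ?thesis"
    then have e: "interior (closure (V n)) = {}" for n by blast
    have "euclidean interior_of \<Union>(range (\<lambda>n. closure (V n))) = {}"
      by (rule Baire_category_alt)
         (use e in \<open>auto intro!: disjI1 completely_metrizable_space_euclidean\<close>)
    moreover have "\<Union>(range (\<lambda>n. closure (V n))) = UNIV"
    proof -
      have "x \<in> closure (V (nat \<lceil>norm (T x)\<rceil>))" for x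
        by (rule subsetD[OF closure_subset]) (simp add: V_def real_nat_ceiling_ge)
      then show ?thesis by blast
    qed
    ultimately show False by simp
  qed
  then obtain n a where "a \<in> interior (closure (V n))" by blast
  then obtain \<rho> where \<rho>: "\<rho> > 0" "ball a \<rho> \<subseteq> closure (V n)"
    by (auto simp: mem_interior)
  \<comment> \<open>Subtracting approximants of \<open>a + h\<close> and of \<open>a\<close> moves
    the ball to the origin and doubles the bound.\<close>
  have dense0: "\<exists>y. norm (T y) \<le> 2 * real n \<and> norm (h - y) < e" if h: "norm h < \<rho>" and e: "e > 0" for h e
  proof -
    have "a + h \<in> closure (V n)" "a \<in> closure (V n)"
      using \<rho> h by (auto simp: dist_norm)
    then obtain y y' where y: "y \<in> V n" "dist y (a + h) < e/2" "y' \<in> V n" "dist y' a < e/2"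
      using e unfolding closure_approachable by (meson half_gt_zero)
    have "norm (T (y - y')) \<le> 2 * real n"
      using y norm_triangle_ineq4[of "T y" "T y'"] by (simp add: V_def linear_diff[OF lin])
    moreover have "norm (h - (y - y')) < e"
    proof -
      have "h - (y - y') = (a + h - y) + (y' - a)" by simp
      then have "norm (h - (y - y')) \<le> norm (a + h - y) + norm (y' - a)"
        by (metis norm_triangle_ineq)
      then show ?thesis using y by (simp add: dist_norm norm_minus_commute)
    qed
    ultimately show ?thesis by blast
  qed
  \<comment> \<open>Scaling \<open>r\<close> to norm \<open>\<rho> / 2\<close>, approximating with
    bound \<open>2 * n\<close>, and scaling back gives this factor.\<close>
  define M where "M = 4 * real n / \<rho>"
  have M0: "M \<ge> 0" using \<rho> by (simp add: M_def)
  have "\<exists>y. norm (T y) \<le> M * norm r \<and> norm (r - y) \<le> norm r / 2" for r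
  proof (cases "r = 0")
    case True
    then show ?thesis by (intro exI[of _ 0]) (simp add: linear_0[OF lin])
  next
    case False
    define c where "c = \<rho> / (2 * norm r)"
    have c: "c > 0" using False \<rho> by (simp add: c_def)
    have "norm (c *\<^sub>R r) < \<rho>" using False \<rho> c by (simp add: c_def)
    then obtain y where y: "norm (T y) \<le> 2 * real n" "norm (c *\<^sub>R r - y) < c * (norm r / 2)"
      using dense0[of "c *\<^sub>R r" "c * (norm r / 2)"] c False by auto
    let ?y = "(1 / c) *\<^sub>R y"
    have "norm (T ?y) = norm (T y) / c"
      using c by (simp add: linear_cmul[OF lin])
    also have "\<dots> \<le> 2 * real n / c" using y c by (simp add: divide_right_mono)
    also have "\<dots> = M * norm r" using \<rho> False by (simp add: M_def c_def)
    finally have 1: "norm (T ?y) \<le> M * norm r" .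
    have "r - ?y = (1 / c) *\<^sub>R (c *\<^sub>R r - y)" using c by (simp add: scaleR_diff_right)
    then have "norm (r - ?y) = norm (c *\<^sub>R r - y) / c" using c by simp
    also have "\<dots> \<le> norm r / 2" using y c by (simp add: field_simps)
    finally show ?thesis using 1 by blast
  qed
  then obtain pick where pick: "\<And>r. norm (T (pick r)) \<le> M * norm r" "\<And>r. norm (r - pick r) \<le> norm r / 2"
    by metis
  have "norm (T x) \<le> norm x * (2 * M)" for x
  proof -
    \<comment> \<open>The residuals tend to 0 while their images converge to \<open>T x - s\<close>;
      the closedness hypothesis then forces \<open>T x = s\<close>, and \<open>s\<close> is bounded
      by a geometric series.\<close>
    define res where "res k = ((\<lambda>r. r - pick r) ^^ k) x" for k
    have res0: "res 0 = x" and resS: "res (Suc k) = res k - pick (res k)" for k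
      by (simp_all add: res_def)
    have nr: "norm (res k) \<le> norm x * (1/2) ^ k" for k
    proof (induction k)
      case (Suc k)
      have "norm (res (Suc k)) \<le> norm (res k) / 2" unfolding resS by (rule pick)
      then show ?case using Suc by simp
    qed (simp add: res0)
    have bd: "norm (T (pick (res k))) \<le> (M * norm x) * (1/2) ^ k" for k
      using pick(1)[of "res k"] mult_left_mono[OF nr[of k] M0] by (simp add: mult.assoc)
    have gs: "(\<lambda>k. (M * norm x) * (1/2) ^ k) sums (M * norm x * 2)"
      using sums_mult[OF geometric_sums[of "1/2::real"], of "M * norm x"] by simp
    have sm: "summable (\<lambda>k. T (pick (res k)))"
      by (rule summable_comparison_test'[OF sums_summable[OF gs], of 0]) (use bd in auto)
    define s where "s = (\<Sum>k. T (pick (res k)))"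
    have ns: "norm s \<le> M * norm x * 2"
    proof -
      have "norm s \<le> (\<Sum>k. (M * norm x) * (1/2) ^ k)"
        unfolding s_def by (rule norm_suminf_le[OF bd sums_summable[OF gs]])
      then show ?thesis using sums_unique[OF gs] by simp
    qed
    have "T (res k) = T x - (\<Sum>i<k. T (pick (res i)))" for k
      by (induction k) (simp_all add: res0 resS linear_diff[OF lin])
    moreover have "(\<lambda>k. T x - (\<Sum>i<k. T (pick (res i)))) \<longlonglongrightarrow> T x - s"
      unfolding s_def by (intro tendsto_intros summable_LIMSEQ sm)
    ultimately have lim: "(\<lambda>k. T (res k)) \<longlonglongrightarrow> T x - s" by simp
    have "res \<longlonglongrightarrow> 0"
    proof (rule Lim_null_comparison)
      show "\<forall>\<^sub>F k in sequentially. norm (res k) \<le> norm x * (1/2) ^ k"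
        using nr by simp
      show "(\<lambda>k. norm x * (1/2) ^ k) \<longlonglongrightarrow> 0"
        by (intro tendsto_mult_right_zero LIMSEQ_realpow_zero) auto
    qed
    from closed[OF this lim] have "T x = s" by simp
    then show ?thesis using ns by (simp add: mult_ac)
  qed
  then show ?thesis
    using linear_add[OF lin] linear_cmul[OF lin] by (intro bounded_linear_intro) auto
qed

context cstar
begin

lemma linear_pencil_power:
  obtains c where "\<And>z. (u + emb z * v) ^ N = (\<Sum>l<Suc N. emb (z ^ l) * c l)"
proof -
  \<comment> \<open>Vanishing beyond \<open>N\<close> is carried along so that the sum for
    \<open>u * c l\<close> can be extended by one term in the induction step.\<close>
  have "\<exists>c. (\<forall>l>N. c l = 0) \<and> (\<forall>z. (u + emb z * v) ^ N = (\<Sum>l<Suc N. emb (z ^ l) * c l))"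
  proof (induction N)
    case 0
    show ?case by (rule exI[of _ "\<lambda>l. if l = 0 then 1 else 0"]) simp
  next
    case (Suc N)
    then obtain c where c0: "\<And>l. l > N \<Longrightarrow> c l = 0"
      and c: "\<And>z. (u + emb z * v) ^ N = (\<Sum>l<Suc N. emb (z ^ l) * c l)" by blast
    define d where "d l = (case l of 0 \<Rightarrow> 0 | Suc k \<Rightarrow> v * c k)" for l
    have "(u + emb z * v) ^ Suc N = (\<Sum>l<Suc (Suc N). emb (z ^ l) * (u * c l + d l))" for z
    proof -
      have "u * (\<Sum>l<Suc N. emb (z ^ l) * c l) = (\<Sum>l<Suc N. emb (z ^ l) * (u * c l))"
        by (simp only: sum_distrib_left emb_left_commute[of u])
      also have "\<dots> = (\<Sum>l<Suc (Suc N). emb (z ^ l) * (u * c l))"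
        using c0[of "Suc N"] by simp
      finally have 1: "u * (\<Sum>l<Suc N. emb (z ^ l) * c l) = (\<Sum>l<Suc (Suc N). emb (z ^ l) * (u * c l))" .
      have "emb (z ^ Suc l) * d (Suc l) = emb z * v * (emb (z ^ l) * c l)" for l
        by (simp add: d_def emb_mult mult.assoc emb_left_commute[of v])
      then have 2: "emb z * v * (\<Sum>l<Suc N. emb (z ^ l) * c l) = (\<Sum>l<Suc (Suc N). emb (z ^ l) * d l)"
        unfolding sum.lessThan_Suc_shift[of _ "Suc N"] by (simp only: sum_distrib_left d_def) simp
      have "(u + emb z * v) ^ Suc N = u * (\<Sum>l<Suc N. emb (z ^ l) * c l) + emb z * v * (\<Sum>l<Suc N. emb (z ^ l) * c l)"
        by (simp only: power_Suc c distrib_right)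
      then show ?thesis
        unfolding 1 2 by (simp only: distrib_left sum.distrib)
    qed
    then show ?case
      by (intro exI[of _ "\<lambda>l. u * c l + d l"]) (auto simp: c0 d_def split: nat.split)
  qed
  then show thesis using that by blast
qed

text \<open>A crude three circles theorem: both bounds on each coefficient of the \<open>N\<close>-th power are
  combined, and the loss of a factor \<open>N + 1\<close> disappears under \<open>N\<close>-th roots.\<close>

lemma three_circles:
  assumes R: "R > 0" and m: "m1 > 0" "m2 > 0"
    and 1: "\<And>z. cmod z = R \<Longrightarrow> sr (u + emb z * v) < m1"
    and 2: "\<And>z. cmod z = 1 / R \<Longrightarrow> sr (u + emb z * v) < m2"
  shows "(sr (u + v))\<^sup>2 \<le> m1 * m2"
proof -
  have comp: "compact ((\<lambda>z. u + emb z * v) ` sphere 0 r)" for r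
    by (intro compact_continuous_image continuous_intros) auto
  have growth: "\<exists>C. \<forall>z N. cmod z = r \<longrightarrow> norm ((u + emb z * v) ^ N) \<le> C * m ^ N"
    if m: "m > 0" and sr: "\<And>z. cmod z = r \<Longrightarrow> sr (u + emb z * v) < m" for r m
  proof -
    obtain C where "\<And>w N. w \<in> (\<lambda>z. u + emb z * v) ` sphere 0 r \<Longrightarrow> norm (w ^ N) \<le> C * m ^ N"
      by (rule sr_uniform_growth[OF comp[of r] m]) (use sr in auto)
    then show ?thesis by (intro exI[of _ C]) auto
  qed
  obtain C1 where C1: "\<And>z N. cmod z = R \<Longrightarrow> norm ((u + emb z * v) ^ N) \<le> C1 * m1 ^ N"
    using growth[OF m(1) 1] by blast
  obtain C2 where C2: "\<And>z N. cmod z = 1 / R \<Longrightarrow> norm ((u + emb z * v) ^ N) \<le> C2 * m2 ^ N"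
    using growth[OF m(2) 2] by blast
  let ?m = "sqrt (m1 * m2)"
  have "sr (u + v) \<le> ?m"
  proof (rule sr_le_of_growth[where C = "sqrt (C1 * C2)"])
    fix N
    obtain c where c: "\<And>z. (u + emb z * v) ^ N = (\<Sum>l<Suc N. emb (z ^ l) * c l)"
      using linear_pencil_power by blast
    have cl: "norm (c l) \<le> sqrt (C1 * C2) * ?m ^ N" if l: "l < Suc N" for l
    proof -
      have a: "R ^ l * norm (c l) \<le> C1 * m1 ^ N"
        using C1[where N = N] unfolding c by (intro coefficient_bound[OF R _ l])
      have b: "(1 / R) ^ l * norm (c l) \<le> C2 * m2 ^ N"
        using C2[where N = N] unfolding c using R by (intro coefficient_bound[OF _ _ l]) auto
      \<comment> \<open>The two radii are reciprocal, so the powers of \<open>R\<close> cancel in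
        the product of the estimates.\<close>
      have "(norm (c l))\<^sup>2 = (R ^ l * norm (c l)) * ((1 / R) ^ l * norm (c l))"
        using R by (simp add: power2_eq_square power_divide)
      also have "\<dots> \<le> (C1 * m1 ^ N) * (C2 * m2 ^ N)"
        using R by (intro mult_mono a b order_trans[OF _ a]) auto
      also have "\<dots> = (C1 * C2) * (m1 * m2) ^ N" by (simp add: power_mult_distrib)
      finally have "norm (c l) \<le> sqrt ((C1 * C2) * (m1 * m2) ^ N)"
        by (rule real_le_rsqrt)
      then show ?thesis by (simp add: real_sqrt_mult real_sqrt_power)
    qed
    have "(u + v) ^ N = (\<Sum>l<Suc N. c l)" using c[of 1] by simp
    then have "norm ((u + v) ^ N) \<le> (\<Sum>l<Suc N. sqrt (C1 * C2) * ?m ^ N)"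
      using cl by (simp only:) (rule sum_norm_le, simp)
    then show "norm ((u + v) ^ N) \<le> sqrt (C1 * C2) * (real N + 1) * ?m ^ N"
      by (simp add: algebra_simps)
  qed (use m in simp)
  then have "(sr (u + v))\<^sup>2 \<le> ?m\<^sup>2" using sr_nonneg by (intro power_mono) auto
  then show ?thesis using m by simp
qed

text \<open>The choices 0, b* and -b* for \<open>c\<close> show that b + b* and b - b* have spectral
  radius 0. One is self-adjoint and the other skew, so both vanish. This yields injectivity of
  \<open>T\<close> and closedness of its graph.\<close>

lemma zero_if_sr_add_le:
  assumes "\<And>c. sr (c + b) \<le> sr c"
  shows "b = 0"
proof -
  have sr0: "sr 0 = 0" using sr_le_norm[of 0] sr_nonneg[of 0] by simp
  have b: "sr b = 0" using assms[of 0] sr_nonneg[of b] sr0 by simp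
  have bs: "sr (st b) = 0" using sr_st[of b] sr_nonneg[of "st b"] b by simp
  have neg: "sr (- st b) = 0"
  proof -
    have "sr (- st b) \<le> sr (st b)"
    proof (rule sr_le_of_norm_power_eq)
      fix n show "norm ((- st b) ^ n) = norm (st b ^ n)"
        by (cases "even n") (simp_all add: power_minus_even power_minus_odd)
    qed
    then show ?thesis using bs sr_nonneg[of "- st b"] by simp
  qed
  have "sr (st b + b) = 0" "sr (- st b + b) = 0"
    using assms[of "st b"] assms[of "- st b"] bs neg sr_nonneg[of "st b + b"] sr_nonneg[of "- st b + b"]
    by auto
  then have "st b + b = 0" "- st b + b = 0"
    using sr_zero_selfadjoint[of "st b + b"] sr_zero_selfadjoint[of "- st b + b"]
    by (simp_all only: st_add st_minus st_st minus_add_distrib minus_minus add.commute simp_thms)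
  then have "(st b + b) + (- st b + b) = 0" by simp
  then have "2 *\<^sub>R b = 0" by (simp add: scaleR_2)
  then show ?thesis by simp
qed

end

section \<open>Spectral isometries: bijectivity, boundedness and square-zero elements\<close>

locale spectral_iso = A: cstar csA stA + B: cstar csB stB
  for csA :: "complex \<Rightarrow> 'a::{real_normed_algebra_1,banach} \<Rightarrow> 'a" and stA
    and csB :: "complex \<Rightarrow> 'b::{real_normed_algebra_1,banach} \<Rightarrow> 'b" and stB +
  fixes T :: "'a \<Rightarrow> 'b"
  assumes isometry: "spectral_isometry csA csB T" and unital: "T 1 = 1" and surj: "surj T"
begin

lemma T_add: "T (x + y) = T x + T y"
  and T_emb: "T (A.emb c * x) = B.emb c * T x"
  and T_sr: "B.sr (T x) = A.sr x"
  using isometry unfolding spectral_isometry_def complex_linear_def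
  by (auto simp: A.cs_emb B.cs_emb)

lemma linear_T: "linear T"
  by (rule linearI) (simp_all add: T_add T_emb flip: A.emb_of_real_mult B.emb_of_real_mult)

lemmas T_diff = linear_diff[OF linear_T]
  and T_scaleR = linear_cmul[OF linear_T]
  and T_0 = linear_0[OF linear_T]

lemma inj_T: "inj T"
proof (rule linear_injective_0[OF linear_T, THEN iffD2], intro allI impI)
  fix x assume x: "T x = 0"
  show "x = 0"
  proof (rule A.zero_if_sr_add_le)
    show "A.sr (c + x) \<le> A.sr c" for c
      using T_sr[of "c + x"] T_sr[of c] x by (simp add: T_add)
  qed
qed

lemma bij_T: "bij T"
  using inj_T surj by (simp add: bij_def)

text \<open>Ransford's argument: \<open>c + b\<close> lies on the pencil \<open>z \<mapsto> T (a + y - x\<^sub>n + z x\<^sub>n)\<close> at \<open>z = 1\<close>, whose values are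
  images of elements near \<open>a + y\<close> on a large circle and are near \<open>c\<close> on a small one.\<close>

lemma separating_zero:
  assumes x: "x \<longlonglongrightarrow> 0" and Tx: "(\<lambda>n. T (x n)) \<longlonglongrightarrow> b"
  shows "b = 0"
proof (rule B.zero_if_sr_add_le)
  fix c
  obtain y a where y: "T y = b" and a: "T a = c" using surj by (metis surjD)
  have eq: "A.sr (a + y) = B.sr (c + b)" using T_sr[of "a + y"] by (simp add: T_add y a)
  let ?r = "B.sr (c + b)" and ?s = "B.sr c"
  have le: "?r\<^sup>2 \<le> (?r + d) * (?s + d)" if d: "d > 0" for d
  proof -
    have "A.sr (a + y) < ?r + d" "?s < ?s + d" using d eq by auto
    then obtain e1 e2 where e1: "e1 > 0" "\<And>w. norm (w - (a + y)) < e1 \<Longrightarrow> A.sr w < ?r + d"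
      and e2: "e2 > 0" "\<And>w. norm (w - c) < e2 \<Longrightarrow> B.sr w < ?s + d"
      using A.sr_upper_semicontinuous B.sr_upper_semicontinuous by metis
    \<comment> \<open>\<open>R\<close> is fixed first, making the term \<open>z * T (x n)\<close>
      small on the inner circle uniformly in \<open>n\<close>. Only then is \<open>n\<close> taken
      so large that the factor \<open>R + 1\<close> on the outer circle is harmless.\<close>
    obtain R where R: "R > 1" "(norm b + 1) / R < e2 / 2"
    proof
      define R where "R = max 2 (2 * (norm b + 1) / e2 + 1)"
      show "R > 1" by (simp add: R_def)
      have "2 * (norm b + 1) / e2 < R" by (simp add: R_def)
      then show "(norm b + 1) / R < e2 / 2"
        using e2(1) \<open>R > 1\<close> by (simp add: field_simps)
    qed
    have "eventually (\<lambda>n. norm (x n) < e1 / (R + 1) \<and> norm (T (x n) - b) < min 1 (e2 / 2)) sequentially"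
    proof (rule eventually_conj)
      show "eventually (\<lambda>n. norm (x n) < e1 / (R + 1)) sequentially"
        using R e1 by (intro order_tendstoD(2)[OF tendsto_norm_zero[OF x]]) auto
      have "(\<lambda>n. T (x n) - b) \<longlonglongrightarrow> 0" using Tx by (simp add: LIM_zero_iff)
      then show "eventually (\<lambda>n. norm (T (x n) - b) < min 1 (e2 / 2)) sequentially"
        using e2 by (intro order_tendstoD(2)[OF tendsto_norm_zero]) auto
    qed
    then obtain n where n: "norm (x n) < e1 / (R + 1)" "norm (T (x n) - b) < 1" "norm (T (x n) - b) < e2 / 2"
      by (metis (no_types, lifting) eventually_sequentially order_refl min_less_iff_conj)
    let ?u = "c + b - T (x n)" and ?v = "T (x n)"
    have "(B.sr (?u + ?v))\<^sup>2 \<le> (?r + d) * (?s + d)"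
    proof (rule B.three_circles)
      show "R > 0" "?r + d > 0" "?s + d > 0"
        using R d B.sr_nonneg[of "c + b"] B.sr_nonneg[of c] by auto
      fix z :: complex
      show "B.sr (?u + B.emb z * ?v) < ?r + d" if z: "cmod z = R"
      proof -
        let ?w = "a + y + A.emb (z - 1) * x n"
        have "T ?w = ?u + B.emb z * ?v"
          by (simp add: T_add T_emb y a B.emb_diff left_diff_distrib)
        moreover have "A.sr ?w < ?r + d"
        proof (rule e1(2))
          have "norm (?w - (a + y)) = cmod (z - 1) * norm (x n)" by (simp add: A.norm_emb_mult)
          also have "\<dots> \<le> (R + 1) * norm (x n)"
            using norm_triangle_ineq4[of z 1] z by (intro mult_right_mono) auto
          also have "\<dots> < e1" using n(1) R by (simp add: field_simps)
          finally show "norm (?w - (a + y)) < e1" .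
        qed
        ultimately show ?thesis using T_sr[of ?w] by simp
      qed
      show "B.sr (?u + B.emb z * ?v) < ?s + d" if z: "cmod z = 1 / R"
      proof (rule e2(2))
        have "norm (?u + B.emb z * ?v - c) \<le> norm (b - T (x n)) + norm (B.emb z * ?v)"
          using norm_triangle_ineq[of "b - T (x n)" "B.emb z * ?v"] by (simp add: algebra_simps)
        also have "norm (B.emb z * ?v) \<le> (norm b + 1) / R"
        proof -
          have "norm ?v \<le> norm b + 1" using n(2) norm_triangle_sub[of "T (x n)" b] by simp
          then show ?thesis using R by (simp add: B.norm_emb_mult z divide_right_mono)
        qed
        finally show "norm (?u + B.emb z * ?v - c) < e2"
          using n(3) R(2) norm_minus_commute[of b "T (x n)"] by linarith
      qed
    qed
    then show ?thesis by simp
  qed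
  have "?r\<^sup>2 \<le> (?r + 0) * (?s + 0)"
  proof (rule tendsto_lowerbound)
    show "((\<lambda>d. (?r + d) * (?s + d)) \<longlongrightarrow> (?r + 0) * (?s + 0)) (at_right 0)"
      by (intro tendsto_intros)
    show "\<forall>\<^sub>F d in at_right 0. ?r\<^sup>2 \<le> (?r + d) * (?s + d)"
      using le by (auto simp: eventually_at_filter)
  qed simp
  then show "?r \<le> ?s"
    using B.sr_nonneg[of "c + b"] B.sr_nonneg[of c]
    by (cases "?r = 0") (auto simp: power2_eq_square)
qed

lemma bounded_linear_T: "bounded_linear T"
  using linear_T separating_zero by (rule closed_graph_bounded)

text \<open>The situation is symmetric in the two algebras, so boundedness applied to the inverse
  bounds \<open>T\<close> from below.\<close>

lemma spectral_iso_inv: "spectral_iso csB stB csA stA (inv T)"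
proof unfold_locales
  have TI: "T (inv T y) = y" for y using surj by (rule surj_f_inv_f)
  have IT: "inv T (T x) = x" for x using inj_T by (rule inv_f_f)
  have "inv T (x + y) = inv T x + inv T y" for x y
    by (metis IT TI T_add)
  moreover have "inv T (csB c y) = csA c (inv T y)" for c y
    by (metis IT TI T_emb A.cs_emb B.cs_emb)
  moreover have "A.sr (inv T y) = B.sr y" for y
    by (metis TI T_sr)
  ultimately show "spectral_isometry csB csA (inv T)"
    by (simp add: spectral_isometry_def complex_linear_def)
  show "inv T 1 = 1" by (metis IT unital)
  show "surj (inv T)" by (metis IT surjI)
qed

lemma bounded_below:
  obtains K where "K > 0" "\<And>x. norm x \<le> norm (T x) * K"
proof -
  have "bounded_linear (inv T)"
    using spectral_iso.bounded_linear_T[OF spectral_iso_inv] .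
  then obtain K where "K > 0" "\<And>y. norm (inv T y) \<le> norm y * K"
    using bounded_linear.pos_bounded by blast
  then show thesis using that inv_f_f[OF inj_T] by metis
qed

text \<open>A spectral value \<open>z\<close> of \<open>E y\<close>, where \<open>E = (1 - u T a)\<inverse>\<close> and \<open>T x = y\<close>, is a spectral value of
  \<open>T (z u a + x)\<close>, and \<open>(z u a + x)\<^sup>2\<close> is only linear in \<open>z u\<close>.\<close>

lemma resolvent_linear_growth:
  assumes a: "a * a = 0" and K: "K > 0" "\<And>x. norm x \<le> norm (T x) * K"
    and inv: "alg_invertible (1 - B.emb u * T a)"
  shows "norm (ainv (1 - B.emb u * T a)) \<le> K * (1 + 2 * cmod u * norm a)"
proof -
  define E where "E = ainv (1 - B.emb u * T a)"
  have E: "E * (1 - B.emb u * T a) = 1" "(1 - B.emb u * T a) * E = 1"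
    using inv by (simp_all add: E_def ainv_left ainv_right)
  obtain x where x: "T x = stB E" using surj by (metis surjD)
  let ?X = "norm x" and ?f = "1 + 2 * cmod u * norm a"
  have "B.sr (E * stB E) \<le> ?X * ?f"
  proof (rule B.sr_least, rule ccontr)
    fix z assume z: "z \<in> spec csB (E * stB E)" and "\<not> cmod z \<le> ?X * ?f"
    then have gt: "?X * ?f < cmod z" by simp
    let ?w = "A.emb (z * u) * a + x"
    have "z \<in> spec csB (T ?w)"
    proof (rule ccontr)
      assume "z \<notin> spec csB (T ?w)"
      then have "alg_invertible (T ?w - B.emb z)" by (simp add: B.spec_iff)
      moreover have zu: "B.emb z * (B.emb u * y) = B.emb (z * u) * y" for y
        by (simp add: B.emb_mult mult.assoc)
      moreover have "alg_invertible E"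
        using E by (auto simp: alg_invertible_def)
      \<comment> \<open>\<open>E\<close> inverts \<open>1 - u T a\<close>, so
        \<open>z = z * E * (1 - u T a)\<close>. The term \<open>z u a\<close> in \<open>?w\<close>
        is there to cancel the unwanted part, leaving \<open>E * stB E - z\<close>.\<close>
      moreover have "E * (T ?w - B.emb z) = E * stB E - B.emb z * (E * (1 - B.emb u * T a))"
        by (simp add: T_add T_emb x zu right_diff_distrib distrib_left B.emb_left_commute[of E] B.emb_commute[of E])
      ultimately have "alg_invertible (E * stB E - B.emb z)"
        using alg_invertible_mult[of E "T ?w - B.emb z"] E by simp
      then show False using z by (simp add: B.spec_iff)
    qed
    then have "cmod z \<le> A.sr ?w" using B.sr_upper T_sr by metis
    also have "A.sr ?w \<le> sqrt (norm (?w ^ 2))"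
      by (rule A.sr_le_of_power[of _ 2]) auto
    finally have "(cmod z)\<^sup>2 \<le> norm (?w ^ 2)"
      by (metis norm_ge_zero real_sqrt_abs real_sqrt_le_iff abs_norm_cancel)
    also have "?w ^ 2 = A.emb (z * u) * (a * x + x * a) + x * x"
      by (simp add: power2_eq_square algebra_simps A.emb_left_commute[of a] A.emb_left_commute[of x] a flip: mult.assoc)
         (simp add: mult.assoc a A.emb_left_commute[of a] A.emb_left_commute[of x])
    also have "norm \<dots> \<le> cmod z * cmod u * (norm a * ?X + ?X * norm a) + ?X * ?X"
    proof (rule norm_triangle_le, rule add_mono)
      have "norm (a * x + x * a) \<le> norm a * ?X + ?X * norm a"
        by (intro norm_triangle_le add_mono norm_mult_ineq)
      then show "norm (A.emb (z * u) * (a * x + x * a)) \<le> cmod z * cmod u * (norm a * ?X + ?X * norm a)"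
        unfolding A.norm_emb_mult norm_mult by (intro mult_left_mono) auto
    qed (rule norm_mult_ineq)
    \<comment> \<open>The assumption to be refuted gives \<open>?X \<le> cmod z\<close>; it is used
      on one factor of \<open>?X * ?X\<close> so that \<open>cmod z\<close> divides the whole
      bound.\<close>
    also have "\<dots> \<le> cmod z * (?X * (2 * cmod u * norm a)) + cmod z * ?X"
    proof -
      have "?X * 1 \<le> ?X * ?f" by (intro mult_left_mono) auto
      then have "?X \<le> cmod z" using gt by simp
      then have "?X * ?X \<le> cmod z * ?X" by (intro mult_right_mono) auto
      then show ?thesis by (simp add: algebra_simps)
    qed
    also have "\<dots> = cmod z * (?X * ?f)" by (simp add: algebra_simps)
    finally have "cmod z * cmod z \<le> cmod z * (?X * ?f)" by (simp add: power2_eq_square)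
    moreover have "0 \<le> ?X * ?f" by simp
    with gt have "0 < cmod z" by linarith
    ultimately show False using gt by simp
  qed
  moreover have "B.sr (E * stB E) = (norm E)\<^sup>2"
    by (subst B.sr_hermitian) (simp_all add: B.st_mult B.norm_mult_st)
  moreover have "?X * ?f \<le> (norm E * K) * ?f"
    using K(2)[of x] by (intro mult_right_mono) (auto simp: x)
  ultimately have "norm E * norm E \<le> norm E * (K * ?f)"
    by (simp add: power2_eq_square mult.assoc)
  then have "norm E \<le> K * ?f"
    using K(1) by (cases "norm E = 0") auto
  then show ?thesis by (simp add: E_def)
qed

text \<open>The square of \<open>T a\<close> is the quadratic coefficient of the resolvent. A Cauchy
  estimate at radius \<open>t\<close> bounds \<open>t\<^sup>2\<close> times its norm by a linear
  function of \<open>t\<close>.\<close>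

theorem square_zero:
  assumes a: "a * a = 0"
  shows "T a * T a = 0"
proof (rule ccontr)
  let ?b = "T a"
  assume "?b * ?b \<noteq> 0"
  then have nb: "norm (?b * ?b) > 0" by simp
  obtain K where K: "K > 0" "\<And>x. norm x \<le> norm (T x) * K" using bounded_below by blast
  have "A.sr a \<le> 0" by (rule A.sr_le_of_power[of _ 2]) (simp_all add: power2_eq_square a)
  then have sr: "B.sr ?b = 0" using T_sr[of a] A.sr_nonneg[of a] by simp
  have inv: "alg_invertible (1 - B.emb u * ?b)" for u
  proof (cases "u = 0")
    case False
    have "alg_invertible (?b - B.emb (inverse u))"
      using B.sr_upper[of "inverse u" ?b] sr False by (auto simp: B.spec_iff)
    then have "alg_invertible (B.emb u * (B.emb (inverse u) - ?b))"
      by (intro alg_invertible_mult B.alg_invertible_emb False) (simp add: alg_invertible_diff_commute)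
    then show ?thesis by (simp add: right_diff_distrib B.emb_inverse[OF False])
  qed simp
  have bound: "t\<^sup>2 * norm (?b * ?b) \<le> 2 * (K * (1 + 2 * t * norm a))" if t: "t \<ge> 1" for t :: real
  proof -
    let ?u = "complex_of_real t" and ?M = "K * (1 + 2 * t * norm a)"
    have M: "?M \<ge> 0" using K t by simp
    \<comment> \<open>The rate \<open>1 / (2 * t)\<close> makes the norm of
      \<open>(t * ?b) ^ n\<close> at most \<open>C / 2 ^ n\<close>, so the factor
      \<open>1 - (t * ?b) ^ n\<close> is harmless for large \<open>n\<close>.\<close>
    have "B.sr ?b < 1 / (2 * t)" using sr t by simp
    from B.sr_growth[OF this] obtain C where C: "\<And>n. norm (?b ^ n) \<le> C * (1 / (2 * t)) ^ n" by blast
    obtain n0 where n0: "2 ^ n0 > C" using real_arch_pow[of 2 C] by auto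
    \<comment> \<open>Adding 3 ensures that the coefficient index 2 lies below
      \<open>n\<close>.\<close>
    define n where "n = n0 + 3"
    have "(2::real) ^ n0 \<le> 2 ^ n" unfolding n_def by (intro power_increasing) auto
    then have n: "n > 2" "C \<le> 2 ^ n" using n0 by (auto simp only: n_def)
    have "norm ((B.emb ?u * ?b) ^ n) = t ^ n * norm (?b ^ n)"
      using t by (simp add: B.emb_mult_power B.norm_emb_mult norm_power)
    also have "\<dots> \<le> t ^ n * (C * (1 / (2 * t)) ^ n)"
      using t by (intro mult_left_mono C) auto
    also have "\<dots> = C / 2 ^ n" using t by (simp add: power_divide power_mult_distrib)
    also have "\<dots> \<le> 1" using n by simp
    finally have "norm (1 - (B.emb ?u * ?b) ^ n) \<le> 2"
      using norm_triangle_ineq4[of 1 "(B.emb ?u * ?b) ^ n"] by simp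
    moreover have "norm (\<Sum>z\<in>unity_roots n. B.emb (inverse z ^ 2) * ainv (1 - B.emb (z * ?u) * ?b)) \<le> (\<Sum>z\<in>unity_roots n. ?M)"
    proof (rule sum_norm_le)
      fix z assume "z \<in> unity_roots n"
      then have z: "cmod z = 1" using n by (intro norm_unity_roots) auto
      show "norm (B.emb (inverse z ^ 2) * ainv (1 - B.emb (z * ?u) * ?b)) \<le> ?M"
        using resolvent_linear_growth[OF a K inv, of "z * ?u"] z t
        by (simp add: B.norm_emb_mult norm_power norm_inverse norm_mult)
    qed
    ultimately have "norm ((\<Sum>z\<in>unity_roots n. B.emb (inverse z ^ 2) * ainv (1 - B.emb (z * ?u) * ?b))
        * (1 - (B.emb ?u * ?b) ^ n)) \<le> (real n * ?M) * 2"
      using n M by (intro order_trans[OF norm_mult_ineq] mult_mono) (auto simp: card_unity_roots)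
    also have "(\<Sum>z\<in>unity_roots n. B.emb (inverse z ^ 2) * ainv (1 - B.emb (z * ?u) * ?b))
        * (1 - (B.emb ?u * ?b) ^ n) = real n *\<^sub>R (B.emb ?u * ?b) ^ 2"
      using n by (intro B.resolvent_average inv) auto
    also have "norm \<dots> = real n * (t\<^sup>2 * norm (?b * ?b))"
      unfolding B.emb_mult_power norm_scaleR B.norm_emb_mult by (simp add: norm_power norm_mult power2_eq_square)
    finally have "real n * (t\<^sup>2 * norm (?b * ?b)) \<le> real n * (2 * ?M)"
      by (simp only: mult_ac)
    then show ?thesis using n by (simp only: mult_le_cancel_left_pos of_nat_0_less_iff)
  qed
  define t where "t = 1 + 2 * K * (1 + 2 * norm a) / norm (?b * ?b)"
  have t: "t \<ge> 1" using K nb by (simp add: t_def)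
  have "t * (t * norm (?b * ?b)) \<le> t * (2 * K * (1 + 2 * norm a))"
  proof -
    have "K * 1 \<le> K * t" using K t by (intro mult_left_mono) auto
    then show ?thesis using bound[OF t] by (simp add: power2_eq_square algebra_simps)
  qed
  then have "t * norm (?b * ?b) \<le> 2 * K * (1 + 2 * norm a)" using t by simp
  moreover have "t * norm (?b * ?b) = norm (?b * ?b) + 2 * K * (1 + 2 * norm a)"
    using nb by (simp add: t_def field_simps)
  ultimately show False using nb by simp
qed

end

section \<open>Functional calculus and real rank zero\<close>

context cstar
begin

lemma norm_square_hermitian: "st x = x \<Longrightarrow> norm (x * x) = norm x * norm x"
  using norm_st_mult[of x] by (simp add: power2_eq_square)

text \<open>Arens' trick: adding \<open>i t\<close> to a self-adjoint element raises the squared norm by at most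
  \<open>t\<^sup>2\<close>, which is too little for a non-real spectral value as \<open>t\<close> grows.\<close>

lemma spec_hermitian_real:
  assumes x: "st x = x" and z: "z \<in> spec cs x"
  shows "Im z = 0"
proof (rule ccontr)
  assume im: "Im z \<noteq> 0"
  have bd: "(Im z + t)\<^sup>2 \<le> (norm x)\<^sup>2 + t\<^sup>2" for t :: real
  proof -
    let ?w = "x + emb (\<i> * of_real t)"
    have "(x - emb z) = ?w - emb (z + \<i> * of_real t)" by (simp add: emb_add)
    then have "z + \<i> * of_real t \<in> spec cs ?w" using z unfolding spec_iff by metis
    then have "(cmod (z + \<i> * of_real t))\<^sup>2 \<le> (norm ?w)\<^sup>2"
      by (intro power_mono norm_ge_spec) auto
    also have "\<dots> = norm (st ?w * ?w)" by (simp add: norm_st_mult)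
    also have "st ?w * ?w = x * x + emb (of_real (t\<^sup>2))"
    proof -
      have "st ?w = x - emb (\<i> * of_real t)" by (simp add: st_add st_emb x emb_minus)
      then have "st ?w * ?w = (x - emb (\<i> * of_real t)) * ?w" by (simp only:)
      also have "\<dots> = x * x - emb (\<i> * of_real t) * emb (\<i> * of_real t)"
        by (simp add: left_diff_distrib distrib_left emb_commute[of x])
      also have "emb (\<i> * of_real t) * emb (\<i> * of_real t) = - emb (of_real (t\<^sup>2))"
        unfolding emb_mult[symmetric] emb_minus[symmetric]
        by (rule arg_cong[of _ _ emb]) (simp add: power2_eq_square algebra_simps)
      finally show ?thesis by simp
    qed
    also have "norm \<dots> \<le> norm (x * x) + norm (emb (of_real (t\<^sup>2)))" by (rule norm_triangle_ineq)
    also have "\<dots> = (norm x)\<^sup>2 + t\<^sup>2"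
      using norm_square_hermitian[OF x] unfolding norm_emb norm_of_real by (simp add: power2_eq_square)
    finally have "(cmod (z + \<i> * of_real t))\<^sup>2 \<le> (norm x)\<^sup>2 + t\<^sup>2" .
    moreover have "(Im z + t)\<^sup>2 \<le> (cmod (z + \<i> * of_real t))\<^sup>2"
      by (simp add: cmod_power2)
    ultimately show ?thesis by linarith
  qed
  have "2 * Im z * t \<le> (norm x)\<^sup>2" for t
    using bd[of t] zero_le_power2[of "Im z"] unfolding power2_sum by linarith
  from this[of "((norm x)\<^sup>2 + 1) / (2 * Im z)"] show False using im by simp
qed

section \<open>Polynomial and continuous functional calculus\<close>

definition rspec :: "'a \<Rightarrow> real set" where
  "rspec x = {t. \<not> alg_invertible (x - t *\<^sub>R 1)}"

lemma spec_of_real: "of_real t \<in> spec cs x \<longleftrightarrow> t \<in> rspec x"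
  by (simp add: spec_iff rspec_def emb_of_real)

lemma rspec_norm: "t \<in> rspec x \<Longrightarrow> \<bar>t\<bar> \<le> norm x"
  using norm_ge_spec[of "of_real t" x] by (simp add: spec_of_real)

lemma compact_rspec: "compact (rspec x)"
proof -
  have "open {t. alg_invertible (x - t *\<^sub>R 1)}"
    using open_vimage[OF open_alg_invertible, of "\<lambda>t. x - t *\<^sub>R 1"]
    by (simp add: vimage_def continuous_intros)
  moreover have "rspec x = - {t. alg_invertible (x - t *\<^sub>R 1)}" by (auto simp: rspec_def)
  ultimately have "closed (rspec x)" by (simp add: closed_def)
  moreover have "bounded (rspec x)" using rspec_norm by (auto simp: bounded_iff)
  ultimately show ?thesis by (simp add: compact_eq_bounded_closed)
qed

text \<open>Horner evaluation. Complex coefficients let polynomials split into linear factors; the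
  real variant \<open>rpev\<close> preserves self-adjointness.\<close>

definition cpev :: "complex poly \<Rightarrow> 'a \<Rightarrow> 'a" where
  "cpev p x = fold_coeffs (\<lambda>c y. emb c + x * y) p 0"

lemma cpev_0 [simp]: "cpev 0 x = 0"
  by (simp add: cpev_def)

lemma cpev_pCons [simp]: "cpev (pCons c p) x = emb c + x * cpev p x"
  by (cases "p = 0 \<and> c = 0") (auto simp: cpev_def)

lemma cpev_add: "cpev (p + q) x = cpev p x + cpev q x"
  by (induction p q rule: poly_induct2) (simp_all add: emb_add algebra_simps)

lemma cpev_smult: "cpev (smult c p) x = emb c * cpev p x"
  by (induction p) (simp_all add: emb_mult distrib_left emb_left_commute[of x])

lemma cpev_commute: "x * cpev p x = cpev p x * x"
proof (induction p)
  case (pCons c p)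
  have "x * (x * cpev p x) = x * cpev p x * x" unfolding pCons.IH by (simp add: pCons.IH flip: mult.assoc)
  then show ?case by (simp add: distrib_left distrib_right emb_commute[of x])
qed simp

lemma cpev_mult: "cpev (p * q) x = cpev p x * cpev q x"
  by (induction p) (simp_all add: cpev_add cpev_smult distrib_right mult.assoc)

text \<open>Splitting off roots writes the value as a product of invertible linear factors. This is
  the half of the spectral mapping theorem that bounds a spectral radius from above.\<close>

lemma cpev_invertible:
  assumes "p \<noteq> 0" "\<And>z. poly p z = 0 \<Longrightarrow> alg_invertible (x - emb z)"
  shows "alg_invertible (cpev p x)"
  using assms
proof (induction "degree p" arbitrary: p)
  case 0
  then obtain c where "p = [:c:]" by (metis degree_eq_zeroE)
  then show ?case using 0 by (simp add: alg_invertible_emb)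
next
  case (Suc n)
  then have "\<not> constant (poly p)" using constant_degree[of p] by simp
  then obtain z where z: "poly p z = 0" using fundamental_theorem_of_algebra by blast
  then obtain q where q: "p = [:- z, 1:] * q" by (metis dvdE poly_eq_0_iff_dvd)
  have "q \<noteq> 0" using Suc.prems q by auto
  then have "degree p = Suc (degree q)" unfolding q by (subst degree_mult_eq) auto
  then have "alg_invertible (cpev q x)"
    using Suc \<open>q \<noteq> 0\<close> by (intro Suc.hyps(1)) (auto simp: q)
  moreover have "cpev [:- z, 1:] x = x - emb z" by (simp add: emb_minus)
  ultimately show ?case
    using Suc.prems(2)[OF z] unfolding q cpev_mult by (simp only: alg_invertible_mult)
qed

definition rpev :: "real poly \<Rightarrow> 'a \<Rightarrow> 'a" where
  "rpev p x = cpev (map_poly complex_of_real p) x"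

lemma rpev_0 [simp]: "rpev 0 x = 0"
  by (simp add: rpev_def)

lemma rpev_pCons [simp]: "rpev (pCons c p) x = c *\<^sub>R 1 + x * rpev p x"
  by (simp add: rpev_def map_poly_pCons emb_of_real)

lemma rpev_add: "rpev (p + q) x = rpev p x + rpev q x"
  by (induction p q rule: poly_induct2) (simp_all add: algebra_simps)

lemma rpev_smult: "rpev (smult c p) x = c *\<^sub>R rpev p x"
  by (induction p) (simp_all add: scaleR_add_right)

lemma rpev_diff: "rpev (p - q) x = rpev p x - rpev q x"
proof -
  have "p - q = p + smult (-1) q" by simp
  then show ?thesis by (simp only: rpev_add rpev_smult) simp
qed

lemma rpev_mult: "rpev (p * q) x = rpev p x * rpev q x"
  by (induction p) (simp_all add: rpev_add rpev_smult distrib_right mult.assoc)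

lemma rpev_commute: "x * rpev p x = rpev p x * x"
  unfolding rpev_def by (rule cpev_commute)

lemma st_rpev: "st x = x \<Longrightarrow> st (rpev p x) = rpev p x"
  by (induction p) (simp_all add: st_add st_mult st_scaleR rpev_commute)

lemma rpev_annihilate:
  assumes "x * y = 0"
  shows "rpev p x * y = poly p 0 *\<^sub>R y"
proof (induction p)
  case (pCons c p)
  have "rpev (pCons c p) x * y = c *\<^sub>R y + rpev p x * (x * y)"
    by (simp add: distrib_right rpev_commute mult.assoc)
  then show ?case using assms by simp
qed simp

lemma poly_map_of_real: "poly (map_poly complex_of_real p) (of_real t) = of_real (poly p t)"
  by (induction p) (simp_all add: map_poly_pCons)

text \<open>Spectral mapping bounds the spectral radius, which on self-adjoint elements is the norm.
  Polynomials that converge uniformly on the spectrum therefore converge in the algebra.\<close>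

lemma norm_rpev_le:
  assumes x: "st x = x" and bd: "\<And>t. t \<in> rspec x \<Longrightarrow> \<bar>poly p t\<bar> \<le> M" and M: "M \<ge> 0"
  shows "norm (rpev p x) \<le> M"
proof -
  have "sr (rpev p x) \<le> M"
  proof (rule sr_least, rule ccontr)
    fix z assume z: "z \<in> spec cs (rpev p x)" and zM: "\<not> cmod z \<le> M"
    let ?q = "map_poly complex_of_real p - [:z:]"
    have "alg_invertible (cpev ?q x)"
    proof (rule cpev_invertible)
      have *: "alg_invertible (x - emb w)" if w: "poly (map_poly complex_of_real p) w = z" for w
      proof (rule ccontr)
        assume "\<not> ?thesis"
        then have ws: "w \<in> spec cs x" by (simp add: spec_iff)
        then have "Im w = 0" by (rule spec_hermitian_real[OF x])
        then have wr: "w = of_real (Re w)" by (simp add: complex_eq_iff)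
        then have "Re w \<in> rspec x" using ws spec_of_real by metis
        moreover have "z = of_real (poly p (Re w))" using w wr poly_map_of_real by metis
        ultimately show False using bd zM by (metis norm_of_real)
      qed
      then show "poly ?q w = 0 \<Longrightarrow> alg_invertible (x - emb w)" for w by simp
      \<comment> \<open>If the polynomial were constantly \<open>z\<close>, every
        \<open>x - w\<close> would be invertible, contradicting nonemptiness of the
        spectrum.\<close>
      show "?q \<noteq> 0"
      proof
        assume "?q = 0"
        then have "map_poly complex_of_real p = [:z:]" by simp
        then have "alg_invertible (x - emb w)" for w using * by simp
        then show False using spec_nonempty[of x] by (auto simp: spec_iff)
      qed
    qed
    moreover have "cpev ?q x = rpev p x - emb z"
      using cpev_add[of ?q "[:z:]" x] by (simp add: rpev_def)
    ultimately show False using z by (simp add: spec_iff)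
  qed
  then show ?thesis using sr_hermitian[OF st_rpev[OF x]] by simp
qed

text \<open>\<open>fcalc x f y\<close> says that \<open>y\<close> is the value at the self-adjoint element \<open>x\<close> of the continuous
  functional calculus for a function \<open>f\<close> that need only be defined sensibly on the real spectrum.\<close>

definition fcalc :: "'a \<Rightarrow> (real \<Rightarrow> real) \<Rightarrow> 'a \<Rightarrow> bool" where
  "fcalc x f y \<longleftrightarrow> (\<exists>p. (\<lambda>n. rpev (p n) x) \<longlonglongrightarrow> y \<and> uniform_limit (rspec x) (\<lambda>n. poly (p n)) f sequentially)"

lemma fcalc_poly: "fcalc x (poly p) (rpev p x)"
  unfolding fcalc_def by (rule exI[of _ "\<lambda>_. p"]) (simp add: uniform_limit_iff)

lemma fcalc_cong: "fcalc x f y \<Longrightarrow> (\<And>t. t \<in> rspec x \<Longrightarrow> f t = g t) \<Longrightarrow> fcalc x g y"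
  unfolding fcalc_def uniform_limit_iff by simp

lemma fcalc_exists:
  assumes x: "st x = x" and f: "continuous_on (rspec x) f"
  shows "\<exists>y. fcalc x f y"
proof -
  have "\<exists>p. \<forall>t\<in>rspec x. \<bar>f t - poly p t\<bar> < inverse (real (Suc n))" for n
  proof -
    obtain g where g: "real_polynomial_function g" "\<And>t. t \<in> rspec x \<Longrightarrow> \<bar>f t - g t\<bar> < inverse (real (Suc n))"
      using Stone_Weierstrass_real_polynomial_function[OF compact_rspec f, of "inverse (real (Suc n))"] by auto
    then obtain a m where "g = (\<lambda>t. \<Sum>i\<le>m. a i * t ^ i)"
      using real_polynomial_function_iff_sum by auto
    then have "g = poly (\<Sum>i\<le>m. monom (a i) i)" by (auto simp: poly_sum poly_monom)
    then show ?thesis using g(2) by auto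
  qed
  then obtain p where p: "\<And>n t. t \<in> rspec x \<Longrightarrow> \<bar>f t - poly (p n) t\<bar> < inverse (real (Suc n))" by metis
  have "Cauchy (\<lambda>n. rpev (p n) x)"
  proof (rule CauchyI)
    fix e :: real assume "e > 0"
    then obtain N where N: "inverse (real (Suc N)) < e / 4" using reals_Archimedean[of "e / 4"] by auto
    have "norm (rpev (p m) x - rpev (p n) x) < e" if "m \<ge> N" "n \<ge> N" for m n
    proof -
      have s: "inverse (real (Suc k)) \<le> inverse (real (Suc N))" if "k \<ge> N" for k
        using that by (simp add: field_simps)
      have "norm (rpev (p m - p n) x) \<le> e / 2"
      proof (rule norm_rpev_le[OF x])
        fix t assume t: "t \<in> rspec x"
        show "\<bar>poly (p m - p n) t\<bar> \<le> e / 2"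
          using p[OF t, of m] p[OF t, of n] s[OF that(1)] s[OF that(2)] N unfolding poly_diff by linarith
      qed (use \<open>e > 0\<close> in simp)
      then show ?thesis using \<open>e > 0\<close> by (simp add: rpev_diff)
    qed
    then show "\<exists>M. \<forall>m\<ge>M. \<forall>n\<ge>M. norm (rpev (p m) x - rpev (p n) x) < e" by blast
  qed
  then obtain y where y: "(\<lambda>n. rpev (p n) x) \<longlonglongrightarrow> y" using Cauchy_convergent_iff convergent_def by blast
  moreover have "uniform_limit (rspec x) (\<lambda>n. poly (p n)) f sequentially"
  proof (rule uniform_limitI)
    fix e :: real assume "e > 0"
    then have "\<forall>\<^sub>F n in sequentially. inverse (real (Suc n)) < e"
      using LIMSEQ_inverse_real_of_nat order_tendstoD(2) by blast
    then show "\<forall>\<^sub>F n in sequentially. \<forall>t\<in>rspec x. dist (poly (p n) t) (f t) < e"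
    proof eventually_elim
      case (elim n)
      then show ?case using p[of _ n] by (force simp: dist_real_def abs_minus_commute)
    qed
  qed
  ultimately show ?thesis unfolding fcalc_def by blast
qed

lemma fcalc_add:
  assumes "fcalc x f y" "fcalc x g z"
  shows "fcalc x (\<lambda>t. f t + g t) (y + z)"
proof -
  obtain p q where pq: "(\<lambda>n. rpev (p n) x) \<longlonglongrightarrow> y" "uniform_limit (rspec x) (\<lambda>n. poly (p n)) f sequentially"
    "(\<lambda>n. rpev (q n) x) \<longlonglongrightarrow> z" "uniform_limit (rspec x) (\<lambda>n. poly (q n)) g sequentially"
    using assms unfolding fcalc_def by blast
  have "(\<lambda>n. rpev (p n + q n) x) \<longlonglongrightarrow> y + z"
    unfolding rpev_add by (intro tendsto_add pq)
  moreover have "uniform_limit (rspec x) (\<lambda>n. poly (p n + q n)) (\<lambda>t. f t + g t) sequentially"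
    using uniform_limit_add[OF pq(2,4)] by (simp add: poly_add[abs_def])
  ultimately show ?thesis unfolding fcalc_def by (intro exI[of _ "\<lambda>n. p n + q n"]) blast
qed

lemma fcalc_scale:
  assumes "fcalc x f y"
  shows "fcalc x (\<lambda>t. c * f t) (c *\<^sub>R y)"
proof -
  obtain p where p: "(\<lambda>n. rpev (p n) x) \<longlonglongrightarrow> y" "uniform_limit (rspec x) (\<lambda>n. poly (p n)) f sequentially"
    using assms unfolding fcalc_def by blast
  have "(\<lambda>n. rpev (smult c (p n)) x) \<longlonglongrightarrow> c *\<^sub>R y"
    unfolding rpev_smult by (intro tendsto_intros p)
  moreover have "uniform_limit (rspec x) (\<lambda>n. poly (smult c (p n))) (\<lambda>t. c * f t) sequentially"
    using bounded_linear.uniform_limit[OF bounded_linear_mult_right p(2), of c] by (simp add: poly_smult[abs_def])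
  ultimately show ?thesis unfolding fcalc_def by (intro exI[of _ "\<lambda>n. smult c (p n)"]) blast
qed

lemma fcalc_diff:
  assumes "fcalc x f y" "fcalc x g z"
  shows "fcalc x (\<lambda>t. f t - g t) (y - z)"
  using fcalc_add[OF assms(1) fcalc_scale[OF assms(2), of "-1"]] by simp

lemma fcalc_sum:
  assumes "\<And>i. i \<in> I \<Longrightarrow> fcalc x (f i) (y i)"
  shows "fcalc x (\<lambda>t. \<Sum>i\<in>I. f i t) (\<Sum>i\<in>I. y i)"
  using assms
proof (induction I rule: infinite_finite_induct)
  case (insert i I)
  then show ?case by (simp add: fcalc_add)
qed (use fcalc_poly[of x 0] in \<open>simp_all add: poly_0[abs_def]\<close>)

lemma norm_fcalc_le:
  assumes x: "st x = x" and y: "fcalc x f y" and bd: "\<And>t. t \<in> rspec x \<Longrightarrow> \<bar>f t\<bar> \<le> M" and M: "M \<ge> 0"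
  shows "norm y \<le> M"
proof (rule field_le_epsilon)
  fix e :: real assume e: "e > 0"
  obtain p where p: "(\<lambda>n. rpev (p n) x) \<longlonglongrightarrow> y" "uniform_limit (rspec x) (\<lambda>n. poly (p n)) f sequentially"
    using y unfolding fcalc_def by blast
  have "\<forall>\<^sub>F n in sequentially. norm (rpev (p n) x) \<le> M + e"
    using uniform_limitD[OF p(2) e]
  proof eventually_elim
    case (elim n)
    then show ?case
      using bd M e by (intro norm_rpev_le[OF x]) (force simp: dist_real_def)+
  qed
  then show "norm y \<le> M + e"
    using tendsto_upperbound[OF tendsto_norm[OF p(1)]] by simp
qed

lemma fcalc_unique:
  assumes "st x = x" "fcalc x f y" "fcalc x f z"
  shows "y = z"
  using norm_fcalc_le[OF assms(1) fcalc_diff[OF assms(2,3)], of 0] by simp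

lemma fcalc_mult:
  assumes x: "st x = x" and f: "continuous_on (rspec x) f" and g: "continuous_on (rspec x) g"
    and "fcalc x f y" "fcalc x g z"
  shows "fcalc x (\<lambda>t. f t * g t) (y * z)"
proof -
  obtain p q where pq: "(\<lambda>n. rpev (p n) x) \<longlonglongrightarrow> y" "uniform_limit (rspec x) (\<lambda>n. poly (p n)) f sequentially"
    "(\<lambda>n. rpev (q n) x) \<longlonglongrightarrow> z" "uniform_limit (rspec x) (\<lambda>n. poly (q n)) g sequentially"
    using assms unfolding fcalc_def by blast
  have "(\<lambda>n. rpev (p n * q n) x) \<longlonglongrightarrow> y * z"
    unfolding rpev_mult by (intro tendsto_mult pq)
  moreover have "bounded (f ` rspec x)" "bounded (g ` rspec x)"
    using compact_rspec f g by (auto intro!: compact_imp_bounded compact_continuous_image)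
  then have "uniform_limit (rspec x) (\<lambda>n. poly (p n * q n)) (\<lambda>t. f t * g t) sequentially"
    using uniform_lim_mult[OF pq(2,4)] by (simp add: poly_mult[abs_def])
  ultimately show ?thesis unfolding fcalc_def by (intro exI[of _ "\<lambda>n. p n * q n"]) blast
qed

lemma st_fcalc:
  assumes x: "st x = x" and y: "fcalc x f y"
  shows "st y = y"
proof -
  obtain p where p: "(\<lambda>n. rpev (p n) x) \<longlonglongrightarrow> y" using y unfolding fcalc_def by blast
  then have "(\<lambda>n. st (rpev (p n) x)) \<longlonglongrightarrow> st y"
    by (rule bounded_linear.tendsto[OF bounded_linear_st])
  then show ?thesis using p LIMSEQ_unique by (simp add: st_rpev[OF x])
qed

text \<open>On an element killed by \<open>x\<close> a polynomial acts as its value at 0. A nonzero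
  such element puts 0 into the spectrum, so these values tend to \<open>f 0\<close>. This places
  spectral projections into corners.\<close>

lemma fcalc_annihilate:
  assumes "x * w = 0" "f 0 = 0" "fcalc x f y"
  shows "y * w = 0"
proof (cases "w = 0")
  case False
  have "0 \<in> rspec x"
  proof (rule ccontr)
    assume "0 \<notin> rspec x"
    then have "alg_invertible x" by (simp add: rspec_def)
    then have "w = ainv x * (x * w)" by (simp add: ainv_left flip: mult.assoc)
    then show False using assms False by simp
  qed
  obtain p where p: "(\<lambda>n. rpev (p n) x) \<longlonglongrightarrow> y" "uniform_limit (rspec x) (\<lambda>n. poly (p n)) f sequentially"
    using assms unfolding fcalc_def by blast
  have "(\<lambda>n. poly (p n) 0) \<longlonglongrightarrow> 0"
    using tendsto_uniform_limitI[OF p(2) \<open>0 \<in> rspec x\<close>] assms by simp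
  then have "(\<lambda>n. rpev (p n) x * w) \<longlonglongrightarrow> 0 *\<^sub>R w"
    unfolding rpev_annihilate[OF assms(1)] by (intro tendsto_intros)
  moreover have "(\<lambda>n. rpev (p n) x * w) \<longlonglongrightarrow> y * w" by (intro tendsto_intros p)
  ultimately show ?thesis using LIMSEQ_unique by fastforce
qed simp

section \<open>Projections and corners\<close>

definition proj :: "'a \<Rightarrow> bool" where "proj p \<longleftrightarrow> st p = p \<and> p * p = p"

lemma proj_compl: "proj p \<Longrightarrow> proj (1 - p)"
  by (simp add: proj_def st_diff algebra_simps)

lemma proj_0 [simp]: "proj 0" and proj_1 [simp]: "proj 1"
  by (simp_all add: proj_def)

lemma norm_proj_le:
  assumes "proj p"
  shows "norm p \<le> 1"
proof -
  have "norm p * norm p = norm p"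
    using norm_square_hermitian[of p] assms by (simp add: proj_def)
  then show ?thesis by (cases "norm p = 0") auto
qed

lemma norm_proj_mult_le: "proj p \<Longrightarrow> norm (p * x) \<le> norm x"
  and norm_mult_proj_le: "proj p \<Longrightarrow> norm (x * p) \<le> norm x"
  using norm_mult_ineq[of p x] norm_mult_ineq[of x p] norm_proj_le[of p]
    mult_right_mono[of "norm p" 1 "norm x"] mult_left_mono[of "norm p" 1 "norm x"]
  by (auto intro: order_trans)

lemma corner_iff:
  assumes "p * p = (p::'a)"
  shows "p * x * p = x \<longleftrightarrow> p * x = x \<and> x * p = x"
proof
  assume x: "p * x * p = x"
  have "p * (p * y) = p * y" for y using assms by (simp flip: mult.assoc)
  then have "p * (p * x * p) = p * x * p" "(p * x * p) * p = p * x * p"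
    by (simp_all add: mult.assoc assms)
  then show "p * x = x \<and> x * p = x" by (metis x)
qed simp

lemma invertible_hermitian_inverse:
  assumes "st x = x" "alg_invertible x"
  shows "st (ainv x) = ainv x"
proof -
  have "x * st (ainv x) = 1" "st (ainv x) * x = 1"
    using arg_cong[OF ainv_left[OF assms(2)], of st] arg_cong[OF ainv_right[OF assms(2)], of st] assms(1)
    by (simp_all add: st_mult)
  then show ?thesis by (rule ainv_eqI[symmetric])
qed

end

locale real_rank_zero_cstar = cstar +
  assumes rr0: "real_rank_zero st"
begin

text \<open>Perturb \<open>k - t\<close> to an invertible element of the whole algebra and take the Schur complement
  with respect to the complementary corner.\<close>

lemma corner_avoid:
  assumes p: "proj p" and k: "st k = k" "p * k * p = k" and t: "t \<noteq> 0" and e: "e > 0"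
  shows "\<exists>k'. st k' = k' \<and> p * k' * p = k' \<and> norm (k - k') < e \<and> t \<notin> rspec k'"
proof -
  define q where "q = 1 - p"
  have P: "st p = p" "p * p = p" and Q: "st q = q" "q * q = q" and pq: "p * q = 0" "q * p = 0" "p + q = 1"
    using p proj_compl[OF p] unfolding proj_def by (simp_all add: q_def algebra_simps)
  have kp: "p * k = k" "k * p = k" using k(2) corner_iff[OF P(2)] by auto
  have kq: "q * k = 0" "k * q = 0" using kp by (simp_all add: q_def left_diff_distrib right_diff_distrib)
  have "p * (p * x) = p * x" "q * (q * x) = q * x" "p * (q * x) = 0" "q * (p * x) = 0"
    "p * (k * x) = k * x" "k * (p * x) = k * x" "q * (k * x) = 0" "k * (q * x) = 0" for x
    using P Q pq kp kq by (simp_all flip: mult.assoc)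
  note PQ = this P Q pq(1,2) kp kq mult.assoc distrib_left distrib_right left_diff_distrib right_diff_distrib
  \<comment> \<open>The bound \<open>\<bar>t\<bar> / 4\<close> makes \<open>c\<close> invertible
    with inverse of norm at most \<open>2 / \<bar>t\<bar>\<close> and keeps the quadratic Schur
    correction below half of \<open>norm h\<close>.\<close>
  define d where "d = min (min (\<bar>t\<bar> / 4) (e / 4)) 1"
  have d: "d > 0" "d \<le> \<bar>t\<bar> / 4" "d \<le> e / 4" using t e by (auto simp: d_def)
  have "st (k - t *\<^sub>R 1) = k - t *\<^sub>R 1" using k by (simp add: st_diff st_scaleR)
  then obtain b where b: "st b = b" "alg_invertible b" "norm ((k - t *\<^sub>R 1) - b) < d"
    using rr0 d(1) unfolding real_rank_zero_def by blast
  define h where "h = b - (k - t *\<^sub>R 1)"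
  have h: "norm h < d" "st h = h" and bh: "b = k - t *\<^sub>R 1 + h"
    using b k by (simp_all add: h_def norm_minus_commute st_diff st_scaleR)
  \<comment> \<open>The lower corner \<open>q * b * q\<close> is filled up by \<open>- t\<close> on
    \<open>p\<close>, so that it can be inverted in the whole algebra as a perturbation of
    \<open>- t\<close>.\<close>
  define c where "c = q * b * q - t *\<^sub>R p"
  have ch: "c = - t *\<^sub>R 1 + q * h * q"
  proof -
    have "q * b * q = q * h * q - t *\<^sub>R q"
      unfolding bh by (simp add: PQ)
    moreover have "t *\<^sub>R 1 = t *\<^sub>R p + t *\<^sub>R q" using pq(3) by (simp flip: scaleR_add_right)
    ultimately show ?thesis by (simp add: c_def algebra_simps)
  qed
  have nq: "norm (q * h * q) \<le> norm h"
    using norm_mult_proj_le[OF proj_compl[OF p], of "q * h"] norm_proj_mult_le[OF proj_compl[OF p], of h]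
    by (simp add: q_def)
  have cinv: "alg_invertible c" and cn: "norm (ainv c) \<le> 2 / \<bar>t\<bar>"
  proof -
    let ?y = "(1 / t) *\<^sub>R (q * h * q)"
    have "norm ?y = norm (q * h * q) / \<bar>t\<bar>" by simp
    also have "\<dots> \<le> (\<bar>t\<bar> / 4) / \<bar>t\<bar>" using nq h d t by (intro divide_right_mono) auto
    finally have y: "norm ?y \<le> 1/4" using t by simp
    have "c = emb (of_real (- t)) * (1 - ?y)" unfolding ch emb_of_real_mult using t by (simp add: scaleR_diff_right)
    moreover have "alg_invertible (emb (of_real (- t)) * (1 - ?y))"
      using y t by (intro alg_invertible_mult neumann alg_invertible_emb) auto
    ultimately show ci: "alg_invertible c" by simp
    have "t *\<^sub>R ainv c = (q * h * q) * ainv c - 1"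
      using ainv_right[OF ci] unfolding ch by (simp add: algebra_simps)
    then have "\<bar>t\<bar> * norm (ainv c) \<le> norm ((q * h * q) * ainv c) + 1"
      by (metis norm_scaleR norm_triangle_ineq4 norm_one)
    also have "norm ((q * h * q) * ainv c) \<le> (\<bar>t\<bar> / 4) * norm (ainv c)"
      using nq h d by (intro order_trans[OF norm_mult_ineq mult_right_mono]) auto
    finally have "\<bar>t\<bar> * norm (ainv c) \<le> 2" by (simp add: field_simps)
    then show "norm (ainv c) \<le> 2 / \<bar>t\<bar>" using t by (simp add: field_simps)
  qed
  define g where "g = ainv c"
  have g: "c * g = 1" "g * c = 1" using cinv by (simp_all add: g_def ainv_left ainv_right)
  have "st c = c" using b Q P by (simp add: c_def st_diff st_mult st_scaleR mult.assoc)
  then have stg: "st g = g" using invertible_hermitian_inverse cinv by (simp add: g_def)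
  have cp: "c * p = p * c" by (simp add: c_def PQ)
  have gp: "g * p = p * g"
    using cp g by (metis mult.assoc mult_1_left mult_1_right)
  then have gq: "g * q = q * g" by (simp add: q_def left_diff_distrib right_diff_distrib)
  have gb: "g * (q * b * q) = q"
  proof -
    have "g * (q * b * q) = g * (c * q)"
      by (simp add: c_def PQ)
    then show ?thesis using g by (simp flip: mult.assoc)
  qed
  have bg: "(q * b * q) * g = q"
  proof -
    have "(q * b * q) * g = (q * c) * g"
      by (simp add: c_def PQ)
    then show ?thesis using g by (simp add: mult.assoc)
  qed
  define S where "S = p * b * p - p * b * q * g * q * b * p"
  have Sp: "p * S = S" "S * p = S" "S * q = 0" "q * S = 0"
    by (simp_all add: S_def PQ)
  have stS: "st S = S" using P Q b stg by (simp add: S_def st_diff st_mult mult.assoc)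
  \<comment> \<open>Block Gaussian elimination: \<open>L\<close> and \<open>R\<close> are unipotent
    triangular and satisfy \<open>L * b * R = S + q * b * q\<close>, so the Schur complement
    \<open>S\<close> inherits invertibility in the corner.\<close>
  define L where "L = 1 - p * b * q * g"
  define R where "R = 1 - g * q * b * p"
  have Linv: "alg_invertible L"
  proof -
    have "(p * b * q * g) * (p * b * q * g) = 0"
      by (metis gp mult.assoc mult_zero_left mult_zero_right pq(2))
    then have "L * (1 + p * b * q * g) = 1" "(1 + p * b * q * g) * L = 1"
      by (simp_all add: L_def distrib_left distrib_right left_diff_distrib right_diff_distrib mult.assoc)
    then show ?thesis by (auto simp: alg_invertible_def)
  qed
  have Rinv: "alg_invertible R"
  proof -
    have "(g * q * b * p) * (g * q * b * p) = 0"
      by (metis gp gq mult.assoc mult_zero_left mult_zero_right pq(1))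
    then have "R * (1 + g * q * b * p) = 1" "(1 + g * q * b * p) * R = 1"
      by (simp_all add: R_def distrib_left distrib_right left_diff_distrib right_diff_distrib mult.assoc)
    then show ?thesis by (auto simp: alg_invertible_def)
  qed
  have b_split: "b = p * b * p + p * b * q + q * b * p + q * b * q"
  proof -
    have "b = (p + q) * b * (p + q)" by (simp add: pq)
    then show ?thesis by (simp only: distrib_left distrib_right add_ac)
  qed
  have Lb: "L * b = S + q * b * p + q * b * q"
  proof -
    have "p * b * q * g * b = p * b * (g * q * b)"
      using gq by (simp add: mult.assoc)
    also have "g * q * b = g * q * b * p + g * (q * b * q)"
      using pq(3) by (metis distrib_left mult.assoc mult_1_right)
    also have "p * b * (g * q * b * p + g * (q * b * q)) = p * b * q * g * q * b * p + p * b * q"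
      unfolding gb using gq Q by (simp add: distrib_left mult.assoc) (metis mult.assoc)
    finally have e: "p * b * q * g * b = p * b * q * g * q * b * p + p * b * q" .
    have "L * b = b - p * b * q * g * b" by (simp add: L_def left_diff_distrib)
    also have "\<dots> = (p * b * p + p * b * q + q * b * p + q * b * q) - (p * b * q * g * q * b * p + p * b * q)"
      using e b_split by simp
    also have "\<dots> = S + q * b * p + q * b * q" by (simp add: S_def)
    finally show ?thesis .
  qed
  have LbR: "L * b * R = S + q * b * q"
  proof -
    have 1: "S * (g * q * b * p) = 0"
      by (metis Sp(3) gq mult.assoc mult_zero_left)
    have 2: "(q * b * p) * (g * q * b * p) = 0"
      by (metis gp mult.assoc mult_zero_left mult_zero_right pq(1))
    have 3: "(q * b * q) * (g * q * b * p) = q * b * p"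
      using bg Q by (metis mult.assoc)
    have "L * b * R = (S + q * b * p + q * b * q) - (S + q * b * p + q * b * q) * (g * q * b * p)"
      unfolding Lb R_def by (simp add: right_diff_distrib)
    then show ?thesis by (simp add: distrib_right 1 2 3)
  qed
  have "alg_invertible (S + q * b * q)"
    unfolding LbR[symmetric] by (intro alg_invertible_mult Linv Rinv b)
  then obtain w where w: "(S + q * b * q) * w = 1" "w * (S + q * b * q) = 1"
    by (auto simp: alg_invertible_def)
  have Sw: "S * w = p"
  proof -
    have "p * ((S + q * b * q) * w) = S * w"
      by (simp add: distrib_left distrib_right Sp(1) pq(1) flip: mult.assoc)
    then show ?thesis using w by simp
  qed
  have wS: "w * S = p"
  proof -
    have "(w * (S + q * b * q)) * p = w * S"
      by (simp add: distrib_left distrib_right Sp(2) pq(2) mult.assoc)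
    then show ?thesis using w by simp
  qed
  have "alg_invertible (S - t *\<^sub>R q)"
  proof (rule alg_invertible_left_right)
    show "(w * p - (1 / t) *\<^sub>R q) * (S - t *\<^sub>R q) = 1"
      using t pq(3) by (simp add: PQ Sp wS)
    show "(S - t *\<^sub>R q) * (p * w - (1 / t) *\<^sub>R q) = 1"
      using t pq(3) by (simp add: PQ Sw mult.assoc[symmetric, of S] Sp(2,3))
  qed
  \<comment> \<open>\<open>t\<close> is added back only inside the corner; then
    \<open>k' - t\<close> is \<open>S\<close> there and \<open>- t\<close> on \<open>q\<close>,
    hence invertible because \<open>t\<close> is nonzero.\<close>
  define k' where "k' = S + t *\<^sub>R p"
  have "k' - t *\<^sub>R 1 = S - t *\<^sub>R q" by (simp add: k'_def q_def algebra_simps)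
  with \<open>alg_invertible (S - t *\<^sub>R q)\<close> have "t \<notin> rspec k'" by (simp add: rspec_def)
  moreover have "st k' = k'" by (simp add: k'_def st_add stS st_scaleR P)
  moreover have "p * k' * p = k'" by (simp add: k'_def distrib_left distrib_right Sp P)
  moreover have "norm (k - k') < e"
  proof -
    have pbp: "p * b * p = k - t *\<^sub>R p + p * h * p"
      unfolding bh by (simp add: PQ)
    have pbq: "p * b * q = p * h * q" and qbp: "q * b * p = q * h * p"
      unfolding bh by (simp_all add: PQ)
    have "k' - k = p * h * p - (p * h * q) * g * (q * h * p)"
    proof -
      have "S = p * b * p - (p * b * q) * g * (q * b * p)" by (simp add: S_def mult.assoc)
      then show ?thesis by (simp add: k'_def pbp pbq qbp)
    qed
    then have "norm (k - k') \<le> norm (p * h * p) + norm ((p * h * q) * g * (q * h * p))"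
      using norm_triangle_ineq4 by (metis norm_minus_commute)
    also have "norm (p * h * p) \<le> norm h"
      using norm_mult_proj_le[OF p, of "p * h"] norm_proj_mult_le[OF p, of h] by simp
    also have "norm ((p * h * q) * g * (q * h * p)) \<le> (norm h * (2 / \<bar>t\<bar>)) * norm h"
    proof -
      have "norm (p * h * q) \<le> norm h" "norm (q * h * p) \<le> norm h"
        using norm_mult_proj_le[OF proj_compl[OF p], of "p * h"] norm_proj_mult_le[OF p, of h]
          norm_mult_proj_le[OF p, of "q * h"] norm_proj_mult_le[OF proj_compl[OF p], of h]
        by (simp_all add: q_def)
      then have "norm ((p * h * q) * g) \<le> norm h * (2 / \<bar>t\<bar>)"
        using cn \<open>norm (p * h * q) \<le> norm h\<close> unfolding g_def
        by - (rule order_trans[OF norm_mult_ineq mult_mono], auto)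
      then show ?thesis
        using \<open>norm (q * h * p) \<le> norm h\<close> by - (rule order_trans[OF norm_mult_ineq mult_mono], auto)
    qed
    also have "(norm h * (2 / \<bar>t\<bar>)) * norm h \<le> (\<bar>t\<bar> / 4 * (2 / \<bar>t\<bar>)) * norm h"
      using h d by (intro mult_right_mono) auto
    also have "\<dots> = norm h / 2" using t by simp
    finally show ?thesis using h d by simp
  qed
  ultimately show ?thesis by blast
qed

lemma rspec_stable:
  assumes "t \<notin> rspec k"
  obtains e where "e > 0" "\<And>k'. norm (k - k') < e \<Longrightarrow> t \<notin> rspec k'"
proof -
  have "k - t *\<^sub>R 1 \<in> {x. alg_invertible x}" using assms by (simp add: rspec_def)
  then obtain e where e: "e > 0" "ball (k - t *\<^sub>R 1) e \<subseteq> {x. alg_invertible x}"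
    using open_alg_invertible open_contains_ball by blast
  show thesis
  proof
    fix k' assume "norm (k - k') < e"
    then have "k' - t *\<^sub>R 1 \<in> ball (k - t *\<^sub>R 1) e" by (simp add: dist_norm)
    then show "t \<notin> rspec k'" using e by (auto simp: rspec_def)
  qed fact
qed

text \<open>Missing a point is an open condition on the element, so later perturbations can be made
  small enough to keep the earlier points out of the spectrum.\<close>

lemma corner_avoid_finite:
  assumes p: "proj p" and F: "finite F" "0 \<notin> F"
  shows "st k = k \<Longrightarrow> p * k * p = k \<Longrightarrow> e > 0 \<Longrightarrow>
    \<exists>k'. st k' = k' \<and> p * k' * p = k' \<and> norm (k - k') < e \<and> F \<inter> rspec k' = {}"
  using F
proof (induction F arbitrary: k e rule: finite_induct)
  case empty
  then show ?case by (intro exI[of _ k]) simp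
next
  case (insert t F)
  obtain k1 where k1: "st k1 = k1" "p * k1 * p = k1" "norm (k - k1) < e / 2" "t \<notin> rspec k1"
    using corner_avoid[OF p, of k t "e / 2"] insert.prems by auto
  obtain d where d: "d > 0" "\<And>k'. norm (k1 - k') < d \<Longrightarrow> t \<notin> rspec k'"
    using rspec_stable[OF k1(4)] by blast
  obtain k2 where k2: "st k2 = k2" "p * k2 * p = k2" "norm (k1 - k2) < min d (e / 2)" "F \<inter> rspec k2 = {}"
    using insert.IH[of k1 "min d (e / 2)"] insert.prems k1 d by auto
  have "norm (k - k2) < e"
    using norm_triangle_ineq[of "k - k1" "k1 - k2"] k1 k2 by simp
  then show ?case using k2 d(2)[of k2] by (intro exI[of _ k2]) auto
qed

end

section \<open>Traces and commutators\<close>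

definition sublinear :: "('a::real_vector \<Rightarrow> real) \<Rightarrow> bool" where
  "sublinear P \<longleftrightarrow> (\<forall>x y. P (x + y) \<le> P x + P y) \<and> (\<forall>c>0. \<forall>x. P (c *\<^sub>R x) \<le> c * P x)"

lemma sublinear_scaleR:
  assumes "sublinear P" "c > 0"
  shows "P (c *\<^sub>R x) = c * P x"
proof (rule antisym)
  show "P (c *\<^sub>R x) \<le> c * P x" using assms by (simp add: sublinear_def)
  have "P (inverse c *\<^sub>R (c *\<^sub>R x)) \<le> inverse c * P (c *\<^sub>R x)"
    using assms positive_imp_inverse_positive unfolding sublinear_def by blast
  then have "P x \<le> inverse c * P (c *\<^sub>R x)" using assms by simp
  then show "c * P x \<le> P (c *\<^sub>R x)" using assms(2) by (simp add: field_simps)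
qed

lemma sublinear_0:
  assumes "sublinear P"
  shows "P 0 = 0"
  using sublinear_scaleR[OF assms, of 2 0] by simp

lemma sublinear_lower:
  assumes "sublinear P"
  shows "- P (- x) \<le> P x"
  using assms sublinear_0[OF assms] unfolding sublinear_def by (metis add.right_inverse minus_le_iff le_diff_eq diff_0 add.commute diff_le_eq)

lemma le_INF_add:
  fixes F G :: "'i \<Rightarrow> real"
  assumes "A \<noteq> {}" "B \<noteq> {}" "\<And>s t. s \<in> A \<Longrightarrow> t \<in> B \<Longrightarrow> u \<le> F s + G t"
  shows "u \<le> (INF s\<in>A. F s) + (INF t\<in>B. G t)"
proof -
  have "u - F s \<le> (INF t\<in>B. G t)" if "s \<in> A" for s
    using assms that by (intro cINF_greatest) (auto simp: algebra_simps)
  then have "u - (INF t\<in>B. G t) \<le> (INF s\<in>A. F s)"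
    using assms(1) by (intro cINF_greatest) (auto simp: algebra_simps)
  then show ?thesis by simp
qed

text \<open>Lowering a sublinear functional along the ray through \<open>x\<close>; a minimal sublinear functional is
  invariant under this and hence linear.\<close>

lemma sublinear_lowering:
  assumes P: "sublinear P"
  obtains Q where "sublinear Q" "\<And>y. Q y \<le> P y" "\<And>y. Q y \<le> P (y + x) - P x"
proof -
  define F where "F y t = P (y + t *\<^sub>R x) - t * P x" for y t
  define Q where "Q y = (INF t\<in>{0..}. F y t)" for y
  have lower: "- P (- y) \<le> F y t" if "t \<ge> 0" for y t
  proof -
    have "t * P x = P (t *\<^sub>R x)"
      using that sublinear_scaleR[OF P, of t x] sublinear_0[OF P] by (cases "t = 0") auto
    also have "\<dots> \<le> P (y + t *\<^sub>R x) + P (- y)"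
      using P unfolding sublinear_def by (metis add.commute add_minus_cancel)
    finally show ?thesis by (simp add: F_def)
  qed
  have bdd: "bdd_below (F y ` {0..})" for y
    unfolding bdd_below_def using lower by (intro exI[of _ "- P (- y)"]) auto
  have Qle: "Q y \<le> F y t" if "t \<ge> 0" for y t
    unfolding Q_def using that bdd by (intro cINF_lower) auto
  show thesis
  proof
    show "Q y \<le> P y" for y using Qle[of 0 y] by (simp add: F_def)
    show "Q y \<le> P (y + x) - P x" for y using Qle[of 1 y] by (simp add: F_def)
    show "sublinear Q" unfolding sublinear_def
    proof (intro conjI allI impI)
      fix y z
      show "Q (y + z) \<le> Q y + Q z"
        unfolding Q_def[of y] Q_def[of z]
      proof (rule le_INF_add)
        fix s t :: real assume st: "s \<in> {0..}" "t \<in> {0..}"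
        have "Q (y + z) \<le> F (y + z) (s + t)" using st by (intro Qle) auto
        also have "\<dots> = P ((y + s *\<^sub>R x) + (z + t *\<^sub>R x)) - (s + t) * P x"
          unfolding F_def by (simp add: algebra_simps)
        also have "\<dots> \<le> F y s + F z t"
        proof -
          have "P ((y + s *\<^sub>R x) + (z + t *\<^sub>R x)) \<le> P (y + s *\<^sub>R x) + P (z + t *\<^sub>R x)"
            using P unfolding sublinear_def by blast
          then show ?thesis by (simp add: F_def distrib_right)
        qed
        finally show "Q (y + z) \<le> F y s + F z t" .
      qed auto
    next
      fix c :: real and y assume c: "c > 0"
      have "inverse c * Q (c *\<^sub>R y) \<le> F y t" if "t \<in> {0..}" for t
      proof -
        have "Q (c *\<^sub>R y) \<le> F (c *\<^sub>R y) (c * t)" using that c by (intro Qle) auto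
        also have "\<dots> = P (c *\<^sub>R (y + t *\<^sub>R x)) - c * t * P x"
          by (simp add: F_def scaleR_add_right)
        also have "\<dots> = c * F y t" unfolding sublinear_scaleR[OF P c] F_def by (simp add: right_diff_distrib mult.assoc)
        finally show ?thesis using c by (simp add: field_simps)
      qed
      then have "inverse c * Q (c *\<^sub>R y) \<le> Q y"
        unfolding Q_def[of y] by (intro cINF_greatest) auto
      then show "Q (c *\<^sub>R y) \<le> c * Q y" using c by (simp add: field_simps)
    qed
  qed
qed

text \<open>Zorn's lemma, downwards. The infimum of a chain is finite because each member lies above
  \<open>- P (- x)\<close>, and subadditive because two members of a chain have a common lower
  one.\<close>

lemma sublinear_minimal:
  assumes P: "sublinear P"
  obtains Q where "sublinear Q" "Q \<le> P" "\<And>R. sublinear R \<Longrightarrow> R \<le> Q \<Longrightarrow> R = Q"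
proof -
  define A where "A = {Q. sublinear Q \<and> Q \<le> P}"
  have "\<exists>m\<in>A. \<forall>a\<in>A. a \<le> m \<longrightarrow> a = m"
  proof (rule predicate_Zorn)
    show "partial_order_on A (relation_of (\<lambda>Q R. R \<le> Q) A)"
      by (rule partial_order_on_relation_ofI) auto
    fix C assume "C \<in> Chains (relation_of (\<lambda>Q R. R \<le> Q) A)"
    then have CA: "C \<subseteq> A" and ch: "\<And>Q R. Q \<in> C \<Longrightarrow> R \<in> C \<Longrightarrow> Q \<le> R \<or> R \<le> Q"
      unfolding Chains_def relation_of_def by blast+
    show "\<exists>u\<in>A. \<forall>a\<in>C. u \<le> a"
    proof (cases "C = {}")
      case True
      then show ?thesis using P by (auto simp: A_def)
    next
      case False
      define u where "u x = (INF Q\<in>C. Q x)" for x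
      have "- P (- x) \<le> Q x" if "Q \<in> C" for Q x
      proof -
        have "sublinear Q" "Q (- x) \<le> P (- x)" using that CA by (auto simp: A_def le_fun_def)
        then show ?thesis using sublinear_lower[of Q x] by linarith
      qed
      then have bdd: "bdd_below ((\<lambda>Q. Q x) ` C)" for x
        unfolding bdd_below_def by blast
      have ule: "u x \<le> Q x" if "Q \<in> C" for Q x
        unfolding u_def using that bdd by (intro cINF_lower) auto
      have "sublinear u" unfolding sublinear_def
      proof (intro conjI allI impI)
        fix x y
        show "u (x + y) \<le> u x + u y" unfolding u_def[of x] u_def[of y]
        proof (rule le_INF_add[OF False False])
          fix Q R assume QR: "Q \<in> C" "R \<in> C"
          obtain M where M: "M \<in> C" "M \<le> Q" "M \<le> R" using ch[OF QR] QR by blast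
          have "u (x + y) \<le> M (x + y)" by (rule ule[OF M(1)])
          also have "\<dots> \<le> M x + M y" using M(1) CA by (auto simp: A_def sublinear_def)
          also have "\<dots> \<le> Q x + R y" using M by (intro add_mono) (auto simp: le_fun_def)
          finally show "u (x + y) \<le> Q x + R y" .
        qed
      next
        fix c :: real and x assume c: "c > 0"
        have "inverse c * u (c *\<^sub>R x) \<le> Q x" if "Q \<in> C" for Q
        proof -
          have "u (c *\<^sub>R x) \<le> c * Q x"
            using ule[OF that, of "c *\<^sub>R x"] that CA sublinear_scaleR[of Q c x] c by (auto simp: A_def)
          then show ?thesis using c by (simp add: field_simps)
        qed
        then have "inverse c * u (c *\<^sub>R x) \<le> u x"
          unfolding u_def[of x] using False by (intro cINF_greatest) auto
        then show "u (c *\<^sub>R x) \<le> c * u x" using c by (simp add: field_simps)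
      qed
      moreover obtain Q0 where "Q0 \<in> C" using False by blast
      then have "u \<le> P" using ule[of Q0] CA by (auto simp: A_def le_fun_def intro: order_trans)
      ultimately have "u \<in> A" by (simp add: A_def)
      then show ?thesis using ule by (auto simp: le_fun_def)
    qed
  qed
  then obtain Q where "Q \<in> A" "\<And>R. R \<in> A \<Longrightarrow> R \<le> Q \<Longrightarrow> R = Q" by blast
  then show thesis
    by (intro that[of Q]) (auto simp: A_def intro: order_trans)
qed

text \<open>A preliminary lowering along \<open>x0\<close> pushes the value at \<open>- x0\<close>
  down to \<open>- P x0\<close>; every linear functional below it then attains \<open>P x0\<close>
  at \<open>x0\<close>.\<close>

theorem hahn_banach_sublinear:
  fixes P :: "'a::real_vector \<Rightarrow> real"
  assumes P: "sublinear P"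
  obtains f where "linear f" "\<And>x. f x \<le> P x" "f x0 = P x0"
proof -
  obtain Q0 where Q0: "sublinear Q0" "\<And>y. Q0 y \<le> P y" "\<And>y. Q0 y \<le> P (y + x0) - P x0"
    using sublinear_lowering[OF P] by metis
  obtain Q where Q: "sublinear Q" "Q \<le> Q0" "\<And>R. sublinear R \<Longrightarrow> R \<le> Q \<Longrightarrow> R = Q"
    using sublinear_minimal[OF Q0(1)] by metis
  have add: "Q (y + x) = Q y + Q x" for x y
  proof (rule antisym)
    show "Q (y + x) \<le> Q y + Q x" using Q(1) by (simp add: sublinear_def)
    obtain R where R: "sublinear R" "\<And>y. R y \<le> Q y" "\<And>y. R y \<le> Q (y + x) - Q x"
      using sublinear_lowering[OF Q(1)] by metis
    have "R = Q" using R by (intro Q(3)) (auto simp: le_fun_def)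
    then show "Q y + Q x \<le> Q (y + x)" using R(3)[of y] by simp
  qed
  have neg: "Q (- x) = - Q x" for x
    using add[of x "- x"] sublinear_0[OF Q(1)] by simp
  have "linear Q"
  proof (rule linearI)
    show "Q (c *\<^sub>R x) = c *\<^sub>R Q x" for c x
    proof -
      consider "c > 0" | "c = 0" | "- c > 0" by linarith
      then show ?thesis
      proof cases
        case 3
        then show ?thesis using sublinear_scaleR[OF Q(1) 3, of x] by (simp add: neg)
      qed (use sublinear_scaleR[OF Q(1)] sublinear_0[OF Q(1)] in auto)
    qed
  qed (rule add)
  moreover have "Q x \<le> P x" for x using Q(2) Q0(2) by (auto simp: le_fun_def intro: order_trans)
  moreover have "Q x0 = P x0"
  proof (rule antisym)
    show "Q x0 \<le> P x0" by fact
    have "Q (- x0) \<le> Q0 (- x0)" using Q(2) by (simp add: le_fun_def)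
    also have "\<dots> \<le> P (- x0 + x0) - P x0" by (rule Q0(3))
    finally have "Q (- x0) \<le> P (- x0 + x0) - P x0" .
    then show "P x0 \<le> Q x0" using sublinear_0[OF P] by (simp add: neg)
  qed
  ultimately show thesis by (rule that)
qed

text \<open>A gap of the spectrum at \<open>c\<close> makes the jump continuous on the spectrum, so
  that the functional calculus produces projections.\<close>

lemma continuous_on_step:
  fixes c :: real
  assumes "c \<notin> S"
  shows "continuous_on S (\<lambda>s. if s > c then 1 else 0 :: real)"
proof (rule continuous_on_subset)
  show "continuous_on ({..<c} \<union> {c<..}) (\<lambda>s. if s > c then 1 else 0 :: real)"
  proof (rule continuous_on_open_Un)
    show "continuous_on {..<c} (\<lambda>s. if s > c then 1 else 0 :: real)"
      by (rule continuous_on_eq[of _ "\<lambda>_. 0"]) auto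
    show "continuous_on {c<..} (\<lambda>s. if s > c then 1 else 0 :: real)"
      by (rule continuous_on_eq[of _ "\<lambda>_. 1"]) auto
  qed auto
  show "S \<subseteq> {..<c} \<union> {c<..}"
  proof
    fix x assume "x \<in> S"
    then have "x \<noteq> c" using assms by blast
    then show "x \<in> {..<c} \<union> {c<..}" by (auto simp: neq_iff)
  qed
qed

context cstar
begin

lemma hermitian_parts:
  obtains h k where "st h = h" "st k = k" "x = h + emb \<i> * k"
proof
  let ?h = "(1/2) *\<^sub>R (x + st x)" and ?k = "emb (- \<i>) * ((1/2) *\<^sub>R (x - st x))"
  show "st ?h = ?h" by (simp add: st_scaleR st_add add.commute)
  have "st ?k = ((1/2) *\<^sub>R (st x - x)) * emb \<i>"
    by (simp add: st_mult st_scaleR st_diff st_emb)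
  also have "\<dots> = ?k" by (simp add: emb_minus emb_commute algebra_simps)
  finally show "st ?k = ?k" .
  have "emb \<i> * ?k = (1/2) *\<^sub>R (x - st x)" by (simp flip: mult.assoc emb_mult)
  then show "x = ?h + emb \<i> * ?k" by (simp add: scaleR_add_right scaleR_diff_right flip: scaleR_add_left)
qed

lemma proj_sum:
  assumes "finite J" "\<And>i. i \<in> J \<Longrightarrow> proj (q i)" "\<And>i j. i \<in> J \<Longrightarrow> j \<in> J \<Longrightarrow> i \<noteq> j \<Longrightarrow> q i * q j = 0"
  shows "proj (sum q J)"
proof -
  have "sum q J * sum q J = (\<Sum>i\<in>J. \<Sum>j\<in>J. q i * q j)" by (rule sum_product)
  also have "\<dots> = (\<Sum>i\<in>J. \<Sum>j\<in>J. if i = j then q i else 0)"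
    using assms by (intro sum.cong refl) (auto simp: proj_def)
  also have "\<dots> = sum q J" using assms(1) by simp
  finally show ?thesis using assms(2) by (simp add: proj_def st_sum)
qed

lemma proj_add: "proj p \<Longrightarrow> proj q \<Longrightarrow> p * q = 0 \<Longrightarrow> proj (p + q)"
proof -
  assume a: "proj p" "proj q" "p * q = 0"
  have "q * p = st (p * q)" using a(1,2) by (simp add: st_mult proj_def)
  then have "q * p = 0" using a(3) by simp
  then show ?thesis using a by (simp add: proj_def st_add algebra_simps)
qed

lemma proj_diff: "proj p \<Longrightarrow> proj q \<Longrightarrow> p * q = q \<Longrightarrow> proj (p - q)"
proof -
  assume a: "proj p" "proj q" "p * q = q"
  have "q * p = st (p * q)" using a(1,2) by (simp add: st_mult proj_def)
  then have "q * p = q" using a(2,3) by (simp add: proj_def)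
  then show ?thesis using a by (simp add: proj_def st_diff algebra_simps)
qed

end

context real_rank_zero_cstar
begin

text \<open>After a perturbation inside the corner the spectrum misses a grid of mesh
  \<open>d\<close>. Differences of the step functions at the grid points are indicators of the cells
  and give orthogonal projections.\<close>

theorem corner_decomposition:
  assumes p: "proj p" and k: "st k = k" "p * k * p = k" and e: "e > 0"
  obtains I :: "int set" and l q where "finite I" "\<And>i. i \<in> I \<Longrightarrow> proj (q i)"
    "\<And>i. i \<in> I \<Longrightarrow> p * q i = q i" "\<And>i. i \<in> I \<Longrightarrow> q i * p = q i"
    "\<And>i j. i \<in> I \<Longrightarrow> j \<in> I \<Longrightarrow> i \<noteq> j \<Longrightarrow> q i * q j = 0"
    "\<And>i. i \<in> I \<Longrightarrow> \<bar>l i\<bar> \<le> norm k" "norm (k - (\<Sum>i\<in>I. l i *\<^sub>R q i)) < e"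
proof -
  define d where "d = e / 4"
  have d: "d > 0" using e by (simp add: d_def)
  obtain m :: nat where m: "(norm k + d) / d < real m" using reals_Archimedean2 by blast
  then have m: "norm k + d < real m * d" using d by (simp add: field_simps)
  \<comment> \<open>Half-integer multiples keep the grid away from 0, a point that corner elements
    cannot be expected to avoid, and centre the cells at the multiples of \<open>d\<close>.\<close>
  define t where "t i = (real_of_int i + 1/2) * d" for i
  define D where "D = {- int m - 1 .. int m}"
  have "0 \<notin> t ` D"
  proof
    assume "0 \<in> t ` D"
    then obtain i :: int where "real_of_int i + 1/2 = 0" using d by (auto simp: t_def)
    then have "real_of_int (2 * i + 1) = 0" by simp
    then have "2 * i + 1 = 0" by (simp only: of_int_eq_0_iff)
    then show False by presburger
  qed
  then obtain k' where k': "st k' = k'" "p * k' * p = k'" "norm (k - k') < d" "t ` D \<inter> rspec k' = {}"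
    using corner_avoid_finite[OF p, of "t ` D" k d] k d by (auto simp: D_def)
  define H where "H i s = (if s > t i then 1 else 0 :: real)" for i s
  have Hc: "continuous_on (rspec k') (H i)" if "i \<in> D" for i
    unfolding H_def[abs_def] using that k'(4) by (intro continuous_on_step) auto
  then have "\<exists>y. fcalc k' (H i) y" if "i \<in> D" for i
    using that by (intro fcalc_exists k') auto
  then obtain Y where Y: "\<And>i. i \<in> D \<Longrightarrow> fcalc k' (H i) (Y i)" by metis
  define f where "f i s = H (i - 1) s - H i s" for i s
  define q where "q i = Y (i - 1) - Y i" for i
  define J where "J = {- int m .. int m}"
  \<comment> \<open>The cell around 0 is dropped: its coefficient would be 0 anyway, and its
    projection need not lie in the corner. The other indicators vanish at 0.\<close>
  define I where "I = J - {0}"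
  have JD: "i \<in> D" "i - 1 \<in> D" if "i \<in> J" for i using that by (auto simp: J_def D_def)
  have fq: "fcalc k' (f i) (q i)" if "i \<in> J" for i
    unfolding f_def[abs_def] q_def using JD[OF that] by (intro fcalc_diff Y)
  have fc: "continuous_on (rspec k') (f i)" if "i \<in> J" for i
    unfolding f_def[abs_def] using JD[OF that] by (intro continuous_on_diff Hc)
  have f: "f i s = (if i = \<lceil>s / d - 1/2\<rceil> then 1 else 0)" for i s
  proof -
    have "s > t (i - 1) \<longleftrightarrow> real_of_int i - 1 < s / d - 1/2" using d by (simp add: t_def field_simps)
    moreover have "s > t i \<longleftrightarrow> \<not> s / d - 1/2 \<le> real_of_int i" using d by (auto simp: t_def field_simps)
    moreover have "t (i - 1) < t i" using d by (simp add: t_def)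
    moreover have "i = \<lceil>s / d - 1/2\<rceil> \<longleftrightarrow> real_of_int i - 1 < s / d - 1/2 \<and> s / d - 1/2 \<le> real_of_int i"
      by (metis ceiling_eq_iff)
    ultimately show ?thesis unfolding f_def H_def by auto
  qed
  have qq: "q i * q j = (if i = j then q i else 0)" if "i \<in> J" "j \<in> J" for i j
  proof -
    have m: "fcalc k' (\<lambda>s. f i s * f j s) (q i * q j)"
      using that by (intro fcalc_mult k' fc fq)
    show ?thesis
    proof (cases "i = j")
      case True
      have "fcalc k' (f i) (q i * q j)" by (rule fcalc_cong[OF m]) (simp add: True f)
      then show ?thesis using fcalc_unique[OF k'(1)] fq that True by auto
    next
      case False
      have "fcalc k' (\<lambda>s. 0) (q i * q j)" by (rule fcalc_cong[OF m]) (use False in \<open>auto simp: f\<close>)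
      then show ?thesis using norm_fcalc_le[OF k'(1), of "\<lambda>s. 0" _ 0] False by simp
    qed
  qed
  have pq: "proj (q i)" if "i \<in> J" for i
    using qq[OF that that] st_fcalc[OF k'(1) fq[OF that]] by (simp add: proj_def)
  have k'p: "k' * p = k'" using k'(2) corner_iff p by (simp add: proj_def)
  have qp: "q i * p = q i" if "i \<in> I" for i
  proof -
    have "q i * (1 - p) = 0"
    proof (rule fcalc_annihilate)
      show "k' * (1 - p) = 0" by (simp add: right_diff_distrib k'p)
      have "\<lceil>- (1/2) :: real\<rceil> = 0" by (simp add: ceiling_eq_iff)
      then show "f i 0 = 0" using that by (simp add: f I_def)
      show "fcalc k' (f i) (q i)" using that by (intro fq) (simp add: I_def)
    qed
    then show ?thesis by (simp add: right_diff_distrib)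
  qed
  define N where "N = norm k"
  \<comment> \<open>Clipping the cell centres makes the coefficients obey the bound
    \<open>norm k\<close> exactly, as \<open>corner_bounds\<close> requires. The spectrum exceeds
    \<open>[-N, N]\<close> by at most \<open>d\<close>, so little is lost.\<close>
  define clip where "clip s = max (- N) (min N s)" for s
  have N: "N \<ge> 0" by (simp add: N_def)
  define l where "l i = clip (real_of_int i * d)" for i
  have "fcalc k' (\<lambda>s. \<Sum>i\<in>I. l i * f i s) (\<Sum>i\<in>I. l i *\<^sub>R q i)"
    by (intro fcalc_sum fcalc_scale fq) (simp add: I_def)
  moreover have "fcalc k' (\<lambda>s. s) k'" using fcalc_cong[OF fcalc_poly[of k' "[:0, 1:]"], of "\<lambda>s. s"] by simp
  ultimately have "fcalc k' (\<lambda>s. s - (\<Sum>i\<in>I. l i * f i s)) (k' - (\<Sum>i\<in>I. l i *\<^sub>R q i))"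
    by (intro fcalc_diff)
  then have "norm (k' - (\<Sum>i\<in>I. l i *\<^sub>R q i)) \<le> 2 * d"
  proof (rule norm_fcalc_le[OF k'(1)])
    fix s assume "s \<in> rspec k'"
    then have s: "\<bar>s\<bar> \<le> norm k'" by (rule rspec_norm)
    have "norm k' \<le> N + d" using k'(3) norm_triangle_sub[of k' k] by (simp add: N_def norm_minus_commute)
    with s have s: "\<bar>s\<bar> \<le> N + d" by simp
    define i where "i = \<lceil>s / d - 1/2\<rceil>"
    have i: "real_of_int i - 1 < s / d - 1/2" "s / d - 1/2 \<le> real_of_int i"
      unfolding i_def by linarith+
    then have "real_of_int i * d < s + d / 2" "s \<le> real_of_int i * d + d / 2"
      using d by (auto simp: field_simps)
    then have i': "\<bar>s - real_of_int i * d\<bar> \<le> d / 2" by linarith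
    have sm: "\<bar>s / d\<bar> < real m" using s m d by (simp add: N_def abs_divide field_simps)
    then have "real_of_int i < real m + 1" "real_of_int i > - real m - 1"
      using i by linarith+
    then have "i \<le> int m" "i \<ge> - int m" by linarith+
    then have iJ: "i \<in> J" by (simp add: J_def)
    have "(\<Sum>j\<in>I. l j * f j s) = (\<Sum>j\<in>I. if j = i then l i else 0)"
      by (intro sum.cong refl) (simp add: f i_def)
    also have "\<dots> = l i"
      using iJ N by (auto simp: I_def J_def l_def clip_def)
    finally have e: "(\<Sum>j\<in>I. l j * f j s) = l i" .
    have "\<bar>s - l i\<bar> \<le> 2 * d"
      using i' s N d unfolding l_def clip_def by linarith
    then show "\<bar>s - (\<Sum>j\<in>I. l j * f j s)\<bar> \<le> 2 * d" by (simp add: e)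
  qed (use d in simp)
  then have "norm (k - (\<Sum>i\<in>I. l i *\<^sub>R q i)) < e"
    using k'(3) norm_triangle_ineq[of "k - k'" "k' - (\<Sum>i\<in>I. l i *\<^sub>R q i)"] d by (simp add: d_def)
  moreover have "p * q i = q i" if "i \<in> I" for i
  proof -
    have "p * q i = st (q i * p)" using pq[of i] p that by (simp add: st_mult proj_def I_def)
    then show ?thesis using qp[OF that] pq[of i] that by (simp add: proj_def I_def)
  qed
  moreover have "\<bar>l i\<bar> \<le> norm k" for i
    using N unfolding l_def clip_def N_def by linarith
  moreover have "finite I" by (simp add: I_def J_def)
  ultimately show thesis
    using that[of I q l] pq qp qq by (auto simp: I_def)
qed

end

lemma subspace_closure:
  fixes S :: "'a::real_normed_vector set"
  assumes "subspace S"
  shows "subspace (closure S)"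
proof (rule subspaceI)
  show "0 \<in> closure S" using assms closure_subset subspace_0 by blast
  fix x y c assume x: "x \<in> closure S"
  then obtain f where f: "\<And>n. f n \<in> S" "f \<longlonglongrightarrow> x" unfolding closure_sequential by blast
  show "c *\<^sub>R x \<in> closure S"
    unfolding closure_sequential using f assms
    by (intro exI[of _ "\<lambda>n. c *\<^sub>R f n"]) (auto intro!: tendsto_intros subspace_scale)
  assume "y \<in> closure S"
  then obtain g where g: "\<And>n. g n \<in> S" "g \<longlonglongrightarrow> y" unfolding closure_sequential by blast
  show "x + y \<in> closure S"
    unfolding closure_sequential using f g assms
    by (intro exI[of _ "\<lambda>n. f n + g n"]) (auto intro!: tendsto_intros subspace_add)
qed

lemma closure_of_approximations:
  fixes S :: "'a::real_normed_vector set"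
  assumes "\<And>e. e > 0 \<Longrightarrow> \<exists>y\<in>closure S. norm (x - y) < e"
  shows "x \<in> closure S"
proof -
  have "x \<in> closure (closure S)"
    unfolding closure_approachable using assms by (auto simp: dist_norm norm_minus_commute)
  then show ?thesis by simp
qed

text \<open>A linear functional dominated by this distance vanishes on \<open>M\<close> and has norm
  at most 1.\<close>

lemma sublinear_infdist:
  fixes M :: "'a::real_normed_vector set"
  assumes "subspace M"
  shows "sublinear (\<lambda>x. infdist x M)"
  unfolding sublinear_def
proof (intro conjI allI impI)
  have ne: "M \<noteq> {}" using assms subspace_0 by blast
  fix x y
  show "infdist (x + y) M \<le> infdist x M + infdist y M"
    unfolding infdist_notempty[OF ne, of x] infdist_notempty[OF ne, of y]
  proof (rule le_INF_add[OF ne ne])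
    fix s t assume "s \<in> M" "t \<in> M"
    then have "infdist (x + y) M \<le> dist (x + y) (s + t)"
      using assms by (intro infdist_le subspace_add)
    then show "infdist (x + y) M \<le> dist x s + dist y t"
      using dist_triangle_add order_trans by blast
  qed
next
  have ne: "M \<noteq> {}" using assms subspace_0 by blast
  fix c :: real and x assume c: "c > 0"
  have "inverse c * infdist (c *\<^sub>R x) M \<le> dist x s" if "s \<in> M" for s
  proof -
    have "infdist (c *\<^sub>R x) M \<le> dist (c *\<^sub>R x) (c *\<^sub>R s)"
      using assms that by (intro infdist_le subspace_scale)
    moreover have "dist (c *\<^sub>R x) (c *\<^sub>R s) = c * dist x s"
      using c by (simp add: dist_norm flip: scaleR_diff_right)
    ultimately show ?thesis using c by (simp add: field_simps)
  qed
  then have "inverse c * infdist (c *\<^sub>R x) M \<le> infdist x M"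
    unfolding infdist_notempty[OF ne, of x] using ne by (intro cINF_greatest) auto
  then show "infdist (c *\<^sub>R x) M \<le> c * infdist x M" using c by (simp add: field_simps)
qed

section \<open>Functionals that vanish on commutators\<close>

context cstar
begin

definition commutators :: "'a set" where
  "commutators = {x * y - y * x | x y. True}"

lemma commutators_emb: "z \<in> span commutators \<Longrightarrow> emb c * z \<in> span commutators"
proof (induction z rule: span_induct_alt)
  case base
  then show ?case by (simp add: span_zero)
next
  case (step r z w)
  then obtain x y where z: "z = x * y - y * x" by (auto simp: commutators_def)
  have "emb c * z = (emb c * x) * y - y * (emb c * x)"
    by (simp add: z right_diff_distrib mult.assoc emb_left_commute)
  then have "emb c * z \<in> commutators" unfolding commutators_def by blast
  then show ?case
    using step by (simp add: distrib_left span_add span_scale span_base)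
qed

lemma closure_commutators_emb:
  assumes "z \<in> closure (span commutators)"
  shows "emb c * z \<in> closure (span commutators)"
proof -
  obtain f where f: "\<And>n. f n \<in> span commutators" "f \<longlonglongrightarrow> z"
    using assms unfolding closure_sequential by blast
  show ?thesis
    unfolding closure_sequential using f
    by (intro exI[of _ "\<lambda>n. emb c * f n"]) (auto intro!: tendsto_intros commutators_emb)
qed

end

text \<open>\<open>g\<close> is tracial but not positive. \<open>K\<close> plays the role of the
  supremum of \<open>g\<close> over the projections; a projection \<open>p\<close> with
  \<open>g p \<ge> K - e\<close> then approximates the support of the positive part of
  \<open>g\<close>.\<close>

locale trace_functional = real_rank_zero_cstar +
  fixes g :: "'a \<Rightarrow> real" and K :: real
  assumes linear_g: "linear g" and g_norm: "\<bar>g x\<bar> \<le> norm x"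
    and g_commute: "g (x * y) = g (y * x)" and g_st: "g (st x) = g x"
    and g_proj_le: "proj p \<Longrightarrow> g p \<le> K"
begin

lemmas g_add = linear_add[OF linear_g] and g_diff = linear_diff[OF linear_g]
  and g_scaleR = linear_cmul[OF linear_g] and g_sum = linear_sum[OF linear_g]

lemma g_split: "g p + (\<Sum>i\<in>I. l i * g (q i)) + g (k - (\<Sum>i\<in>I. l i *\<^sub>R q i)) = g (p + k)"
proof -
  have "g (p + k) = g (p + (\<Sum>i\<in>I. l i *\<^sub>R q i) + (k - (\<Sum>i\<in>I. l i *\<^sub>R q i)))" by simp
  also have "\<dots> = g p + g (\<Sum>i\<in>I. l i *\<^sub>R q i) + g (k - (\<Sum>i\<in>I. l i *\<^sub>R q i))"
    by (simp only: g_add)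
  also have "g (\<Sum>i\<in>I. l i *\<^sub>R q i) = (\<Sum>i\<in>I. l i * g (q i))" by (simp add: g_sum g_scaleR)
  finally show ?thesis by simp
qed

text \<open>An approximate Hahn decomposition of \<open>g\<close>.\<close>

lemma corner_bounds:
  assumes p: "proj p" and gp: "g p \<ge> K - e" and k: "st k = k" "norm k \<le> 1"
  shows "p * k * p = k \<Longrightarrow> g (p + k) \<ge> - 2 * e"
    and "(1 - p) * k * (1 - p) = k \<Longrightarrow> g (1 - p + k) \<le> 2 * e"
proof -
  \<comment> \<open>The coefficients are at most 1 in modulus, so the worst case is a sign choice:
    group the projections by the sign of \<open>g\<close>.\<close>
  have main: "g s + (\<Sum>i\<in>I. l i * g (q i)) \<ge> g s - g (sum q {i\<in>I. g (q i) \<ge> 0}) + g (sum q {i\<in>I. g (q i) < 0})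
      \<and> g s + (\<Sum>i\<in>I. l i * g (q i)) \<le> g s + g (sum q {i\<in>I. g (q i) \<ge> 0}) - g (sum q {i\<in>I. g (q i) < 0})"
    if I: "finite I" and l: "\<forall>i\<in>I. \<bar>l i\<bar> \<le> 1" for s and I :: "int set" and l q
  proof -
    let ?A = "{i\<in>I. g (q i) \<ge> 0}" and ?B = "{i\<in>I. g (q i) < 0}"
    have "(\<Sum>i\<in>?A \<union> ?B. \<bar>g (q i)\<bar>) = (\<Sum>i\<in>?A. \<bar>g (q i)\<bar>) + (\<Sum>i\<in>?B. \<bar>g (q i)\<bar>)"
      by (rule sum.union_disjoint) (use I in auto)
    moreover have "?A \<union> ?B = I" by auto
    ultimately have "(\<Sum>i\<in>I. \<bar>g (q i)\<bar>) = (\<Sum>i\<in>?A. \<bar>g (q i)\<bar>) + (\<Sum>i\<in>?B. \<bar>g (q i)\<bar>)" by simp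
    also have "\<dots> = g (sum q {i\<in>I. g (q i) \<ge> 0}) - g (sum q {i\<in>I. g (q i) < 0})"
    proof -
      have "(\<Sum>i\<in>?A. \<bar>g (q i)\<bar>) = (\<Sum>i\<in>?A. g (q i))" by (intro sum.cong) auto
      moreover have "(\<Sum>i\<in>?B. \<bar>g (q i)\<bar>) = (\<Sum>i\<in>?B. - g (q i))" by (intro sum.cong) auto
      ultimately show ?thesis unfolding g_sum sum_negf by linarith
    qed
    finally have e: "(\<Sum>i\<in>I. \<bar>g (q i)\<bar>) = g (sum q {i\<in>I. g (q i) \<ge> 0}) - g (sum q {i\<in>I. g (q i) < 0})" .
    have "\<bar>\<Sum>i\<in>I. l i * g (q i)\<bar> \<le> (\<Sum>i\<in>I. \<bar>g (q i)\<bar>)"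
    proof (rule order_trans[OF sum_abs sum_mono])
      show "\<bar>l i * g (q i)\<bar> \<le> \<bar>g (q i)\<bar>" if "i \<in> I" for i
        using mult_right_mono[OF bspec[OF l that], of "\<bar>g (q i)\<bar>"] by (simp add: abs_mult)
    qed
    then show ?thesis using e by (simp add: abs_le_iff)
  qed
  show "g (p + k) \<ge> - 2 * e" if kp: "p * k * p = k"
  proof (rule field_le_epsilon)
    fix d :: real assume d: "d > 0"
    obtain I :: "int set" and q l where I: "finite I" "\<And>i. i \<in> I \<Longrightarrow> proj (q i)"
      "\<And>i. i \<in> I \<Longrightarrow> p * q i = q i" "\<And>i. i \<in> I \<Longrightarrow> q i * p = q i"
      "\<And>i j. i \<in> I \<Longrightarrow> j \<in> I \<Longrightarrow> i \<noteq> j \<Longrightarrow> q i * q j = 0"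
      "\<And>i. i \<in> I \<Longrightarrow> \<bar>l i\<bar> \<le> norm k" "norm (k - (\<Sum>i\<in>I. l i *\<^sub>R q i)) < d"
      by (rule corner_decomposition[OF p k(1) kp d], rule that; assumption)
    have l: "\<forall>i\<in>I. \<bar>l i\<bar> \<le> 1" using I(6) k(2) order_trans by blast
    have ps: "proj (sum q J)" if "J \<subseteq> I" for J
      using that I(1,2,5) finite_subset by (intro proj_sum) (auto simp: subset_iff)
    let ?J = "{i\<in>I. g (q i) < 0}"
    have "p * sum q ?J = sum q ?J" by (simp add: sum_distrib_left I(3))
    \<comment> \<open>Removing from \<open>p\<close> the part on which \<open>g\<close> is negative
      cannot beat \<open>K\<close>, so by near maximality that part has \<open>g\<close> at least
      \<open>- e\<close>.\<close>
    then have "proj (p - sum q ?J)" by (intro proj_diff p ps) auto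
    then have "g p - g (sum q ?J) \<le> K" using g_proj_le g_diff by metis
    moreover have "g (sum q {i\<in>I. g (q i) \<ge> 0}) \<le> K" by (intro g_proj_le ps) auto
    moreover have "g (k - (\<Sum>i\<in>I. l i *\<^sub>R q i)) \<ge> - d"
      using g_norm[of "k - (\<Sum>i\<in>I. l i *\<^sub>R q i)"] I(7) by linarith
    ultimately show "- 2 * e \<le> g (p + k) + d"
      using main[OF I(1) l, where s = p and q = q] g_split[where p = p and l = l and q = q and I = I and k = k] gp by linarith
  qed
  show "g (1 - p + k) \<le> 2 * e" if kp: "(1 - p) * k * (1 - p) = k"
  proof (rule field_le_epsilon)
    fix d :: real assume d: "d > 0"
    let ?q = "1 - p"
    have P: "p * p = p" using p by (simp add: proj_def)
    obtain I :: "int set" and q l where I: "finite I" "\<And>i. i \<in> I \<Longrightarrow> proj (q i)"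
      "\<And>i. i \<in> I \<Longrightarrow> ?q * q i = q i" "\<And>i. i \<in> I \<Longrightarrow> q i * ?q = q i"
      "\<And>i j. i \<in> I \<Longrightarrow> j \<in> I \<Longrightarrow> i \<noteq> j \<Longrightarrow> q i * q j = 0"
      "\<And>i. i \<in> I \<Longrightarrow> \<bar>l i\<bar> \<le> norm k" "norm (k - (\<Sum>i\<in>I. l i *\<^sub>R q i)) < d"
      by (rule corner_decomposition[OF proj_compl[OF p] k(1) kp d], rule that; assumption)
    have l: "\<forall>i\<in>I. \<bar>l i\<bar> \<le> 1" using I(6) k(2) order_trans by blast
    have ps: "proj (sum q J)" if "J \<subseteq> I" for J
      using that I(1,2,5) finite_subset by (intro proj_sum) (auto simp: subset_iff)
    let ?J = "{i\<in>I. g (q i) < 0}" and ?L = "{i\<in>I. g (q i) \<ge> 0}"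
    have pq: "p * q i = 0" if "i \<in> I" for i
      using I(3)[OF that] by (simp add: left_diff_distrib)
    have "proj (1 - sum q ?J)" by (intro proj_diff ps) auto
    then have "g 1 - g (sum q ?J) \<le> K" using g_proj_le g_diff by metis
    moreover have "g ?q = g 1 - g p" by (rule g_diff)
    moreover have "p * sum q ?L = 0" by (simp add: sum_distrib_left pq)
    then have "proj (p + sum q ?L)" by (intro proj_add p ps) auto
    then have "g p + g (sum q ?L) \<le> K" using g_proj_le g_add by metis
    moreover have "g (k - (\<Sum>i\<in>I. l i *\<^sub>R q i)) \<le> d"
      using g_norm[of "k - (\<Sum>i\<in>I. l i *\<^sub>R q i)"] I(7) by linarith
    ultimately show "g (1 - p + k) \<le> 2 * e + d"
      using main[OF I(1) l, where s = ?q and q = q] g_split[where p = ?q and l = l and q = q and I = I and k = k] gp by linarith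
  qed
qed

text \<open>x x* lies in the corner of \<open>p\<close>, where \<open>g\<close> is nearly positive,
  and x* x in the complementary one, where \<open>g\<close> is nearly negative. Being tracial,
  \<open>g\<close> takes the same value at both.\<close>

lemma off_diagonal_square:
  assumes p: "proj p" and gp: "g p \<ge> K - e" and x: "p * x = x" "x * p = 0" "norm x \<le> 1/2"
  shows "\<bar>g (x * st x)\<bar> \<le> e"
proof -
  have P: "st p = p" "p * p = p" using p by (simp_all add: proj_def)
  have sx: "st x * p = st x" "p * st x = 0"
    using arg_cong[OF x(1), of st] arg_cong[OF x(2), of st] by (simp_all add: st_mult P)
  have xx: "x * x = 0" "st x * st x = 0"
  proof -
    have "x * x = (x * p) * x" using x(1) by (simp add: mult.assoc)
    then show "x * x = 0" using x(2) by simp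
    have "st x * st x = st x * (p * st x)" using sx(1) by (simp flip: mult.assoc)
    then show "st x * st x = 0" using sx(2) by simp
  qed
  define z where "z = x + st x"
  have z: "st z = z" by (simp add: z_def st_add add.commute)
  have nz: "norm z \<le> 1" using norm_triangle_ineq[of x "st x"] x(3) by (simp add: z_def)
  have zz: "z * z = x * st x + st x * x" by (simp add: z_def distrib_left distrib_right xx)
  \<comment> \<open>The Chebyshev polynomial 2 t^2 - 1 maps [-1, 1] to itself, so \<open>w\<close>
    is a contraction, and adding \<open>p\<close> to its compression gives twice x x*, the form
    \<open>corner_bounds\<close> expects.\<close>
  define w where "w = 2 *\<^sub>R (z * z) - 1"
  have w: "w = rpev [:-1, 0, 2:] z" by (simp add: w_def)
  have nw: "norm w \<le> 1" unfolding w
  proof (rule norm_rpev_le[OF z])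
    fix t assume "t \<in> rspec z"
    then have "\<bar>t\<bar> \<le> 1" using rspec_norm nz by fastforce
    then have "t * t \<le> 1" by (simp add: abs_square_le_1 flip: power2_eq_square)
    then show "\<bar>poly [:-1, 0, 2:] t\<bar> \<le> 1" using zero_le_square[of t] by (simp add: abs_le_iff algebra_simps)
  qed simp
  have sw: "st w = w" unfolding w by (rule st_rpev[OF z])
  have Q: "proj (1 - p)" by (rule proj_compl[OF p])
  let ?q = "1 - p"
  have "p * w * p = 2 *\<^sub>R (x * st x) - p"
    by (simp add: w_def zz right_diff_distrib left_diff_distrib distrib_left distrib_right P mult.assoc x sx)
       (simp add: x flip: mult.assoc)
  moreover have "g (p + p * w * p) \<ge> - 2 * e"
  proof (rule corner_bounds(1)[OF p gp])
    show "st (p * w * p) = p * w * p" by (simp add: st_mult P sw mult.assoc)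
    show "norm (p * w * p) \<le> 1"
      using norm_mult_proj_le[OF p, of "p * w"] norm_proj_mult_le[OF p, of w] nw by simp
    show "p * (p * w * p) * p = p * w * p" by (simp add: mult.assoc P) (simp add: P flip: mult.assoc)
  qed
  ultimately have 1: "g (x * st x) \<ge> - e" by (simp add: g_add g_diff g_scaleR)
  have qq: "?q * ?q = ?q" "st ?q = ?q" using Q by (simp_all add: proj_def)
  have "?q * w * ?q = 2 *\<^sub>R (st x * x) - ?q"
  proof -
    have qx: "?q * x = 0" "x * ?q = x" "?q * st x = st x" "st x * ?q = 0"
      by (simp_all add: left_diff_distrib right_diff_distrib x sx)
    have "?q * (z * z) * ?q = (?q * x) * st x * ?q + (?q * st x) * (x * ?q)"
      by (simp only: zz distrib_left distrib_right mult.assoc)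
    then have "?q * (z * z) * ?q = st x * x" by (simp add: qx)
    moreover have "?q * w * ?q = 2 *\<^sub>R (?q * (z * z) * ?q) - ?q * ?q"
      unfolding w_def by (simp only: right_diff_distrib[of ?q "2 *\<^sub>R (z * z)"] left_diff_distrib[of _ _ ?q]
        mult_scaleR_left mult_scaleR_right mult_1_right)
    ultimately show ?thesis by (simp only: qq)
  qed
  moreover have "g (?q + ?q * w * ?q) \<le> 2 * e"
  proof (rule corner_bounds(2)[OF p gp])
    show "st (?q * w * ?q) = ?q * w * ?q" by (simp only: st_mult qq sw mult.assoc)
    show "norm (?q * w * ?q) \<le> 1"
      using norm_mult_proj_le[OF Q, of "?q * w"] norm_proj_mult_le[OF Q, of w] nw by linarith
    show "?q * (?q * w * ?q) * ?q = ?q * w * ?q"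
      by (metis mult.assoc qq(1))
  qed
  ultimately have 2: "g (st x * x) \<le> e" by (simp add: g_add g_diff g_scaleR)
  show ?thesis using 1 2 g_commute[of x "st x"] by (simp add: abs_le_iff)
qed

text \<open>Polarization; \<open>g\<close> is hermitian, so the two cross terms agree. Norms at most
  1/4 let \<open>x + y\<close> satisfy the bound for squares.\<close>

lemma off_diagonal_product:
  assumes p: "proj p" and gp: "g p \<ge> K - e"
    and x: "p * x = x" "x * p = 0" "norm x \<le> 1/4" and y: "p * y = y" "y * p = 0" "norm y \<le> 1/4"
  shows "\<bar>g (x * st y)\<bar> \<le> 2 * e"
proof -
  have 1: "\<bar>g (x * st x)\<bar> \<le> e" using x by (intro off_diagonal_square[OF p gp]) auto
  have 2: "\<bar>g (y * st y)\<bar> \<le> e" using y by (intro off_diagonal_square[OF p gp]) auto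
  have 3: "\<bar>g ((x + y) * st (x + y))\<bar> \<le> e"
    using x y norm_triangle_ineq[of x y]
    by (intro off_diagonal_square[OF p gp]) (auto simp: distrib_left distrib_right)
  have "g (y * st x) = g (x * st y)" using g_st[of "x * st y"] by (simp add: st_mult)
  then have "g ((x + y) * st (x + y)) = g (x * st x) + g (y * st y) + 2 * g (x * st y)"
    by (simp add: st_add distrib_left distrib_right g_add)
  then show ?thesis using 1 2 3 by (simp add: abs_le_iff)
qed

text \<open>Insert \<open>p + q = 1\<close> between the factors. The terms through \<open>p\<close>
  cancel because \<open>g\<close> is tracial, and those through \<open>q\<close> are products of
  off-diagonal elements. Dividing by \<open>r\<close> brings the norms down to 1/4.\<close>

lemma approximate_trace:
  assumes p: "proj p" and gp: "g p \<ge> K - e"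
  shows "\<bar>g (p * (x * y - y * x))\<bar> \<le> 4 * e * (4 * (norm x + norm y + 1))\<^sup>2"
proof -
  have P: "st p = p" "p * p = p" using p by (simp_all add: proj_def)
  define q where "q = 1 - p"
  have Q: "proj q" unfolding q_def by (rule proj_compl[OF p])
  have qq: "st q = q" "q * q = q" using Q by (simp_all add: proj_def)
  have pq: "p * q = 0" "q * p = 0" by (simp_all add: q_def right_diff_distrib left_diff_distrib P)
  define r where "r = 4 * (norm x + norm y + 1)"
  have r: "r > 0" by (simp add: r_def add_nonneg_pos)
  have bd: "\<bar>g (p * u * q * v)\<bar> \<le> 2 * e * r\<^sup>2" if uv: "norm u \<le> r / 4" "norm v \<le> r / 4" for u v
  proof -
    let ?a = "(1 / r) *\<^sub>R (p * u * q)" and ?b = "(1 / r) *\<^sub>R (p * st v * q)"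
    have n: "norm (p * w * q) \<le> norm w" for w
      using norm_mult_proj_le[OF Q, of "p * w"] norm_proj_mult_le[OF p, of w] by simp
    have "\<bar>g (?a * st ?b)\<bar> \<le> 2 * e"
    proof (rule off_diagonal_product[OF p gp])
      show "p * ?a = ?a" "p * ?b = ?b" using P by (simp_all flip: mult.assoc)
      show "?a * p = 0" "?b * p = 0" using pq by (simp_all add: mult.assoc)
      show "norm ?a \<le> 1/4" "norm ?b \<le> 1/4"
        using n[of u] n[of "st v"] uv r by (simp_all add: field_simps)
    qed
    also have "?a * st ?b = (1 / r\<^sup>2) *\<^sub>R (p * u * q * v * p)"
      by (simp add: st_scaleR st_mult P qq power2_eq_square mult.assoc) (simp add: qq flip: mult.assoc)
    also have "g ((1 / r\<^sup>2) *\<^sub>R (p * u * q * v * p)) = g (p * u * q * v) / r\<^sup>2"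
    proof -
      have "g ((p * u * q * v) * p) = g (p * (p * u * q * v))" by (rule g_commute)
      also have "p * (p * u * q * v) = p * u * q * v" using P by (simp flip: mult.assoc)
      finally show ?thesis by (simp add: g_scaleR)
    qed
    finally show ?thesis using r by (simp add: abs_divide field_simps)
  qed
  have 1: "g (p * u * v) = g (p * u * p * v) + g (p * u * q * v)" for u v
  proof -
    have "p * u * v = p * u * p * v + p * u * q * v"
      by (simp add: q_def right_diff_distrib left_diff_distrib)
    then show ?thesis by (simp add: g_add)
  qed
  have "g (p * x * p * y) = g (p * y * p * x)"
    using g_commute[of "p * x" "p * y"] by (simp add: mult.assoc)
  then have "g (p * (x * y - y * x)) = g (p * x * q * y) - g (p * y * q * x)"
    using 1[of x y] 1[of y x] by (simp add: right_diff_distrib g_diff mult.assoc)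
  moreover have "\<bar>g (p * x * q * y)\<bar> \<le> 2 * e * r\<^sup>2" "\<bar>g (p * y * q * x)\<bar> \<le> 2 * e * r\<^sup>2"
  proof -
    have "norm x \<le> r / 4" "norm y \<le> r / 4" by (simp_all add: r_def)
    then show "\<bar>g (p * x * q * y)\<bar> \<le> 2 * e * r\<^sup>2" "\<bar>g (p * y * q * x)\<bar> \<le> 2 * e * r\<^sup>2"
      by (simp_all only: bd)
  qed
  ultimately show ?thesis unfolding r_def[symmetric] by simp
qed

text \<open>The symmetry \<open>2 r - 1\<close> has norm 1, and its compression plus
  \<open>p\<close> is \<open>2 p r p\<close>; \<open>g\<close> does not distinguish
  \<open>p r p\<close> from \<open>p r\<close>.\<close>

lemma approximate_positive:
  assumes p: "proj p" and gp: "g p \<ge> K - e" and r: "proj r"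
  shows "g (p * r) \<ge> - e"
proof -
  have P: "st p = p" "p * p = p" using p by (simp_all add: proj_def)
  have R: "st r = r" "r * r = r" using r by (simp_all add: proj_def)
  let ?w = "2 *\<^sub>R r - 1"
  have sw: "st ?w = ?w" by (simp add: st_diff st_scaleR R)
  have "?w * ?w = 1" by (simp add: left_diff_distrib right_diff_distrib distrib_left distrib_right R scaleR_2)
  then have "norm ?w * norm ?w = 1" using norm_square_hermitian[OF sw] by simp
  then have nw: "norm ?w = 1" using norm_ge_zero[of ?w] by (simp add: square_eq_1_iff)
  have "g (p + p * ?w * p) \<ge> - 2 * e"
  proof (rule corner_bounds(1)[OF p gp])
    show "st (p * ?w * p) = p * ?w * p" by (simp add: st_mult P sw mult.assoc)
    show "norm (p * ?w * p) \<le> 1"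
      using norm_mult_proj_le[OF p, of "p * ?w"] norm_proj_mult_le[OF p, of ?w] nw by simp
    show "p * (p * ?w * p) * p = p * ?w * p" by (metis mult.assoc P(2))
  qed
  moreover have "p + p * ?w * p = 2 *\<^sub>R (p * r * p)"
    by (simp add: left_diff_distrib right_diff_distrib P)
  moreover have "g (p * r * p) = g (p * r)"
    using g_commute[of "p * r" p] P by (simp flip: mult.assoc)
  ultimately show ?thesis by (simp add: g_scaleR)
qed

end

context cstar
begin

lemma square_orthogonal_sum:
  assumes "finite I" "\<And>i. i \<in> I \<Longrightarrow> proj (q i)" "\<And>i j. i \<in> I \<Longrightarrow> j \<in> I \<Longrightarrow> i \<noteq> j \<Longrightarrow> q i * q j = 0"
  shows "(\<Sum>i\<in>I. l i *\<^sub>R q i) * (\<Sum>i\<in>I. l i *\<^sub>R q i) = (\<Sum>i\<in>I. (l i)\<^sup>2 *\<^sub>R q i)"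
proof -
  have "(\<Sum>i\<in>I. l i *\<^sub>R q i) * (\<Sum>i\<in>I. l i *\<^sub>R q i) = (\<Sum>i\<in>I. \<Sum>j\<in>I. (l i *\<^sub>R q i) * (l j *\<^sub>R q j))"
    by (rule sum_product)
  also have "\<dots> = (\<Sum>i\<in>I. \<Sum>j\<in>I. if i = j then (l i)\<^sup>2 *\<^sub>R q i else 0)"
    using assms by (intro sum.cong refl) (auto simp: proj_def power2_eq_square)
  also have "\<dots> = (\<Sum>i\<in>I. (l i)\<^sup>2 *\<^sub>R q i)" using assms(1) by simp
  finally show ?thesis .
qed

end

context real_rank_zero_cstar
begin

lemma hermitian_square_approx:
  assumes h: "st h = h" and e: "e > 0"
  obtains I :: "int set" and l q where "finite I" "\<And>i. i \<in> I \<Longrightarrow> proj (q i)"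
    "\<And>i j. i \<in> I \<Longrightarrow> j \<in> I \<Longrightarrow> i \<noteq> j \<Longrightarrow> q i * q j = 0"
    "norm (h - (\<Sum>i\<in>I. l i *\<^sub>R q i)) < e"
    "norm (h * h - (\<Sum>i\<in>I. (l i)\<^sup>2 *\<^sub>R q i)) < e"
proof -
  define d where "d = min (min 1 e) (e / (2 * norm h + 1))"
  have pos: "2 * norm h + 1 > 0" by (simp add: add_nonneg_pos)
  have d: "d > 0" "d \<le> 1" "d \<le> e" "d \<le> e / (2 * norm h + 1)" using e pos by (simp_all add: d_def)
  obtain I :: "int set" and q l where I: "finite I" "\<And>i. i \<in> I \<Longrightarrow> proj (q i)"
      "\<And>i. i \<in> I \<Longrightarrow> 1 * q i = q i" "\<And>i. i \<in> I \<Longrightarrow> q i * 1 = q i"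
      "\<And>i j. i \<in> I \<Longrightarrow> j \<in> I \<Longrightarrow> i \<noteq> j \<Longrightarrow> q i * q j = 0"
      "\<And>i. i \<in> I \<Longrightarrow> \<bar>l i\<bar> \<le> norm h" "norm (h - (\<Sum>i\<in>I. l i *\<^sub>R q i)) < d"
  proof (rule corner_decomposition[of 1 h d], goal_cases)
    case (5 I q l)
    then show ?case by (intro 5(1)) auto
  qed (use h d in auto)
  define s where "s = (\<Sum>i\<in>I. l i *\<^sub>R q i)"
  have s: "norm (h - s) < d" using I(7) by (simp add: s_def)
  have ns: "norm s \<le> norm h + 1" using s d norm_triangle_sub[of s h] by (simp add: norm_minus_commute)
  have "h * h - s * s = h * (h - s) + (h - s) * s" by (simp add: algebra_simps)
  then have "norm (h * h - s * s) \<le> norm (h * (h - s)) + norm ((h - s) * s)"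
    by (metis norm_triangle_ineq)
  also have "\<dots> \<le> norm h * norm (h - s) + norm (h - s) * norm s"
    by (intro add_mono norm_mult_ineq)
  also have "\<dots> \<le> norm h * norm (h - s) + norm (h - s) * (norm h + 1)"
    using ns by (intro add_left_mono mult_left_mono) auto
  also have "\<dots> = norm (h - s) * (2 * norm h + 1)" by (simp add: algebra_simps)
  also have "\<dots> < d * (2 * norm h + 1)" using s pos by (intro mult_strict_right_mono)
  also have "\<dots> \<le> e" using d(4) pos by (simp add: field_simps)
  also have "s * s = (\<Sum>i\<in>I. (l i)\<^sup>2 *\<^sub>R q i)"
    unfolding s_def using I by (intro square_orthogonal_sum) auto
  finally show thesis
    using that[of I q l] I d by simp
qed

end

context trace_functional
begin

text \<open>The functional \<open>f\<close> below is a generalized limit of \<open>x \<mapsto> g (p\<^sub>n x)\<close>; \<open>Inf (A x)\<close> is the upper limit.\<close>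

theorem tracial_state_exists:
  assumes K: "K > 0" and ex: "\<And>e. e > 0 \<Longrightarrow> \<exists>p. proj p \<and> g p \<ge> K - e"
  shows "\<exists>\<tau>. tracial_state cs st \<tau>"
proof -
  define e where "e n = inverse (real (Suc n))" for n
  have e0: "e \<longlonglongrightarrow> 0" unfolding e_def by (rule LIMSEQ_inverse_real_of_nat)
  have ev_e: "\<forall>\<^sub>F n in sequentially. e n < d" if "d > 0" for d
    using order_tendstoD(2)[OF e0 that] .
  have "\<exists>p. proj p \<and> g p \<ge> K - e n" for n by (rule ex) (simp add: e_def)
  then obtain p where p: "\<And>n. proj (p n)" "\<And>n. g (p n) \<ge> K - e n" by metis
  define A where "A x = {c. \<forall>\<^sub>F n in sequentially. g (p n * x) \<le> c}" for x
  have gp: "\<bar>g (p n * x)\<bar> \<le> norm x" for n x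
    using g_norm[of "p n * x"] norm_proj_mult_le[OF p(1)[of n], of x] by linarith
  have ne: "norm x \<in> A x" for x by (simp add: A_def abs_le_D1[OF gp])
  have lower: "- norm x \<le> c" if c: "c \<in> A x" for c x
  proof -
    obtain n where "g (p n * x) \<le> c" using c unfolding A_def eventually_sequentially by auto
    then show ?thesis using gp[of n x] by (simp add: abs_le_iff)
  qed
  have bdd: "bdd_below (A x)" for x unfolding bdd_below_def using lower by blast
  define P where "P x = Inf (A x)" for x
  have P_le: "P x \<le> c" if "c \<in> A x" for c x
    unfolding P_def using that bdd by (rule cInf_lower)
  have "sublinear P" unfolding sublinear_def
  proof (intro conjI allI impI)
    fix x y
    have "P (x + y) \<le> (INF s\<in>A x. s) + (INF t\<in>A y. t)"
    proof (rule le_INF_add)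
      fix s t assume st: "s \<in> A x" "t \<in> A y"
      have "\<forall>\<^sub>F n in sequentially. g (p n * (x + y)) \<le> s + t"
        using st unfolding A_def mem_Collect_eq
        by eventually_elim (simp add: distrib_left g_add)
      then show "P (x + y) \<le> s + t" by (intro P_le) (simp add: A_def)
    qed (use ne in auto)
    then show "P (x + y) \<le> P x + P y" by (simp add: P_def)
  next
    fix c :: real and x assume c: "c > 0"
    have "inverse c * P (c *\<^sub>R x) \<le> s" if s: "s \<in> A x" for s
    proof -
      have "\<forall>\<^sub>F n in sequentially. g (p n * (c *\<^sub>R x)) \<le> c * s"
        using s unfolding A_def mem_Collect_eq
        by eventually_elim (use c in \<open>simp add: g_scaleR\<close>)
      then have "P (c *\<^sub>R x) \<le> c * s" by (intro P_le) (simp add: A_def)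
      then show ?thesis using c by (simp add: field_simps)
    qed
    then have "inverse c * P (c *\<^sub>R x) \<le> P x"
      unfolding P_def[of x] using ne by (intro cInf_greatest) auto
    then show "P (c *\<^sub>R x) \<le> c * P x" using c by (simp add: field_simps)
  qed
  then obtain f where f: "linear f" "\<And>x. f x \<le> P x" using hahn_banach_sublinear by blast
  note fl = linear_add[OF f(1)] linear_diff[OF f(1)] linear_cmul[OF f(1)] linear_neg[OF f(1)]
  have f_le: "f x \<le> c" if "\<forall>\<^sub>F n in sequentially. g (p n * x) \<le> c" for x c
    using P_le[of c x] f(2)[of x] that by (simp add: A_def)
  have f_zero: "f x = 0" if lim: "(\<lambda>n. g (p n * x)) \<longlonglongrightarrow> 0" for x
  proof -
    have le: "f y \<le> 0" if lim: "(\<lambda>n. g (p n * y)) \<longlonglongrightarrow> 0" for y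
    proof (rule field_le_epsilon)
      fix d :: real assume "d > 0"
      then have "\<forall>\<^sub>F n in sequentially. g (p n * y) < d" by (rule order_tendstoD(2)[OF lim])
      then show "f y \<le> 0 + d" by (intro f_le) (auto elim: eventually_mono)
    qed
    have "(\<lambda>n. g (p n * (- x))) \<longlonglongrightarrow> - 0"
      using tendsto_minus[OF lim] by (simp add: linear_neg[OF linear_g])
    then have "f (- x) \<le> 0" by (intro le) simp
    then show ?thesis using le[OF lim] by (simp add: fl)
  qed
  have f_norm: "\<bar>f x\<bar> \<le> norm x" for x
    using f_le[of x "norm x"] f_le[of "- x" "norm x"] ne[of x] ne[of "- x"]
    by (simp add: A_def fl abs_le_iff)
  have f_commute: "f (x * y) = f (y * x)" for x y
  proof -
    define R where "R = (4 * (norm x + norm y + 1))\<^sup>2"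
    have "f (x * y - y * x) = 0"
    proof (rule f_zero, rule Lim_null_comparison)
      show "\<forall>\<^sub>F n in sequentially. norm (g (p n * (x * y - y * x))) \<le> 4 * e n * R"
        using approximate_trace[OF p] by (simp add: R_def)
      show "(\<lambda>n. 4 * e n * R) \<longlonglongrightarrow> 0"
        using tendsto_mult_left_zero[OF tendsto_mult_right_zero[OF e0]] by blast
    qed
    then show ?thesis by (simp add: fl)
  qed
  have f_st: "f (st x) = f x" for x
  proof -
    have "g (p n * (x - st x)) = 0" for n
    proof -
      have "g (p n * x) = g (st (p n * x))" by (simp only: g_st)
      also have "\<dots> = g (st x * p n)" using p(1)[of n] by (simp add: st_mult proj_def)
      also have "\<dots> = g (p n * st x)" by (rule g_commute)
      finally show ?thesis by (simp add: right_diff_distrib g_diff)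
    qed
    then have "f (x - st x) = 0" by (intro f_zero) simp
    then show ?thesis by (simp add: fl)
  qed
  have f_proj: "f r \<ge> 0" if r: "proj r" for r
  proof -
    have "f (- r) \<le> 0"
    proof (rule field_le_epsilon)
      fix d :: real assume "d > 0"
      have "\<forall>\<^sub>F n in sequentially. g (p n * (- r)) \<le> d"
        using ev_e[OF \<open>d > 0\<close>]
      proof eventually_elim
        case (elim n)
        then show ?case using approximate_positive[OF p r, of n] by (simp add: linear_neg[OF linear_g])
      qed
      then show "f (- r) \<le> 0 + d" by (intro f_le) simp
    qed
    then show ?thesis by (simp add: fl)
  qed
  have f1: "f 1 > 0"
  proof -
    have "\<forall>\<^sub>F n in sequentially. e n < K / 2" by (rule ev_e) (use K in simp)
    then have "\<forall>\<^sub>F n in sequentially. g (p n * (- 1)) \<le> - (K / 2)"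
    proof eventually_elim
      case (elim n)
      then show ?case using p(2)[of n] by (simp add: linear_neg[OF linear_g])
    qed
    then have "f (- 1) \<le> - (K / 2)" by (rule f_le)
    then show ?thesis using K by (simp add: fl)
  qed
  have f_square: "f (h * h) \<ge> 0" if h: "st h = h" for h
  proof (rule field_le_epsilon)
    fix d :: real assume "d > 0"
    obtain I :: "int set" and q l where I: "finite I" "\<And>i. i \<in> I \<Longrightarrow> proj (q i)"
      "\<And>i j. i \<in> I \<Longrightarrow> j \<in> I \<Longrightarrow> i \<noteq> j \<Longrightarrow> q i * q j = 0"
      "norm (h - (\<Sum>i\<in>I. l i *\<^sub>R q i)) < d"
      "norm (h * h - (\<Sum>i\<in>I. (l i)\<^sup>2 *\<^sub>R q i)) < d"
      by (rule hermitian_square_approx[OF h \<open>d > 0\<close>], rule that; assumption)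
    have "f (\<Sum>i\<in>I. (l i)\<^sup>2 *\<^sub>R q i) = (\<Sum>i\<in>I. (l i)\<^sup>2 * f (q i))"
      by (simp add: linear_sum[OF f(1)] fl)
    also have "\<dots> \<ge> 0" using I(2) f_proj by (intro sum_nonneg mult_nonneg_nonneg) auto
    finally show "0 \<le> f (h * h) + d"
      using f_norm[of "h * h - (\<Sum>i\<in>I. (l i)\<^sup>2 *\<^sub>R q i)"] I(5) by (simp add: fl abs_le_iff)
  qed
  have f_i: "f (emb \<i> * h) = 0" if "st h = h" for h
  proof -
    have "st (emb \<i> * h) = - (emb \<i> * h)"
      using that by (simp add: st_mult st_emb emb_minus emb_commute)
    then show ?thesis using f_st[of "emb \<i> * h"] by (simp add: fl)
  qed
  \<comment> \<open>The complexification \<open>f x - i f (i x)\<close> of a real functional,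
    normalized by \<open>f 1\<close>. It is real on self-adjoint elements by
    \<open>f_i\<close>.\<close>
  define \<tau> where "\<tau> x = Complex (f x / f 1) (- f (emb \<i> * x) / f 1)" for x
  have "tracial_state cs st \<tau>"
    unfolding tracial_state_def complex_linear_def
  proof (intro conjI allI)
    show "\<tau> (x + y) = \<tau> x + \<tau> y" for x y
      by (simp add: \<tau>_def complex_eq_iff distrib_left fl add_divide_distrib diff_divide_distrib)
    show "\<tau> (cs c x) = c * \<tau> x" for c x
    proof -
      have emb_c: "emb c * y = Re c *\<^sub>R y + Im c *\<^sub>R (emb \<i> * y)" for y
      proof -
        have "emb c = emb (of_real (Re c) + of_real (Im c) * \<i>)"
          by (rule arg_cong[of _ _ emb]) (simp add: complex_eq_iff)
        then show ?thesis
          by (simp only: emb_add emb_mult distrib_right emb_of_real_mult mult_scaleR_left mult.assoc)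
      qed
      have "emb \<i> * (emb \<i> * y) = - y" for y
        by (simp add: emb_minus flip: mult.assoc emb_mult)
      then have "emb \<i> * (emb c * x) = Re c *\<^sub>R (emb \<i> * x) - Im c *\<^sub>R x"
        unfolding emb_c[of x] by (simp add: distrib_left)
      then have i: "f (emb \<i> * (emb c * x)) = Re c * f (emb \<i> * x) - Im c * f x"
        by (simp add: fl(2,3))
      have r: "f (emb c * x) = Re c * f x + Im c * f (emb \<i> * x)"
        by (simp only: emb_c fl(1,3) real_scaleR_def)
      have "\<tau> (emb c * x) = c * \<tau> x"
        by (rule complex_eqI) (simp_all only: \<tau>_def i r complex.sel times_complex.sel add_divide_distrib
            diff_divide_distrib, simp_all add: algebra_simps diff_divide_distrib)
      then show ?thesis by (simp only: cs_emb[of c x])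
    qed
    show "\<tau> 1 = 1"
      using f1 f_i[of 1] by (simp add: \<tau>_def complex_eq_iff)
    show "\<tau> (x * y) = \<tau> (y * x)" for x y
      using f_commute[of x y] f_commute[of "emb \<i> * x" y]
      by (simp add: \<tau>_def complex_eq_iff mult.assoc emb_left_commute[of y])
    fix x
    have sx: "st (st x * x) = st x * x" by (simp add: st_mult)
    show "Im (\<tau> (st x * x)) = 0" using f_i[OF sx] by (simp add: \<tau>_def)
    obtain h k where hk: "st h = h" "st k = k" "x = h + emb \<i> * k" using hermitian_parts by blast
    have sxe: "st x = h - emb \<i> * k"
      by (simp add: hk st_add st_mult st_emb emb_minus emb_commute)
    have ii: "emb \<i> * (emb \<i> * y) = - y" for y
      by (simp add: emb_minus flip: mult.assoc emb_mult)
    \<comment> \<open>Symmetrizing turns x* x into squares of self-adjoint elements without a square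
      root; the trace property makes both summands count equally.\<close>
    have "st x * x + x * st x
        = (h - emb \<i> * k) * (h + emb \<i> * k) + (h + emb \<i> * k) * (h - emb \<i> * k)"
      by (simp only: sxe hk(3)[symmetric])
    also have "\<dots> = 2 *\<^sub>R (h * h) + 2 *\<^sub>R (k * k)"
      by (simp add: ii left_diff_distrib right_diff_distrib distrib_left distrib_right mult.assoc
          emb_left_commute[of h] emb_left_commute[of k] scaleR_2)
    finally have "f (st x * x) + f (x * st x) = 2 * f (h * h) + 2 * f (k * k)"
      by (metis fl(1) fl(3) real_scaleR_def)
    then have "f (st x * x) \<ge> 0"
      using f_commute[of x "st x"] f_square[OF hk(1)] f_square[OF hk(2)] by linarith
    then show "Re (\<tau> (st x * x)) \<ge> 0" using f1 by (simp add: \<tau>_def)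
  qed
  then show ?thesis by blast
qed

end

context real_rank_zero_cstar
begin

text \<open>By real rank zero a proper closed span already misses a projection. Choosing the
  functional nonzero there makes its hermitian part nonzero too and gives
  \<open>K > 0\<close>.\<close>

theorem commutators_dense:
  assumes no: "\<not> (\<exists>\<tau>. tracial_state cs st \<tau>)"
  shows "closure (span commutators) = UNIV"
proof (rule ccontr)
  let ?M = "span commutators"
  have sM: "subspace ?M" by simp
  have sC: "subspace (closure ?M)" by (rule subspace_closure[OF sM])
  assume ne: "closure ?M \<noteq> UNIV"
  have "\<exists>p0. proj p0 \<and> p0 \<notin> closure ?M"
  proof (rule ccontr)
    assume "\<not> ?thesis"
    then have all: "proj q \<Longrightarrow> q \<in> closure ?M" for q by blast
    have herm: "h \<in> closure ?M" if h: "st h = h" for h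
    proof (rule closure_of_approximations)
      fix e :: real assume "e > 0"
      obtain I :: "int set" and q l where I: "finite I" "\<And>i. i \<in> I \<Longrightarrow> proj (q i)"
        "\<And>i j. i \<in> I \<Longrightarrow> j \<in> I \<Longrightarrow> i \<noteq> j \<Longrightarrow> q i * q j = 0"
        "norm (h - (\<Sum>i\<in>I. l i *\<^sub>R q i)) < e"
        "norm (h * h - (\<Sum>i\<in>I. (l i)\<^sup>2 *\<^sub>R q i)) < e"
        by (rule hermitian_square_approx[OF h \<open>e > 0\<close>], rule that; assumption)
      have "(\<Sum>i\<in>I. l i *\<^sub>R q i) \<in> closure ?M"
        using I(2) all by (intro subspace_sum[OF sC] subspace_scale[OF sC]) auto
      then show "\<exists>y\<in>closure ?M. norm (h - y) < e" using I(4) by blast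
    qed
    have "x \<in> closure ?M" for x
    proof -
      obtain h k where hk: "st h = h" "st k = k" "x = h + emb \<i> * k" using hermitian_parts by blast
      then show ?thesis
        using herm closure_commutators_emb by (auto intro!: subspace_add[OF sC])
    qed
    then show False using ne by auto
  qed
  then obtain p0 where p0: "proj p0" "p0 \<notin> closure ?M" by blast
  have neM: "?M \<noteq> {}" using span_zero by blast
  obtain f where f: "linear f" "\<And>x. f x \<le> infdist x ?M" "f p0 = infdist p0 ?M"
    using hahn_banach_sublinear[OF sublinear_infdist[OF sM]] by metis
  have fp0: "f p0 > 0"
    using p0(2) in_closure_iff_infdist_zero[OF neM] infdist_nonneg[of p0 ?M] f(3) by (metis order_le_less)
  note fl = linear_add[OF f(1)] linear_diff[OF f(1)] linear_cmul[OF f(1)] linear_neg[OF f(1)]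
  have f0: "f m = 0" if "m \<in> ?M" for m
    using f(2)[of m] f(2)[of "- m"] that by (simp add: fl span_neg)
  have f_norm: "\<bar>f x\<bar> \<le> norm x" for x
  proof -
    have "infdist y ?M \<le> norm y" for y
      using infdist_le[OF span_zero, of y commutators] by simp
    from this[of x] this[of "- x"] show ?thesis
      using f(2)[of x] f(2)[of "- x"] by (simp add: fl abs_le_iff)
  qed
  have f_comm: "f (x * y) = f (y * x)" for x y
  proof -
    have "x * y - y * x \<in> ?M" by (rule span_base) (auto simp: commutators_def)
    then show ?thesis using f0 fl(2) by fastforce
  qed
  define g where "g x = (f x + f (st x)) / 2" for x
  have lg: "linear g"
    by (rule linearI) (simp_all add: g_def st_add st_scaleR fl add_divide_distrib algebra_simps)
  have gn: "\<bar>g x\<bar> \<le> norm x" for x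
    using f_norm[of x] f_norm[of "st x"] unfolding g_def by (simp add: abs_le_iff)
  define K where "K = (SUP p\<in>Collect proj. g p)"
  have bdd: "bdd_above (g ` Collect proj)"
    unfolding bdd_above_def
  proof (intro exI[of _ 1] ballI)
    fix y assume "y \<in> g ` Collect proj"
    then obtain p where "proj p" "y = g p" by auto
    then show "y \<le> 1" using gn[of p] norm_proj_le[of p] by (simp add: abs_le_iff)
  qed
  have gK: "g p \<le> K" if "proj p" for p
    unfolding K_def using that bdd by (intro cSUP_upper) auto
  interpret trace_functional cs st g K
  proof
    show "g (x * y) = g (y * x)" for x y
      using f_comm[of x y] f_comm[of "st y" "st x"] by (simp add: g_def st_mult)
    show "g (st x) = g x" for x by (simp add: g_def)
  qed (use gn gK in \<open>auto simp: linear_add[OF lg] linear_cmul[OF lg]\<close>)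
  have "g p0 = f p0" using p0(1) by (simp add: g_def proj_def)
  then have "K > 0" using gK[OF p0(1)] fp0 by simp
  moreover have "\<exists>p. proj p \<and> g p \<ge> K - e" if "e > 0" for e
  proof -
    have "K - e < K" using that by simp
    then obtain p where "proj p" "K - e < g p"
      unfolding K_def less_cSUP_iff[OF _ bdd] using proj_0 by (metis (no_types, lifting) bdd empty_iff less_cSUP_iff mem_Collect_eq)
    then show ?thesis by (intro exI[of _ p]) auto
  qed
  ultimately have "\<exists>\<tau>. tracial_state cs st \<tau>" by (rule tracial_state_exists)
  with no show False by blast
qed

end

section \<open>The primitive ideal space\<close>

context cstar
begin

lemma left_ideal_iff:
  "left_ideal cs L \<longleftrightarrow> 0 \<in> L \<and> (\<forall>x\<in>L. \<forall>y\<in>L. x + y \<in> L) \<and> (\<forall>x\<in>L. \<forall>a. a * x \<in> L)"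
proof
  assume "left_ideal cs L"
  then show "0 \<in> L \<and> (\<forall>x\<in>L. \<forall>y\<in>L. x + y \<in> L) \<and> (\<forall>x\<in>L. \<forall>a. a * x \<in> L)"
    unfolding left_ideal_def by blast
next
  assume L: "0 \<in> L \<and> (\<forall>x\<in>L. \<forall>y\<in>L. x + y \<in> L) \<and> (\<forall>x\<in>L. \<forall>a. a * x \<in> L)"
  have "cs c x \<in> L" if "x \<in> L" for c x
    using L that cs_emb[of c x] by simp
  with L show "left_ideal cs L" unfolding left_ideal_def by blast
qed

lemma left_ideal_0: "left_ideal cs L \<Longrightarrow> 0 \<in> L"
  and left_ideal_add: "left_ideal cs L \<Longrightarrow> x \<in> L \<Longrightarrow> y \<in> L \<Longrightarrow> x + y \<in> L"
  and left_ideal_mult: "left_ideal cs L \<Longrightarrow> x \<in> L \<Longrightarrow> a * x \<in> L"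
  by (simp_all add: left_ideal_iff)

lemma maximal_left_ideal_exists:
  assumes N: "left_ideal cs N" "1 \<notin> N"
  obtains L where "maximal_left_ideal cs L" "N \<subseteq> L"
proof -
  let ?A = "{L. left_ideal cs L \<and> N \<subseteq> L \<and> 1 \<notin> L}"
  have "\<exists>M\<in>?A. \<forall>X\<in>?A. M \<subseteq> X \<longrightarrow> X = M"
  proof (rule subset_Zorn_nonempty)
    show "?A \<noteq> {}" using N by blast
    fix C assume C: "C \<noteq> {}" "subset.chain ?A C"
    then have CA: "C \<subseteq> ?A" and ch: "\<And>X Y. X \<in> C \<Longrightarrow> Y \<in> C \<Longrightarrow> X \<subseteq> Y \<or> Y \<subseteq> X"
      unfolding subset.chain_def by blast+
    have C_ideal: "left_ideal cs X" if "X \<in> C" for X using that CA by blast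
    note CL = left_ideal_0[OF C_ideal] left_ideal_add[OF C_ideal] left_ideal_mult[OF C_ideal]
    have "left_ideal cs (\<Union>C)" unfolding left_ideal_iff
    proof (intro conjI ballI allI)
      show "0 \<in> \<Union>C" using C(1) CL(1) by blast
      show "a * x \<in> \<Union>C" if "x \<in> \<Union>C" for a x using that CL(3) by blast
      fix x y assume "x \<in> \<Union>C" "y \<in> \<Union>C"
      then obtain X Y where XY: "X \<in> C" "x \<in> X" "Y \<in> C" "y \<in> Y" by blast
      then obtain Z where "Z \<in> C" "x \<in> Z" "y \<in> Z" using ch[of X Y] by blast
      then show "x + y \<in> \<Union>C" using CL(2) by blast
    qed
    then show "\<Union>C \<in> ?A" using C(1) CA by blast
  qed
  then obtain M where MA: "M \<in> ?A" and max: "\<forall>X\<in>?A. M \<subseteq> X \<longrightarrow> X = M"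
    by (elim bexE) (rule that)
  have M: "left_ideal cs M" "N \<subseteq> M" "1 \<notin> M" using MA by simp_all
  have "X = M \<or> 1 \<in> X" if X: "left_ideal cs X \<and> M \<subseteq> X" for X
  proof (rule disjCI)
    assume "1 \<notin> X"
    then have "X \<in> ?A" using X M(2) by auto
    then show "X = M" using max X by simp
  qed
  then have "maximal_left_ideal cs M" unfolding maximal_left_ideal_def using M by simp
  then show thesis using M(2) by (rule that)
qed

lemma PrimE:
  assumes "P \<in> Prim cs"
  obtains L where "maximal_left_ideal cs L" "P = {a. \<forall>b. a * b \<in> L}" "P \<subseteq> L"
proof -
  obtain L where L: "maximal_left_ideal cs L" "P = {a. \<forall>b. a * b \<in> L}"
    using assms by (auto simp: Prim_def)
  have "P \<subseteq> L" unfolding L(2) by (auto dest: spec[where x = 1])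
  then show thesis using L that by blast
qed

lemma Prim_0: "P \<in> Prim cs \<Longrightarrow> 0 \<in> P"
  and Prim_add: "P \<in> Prim cs \<Longrightarrow> x \<in> P \<Longrightarrow> y \<in> P \<Longrightarrow> x + y \<in> P"
  and Prim_left: "P \<in> Prim cs \<Longrightarrow> x \<in> P \<Longrightarrow> a * x \<in> P"
  and Prim_right: "P \<in> Prim cs \<Longrightarrow> x \<in> P \<Longrightarrow> x * a \<in> P"
  unfolding Prim_def maximal_left_ideal_def left_ideal_iff
  by (auto simp: distrib_right mult.assoc)

lemma Prim_1: "P \<in> Prim cs \<Longrightarrow> 1 \<notin> P"
  by (elim PrimE) (auto simp: maximal_left_ideal_def)

lemma Prim_compl: "P \<in> Prim cs \<Longrightarrow> x \<in> P \<Longrightarrow> 1 - x \<notin> P"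
  using Prim_add[of P x "1 - x"] Prim_1 by auto

lemma Prim_exists:
  assumes N: "left_ideal cs N" "1 \<notin> N"
  obtains L P where "P \<in> Prim cs" "maximal_left_ideal cs L" "N \<subseteq> L" "P \<subseteq> L" "1 \<notin> L"
    "left_ideal cs L" "P = {a. \<forall>b. a * b \<in> L}"
proof -
  obtain L where L: "maximal_left_ideal cs L" "N \<subseteq> L" using maximal_left_ideal_exists[OF N] .
  let ?P = "{a. \<forall>b. a * b \<in> L}"
  have "?P \<in> Prim cs" using L by (auto simp: Prim_def)
  moreover have "?P \<subseteq> L" by (auto dest: spec[where x = 1])
  ultimately show thesis using that L by (auto simp: maximal_left_ideal_def)
qed

text \<open>If \<open>b * c\<close> is outside the maximal left ideal \<open>L\<close>, then
  \<open>1 = x * b * c + l\<close> with \<open>l\<close> in \<open>L\<close>, and multiplying by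
  \<open>a * y\<close> puts \<open>a * y\<close> into \<open>L\<close>.\<close>

lemma Prim_prime:
  assumes P: "P \<in> Prim cs" and ab: "\<And>x. a * x * b \<in> P"
  shows "a \<in> P \<or> b \<in> P"
proof (rule ccontr)
  assume n: "\<not> (a \<in> P \<or> b \<in> P)"
  obtain L where L: "maximal_left_ideal cs L" "P = {a. \<forall>b. a * b \<in> L}" by (rule PrimE[OF P])
  have "left_ideal cs L" using L(1) by (simp add: maximal_left_ideal_def)
  note LI = left_ideal_0[OF this] left_ideal_add[OF this] left_ideal_mult[OF this]
  obtain c where c: "b * c \<notin> L" using n L(2) by auto
  define N where "N = {x * (b * c) + l | x l. l \<in> L}"
  have "left_ideal cs N" unfolding left_ideal_iff
  proof (intro conjI ballI allI)
    have "0 = 0 * (b * c) + 0" by simp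
    then show "0 \<in> N" using LI(1) unfolding N_def by blast
    fix y assume "y \<in> N"
    then obtain x l where y: "y = x * (b * c) + l" "l \<in> L" by (auto simp: N_def)
    show "z * y \<in> N" for z
    proof -
      have "z * y = (z * x) * (b * c) + z * l" by (simp add: y distrib_left mult.assoc)
      then show ?thesis using LI(3)[OF y(2)] unfolding N_def by blast
    qed
    fix y' assume "y' \<in> N"
    then obtain x' l' where y': "y' = x' * (b * c) + l'" "l' \<in> L" by (auto simp: N_def)
    have "y + y' = (x + x') * (b * c) + (l + l')" by (simp add: y y' distrib_right add_ac)
    then show "y + y' \<in> N" using LI(2)[OF y(2) y'(2)] unfolding N_def by blast
  qed
  moreover have "L \<subseteq> N"
  proof
    fix l assume "l \<in> L"
    moreover have "l = 0 * (b * c) + l" by simp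
    ultimately show "l \<in> N" unfolding N_def by blast
  qed
  moreover have "b * c \<in> N"
  proof -
    have "b * c = 1 * (b * c) + 0" by simp
    then show ?thesis using LI(1) unfolding N_def by blast
  qed
  ultimately have "1 \<in> N" using L(1) c unfolding maximal_left_ideal_def by blast
  then obtain x l where one: "1 = x * (b * c) + l" "l \<in> L" by (auto simp: N_def)
  have "a * y \<in> L" for y
  proof -
    have "a * y = a * y * (x * (b * c) + l)" using one by simp
    also have "\<dots> = (a * (y * x) * b) * c + (a * y) * l" by (simp add: distrib_left mult.assoc)
    finally have "a * y = (a * (y * x) * b) * c + (a * y) * l" .
    moreover have "(a * (y * x) * b) * c \<in> L" using ab[of "y * x"] unfolding L(2) by simp
    moreover have "(a * y) * l \<in> L" using one(2) by (rule LI(3))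
    ultimately show ?thesis using LI(2) by metis
  qed
  then show False using n L(2) by simp
qed

text \<open>For \<open>y\<close> in all primitive ideals, \<open>1 - y\<close> has a left inverse,
  which is again of this form, so \<open>1 - y\<close> is invertible. Hence x* x has spectral radius
  0.\<close>

lemma semisimple:
  assumes x: "\<And>P. P \<in> Prim cs \<Longrightarrow> x \<in> P"
  shows "x = 0"
proof -
  have left_inv: "\<exists>z. z * (1 - y) = 1" if y: "\<And>P. P \<in> Prim cs \<Longrightarrow> y \<in> P" for y
  proof (rule ccontr)
    assume n: "\<not> ?thesis"
    let ?N = "range (\<lambda>a. a * (1 - y))"
    have I: "left_ideal cs ?N" unfolding left_ideal_iff
      by (auto simp: image_iff) (metis mult_zero_left, metis distrib_right, metis mult.assoc)
    have n1: "1 \<notin> ?N" using n by (metis imageE)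
        obtain L P where LP: "P \<in> Prim cs" "maximal_left_ideal cs L" "?N \<subseteq> L" "P \<subseteq> L" "1 \<notin> L"
      "left_ideal cs L" "P = {a. \<forall>b. a * b \<in> L}"
      by (rule Prim_exists[OF I n1], rule that; assumption)
    note L = LP(1) LP(3) LP(4) LP(5) LP(6)
    have "1 * (1 - y) \<in> L" using L(2) by blast
    moreover have "y \<in> L" using y[OF L(1)] L(3) by blast
    ultimately have "1 * (1 - y) + y \<in> L" using L(5) unfolding left_ideal_iff by blast
    then show False using L(4) by simp
  qed
  have inv: "alg_invertible (1 - y)" if y: "\<And>P. P \<in> Prim cs \<Longrightarrow> y \<in> P" for y
  proof -
    obtain z where z: "z * (1 - y) = 1" using left_inv[OF y] by blast
    have "\<And>P. P \<in> Prim cs \<Longrightarrow> (- z) * y \<in> P" using y Prim_left by blast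
    then obtain w where w: "w * (1 - (- z) * y) = 1" using left_inv by metis
    have "1 - (- z) * y = z" using z by (simp add: right_diff_distrib diff_eq_eq)
    then have "w * z = 1" using w by simp
    then have "w = w * (z * (1 - y))" using z by simp
    also have "\<dots> = 1 - y" using \<open>w * z = 1\<close> by (simp flip: mult.assoc)
    finally show ?thesis using z \<open>w * z = 1\<close> unfolding alg_invertible_def by blast
  qed
  let ?h = "st x * x"
  have "sr ?h \<le> 0"
  proof (rule sr_least, rule ccontr)
    fix z assume z: "z \<in> spec cs ?h" and "\<not> cmod z \<le> 0"
    then have z0: "z \<noteq> 0" by simp
    have "alg_invertible (1 - emb (inverse z) * ?h)"
      using x Prim_left by (intro inv) blast
    then have "alg_invertible (emb z * (1 - emb (inverse z) * ?h))"
      by (intro alg_invertible_mult alg_invertible_emb z0)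
    moreover have "emb z * (1 - emb (inverse z) * ?h) = emb z - ?h"
      using emb_inverse[OF z0] by (simp add: right_diff_distrib flip: mult.assoc)
    ultimately show False using z by (simp add: spec_iff alg_invertible_diff_commute)
  qed
  moreover have "st ?h = ?h" by (simp add: st_mult)
  ultimately have "norm ?h \<le> 0" using sr_hermitian by simp
  then show ?thesis by (simp add: norm_st_mult)
qed

section \<open>The hull-kernel topology\<close>

definition prim_hull :: "'a set \<Rightarrow> 'a set set" where
  "prim_hull J = {P \<in> Prim cs. J \<subseteq> P}"

abbreviation PrimX :: "'a set topology" where "PrimX \<equiv> jacobson_topology cs"

lemma openin_hull_compl: "openin PrimX (Prim cs - prim_hull J)"
  unfolding jacobson_topology_def openin_topology_generated_by_iff prim_hull_def
  by (rule generate_topology_on.Basis) blast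

text \<open>The generating sets already form a topology; closure under intersections is primeness,
  through the products \<open>x * z * y\<close>.\<close>

lemma openin_jacobson:
  assumes "openin PrimX U"
  shows "\<exists>J. U = Prim cs - prim_hull J"
  using assms unfolding jacobson_topology_def openin_topology_generated_by_iff
proof (induction rule: generate_topology_on.induct)
  case Empty
  have "prim_hull {} = Prim cs" by (auto simp: prim_hull_def)
  then show ?case by (intro exI[of _ "{}"]) simp
next
  case (Int a b)
  then obtain J1 J2 where J: "a = Prim cs - prim_hull J1" "b = Prim cs - prim_hull J2" by blast
  have "a \<inter> b = Prim cs - prim_hull {x * z * y | x y z. x \<in> J1 \<and> y \<in> J2}"
  proof (intro equalityI subsetI)
    fix P assume "P \<in> a \<inter> b"
    then obtain x y where P: "P \<in> Prim cs" "x \<in> J1" "x \<notin> P" "y \<in> J2" "y \<notin> P"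
      unfolding J prim_hull_def by blast
    then obtain z where "x * z * y \<notin> P" using Prim_prime by blast
    then show "P \<in> Prim cs - prim_hull {x * z * y | x y z. x \<in> J1 \<and> y \<in> J2}"
      using P unfolding prim_hull_def by blast
  next
    fix P assume "P \<in> Prim cs - prim_hull {x * z * y | x y z. x \<in> J1 \<and> y \<in> J2}"
    then obtain x y z where P: "P \<in> Prim cs" "x \<in> J1" "y \<in> J2" "x * z * y \<notin> P"
      unfolding prim_hull_def by blast
    then have "x \<notin> P" "y \<notin> P" using Prim_left Prim_right by blast+
    then show "P \<in> a \<inter> b" using P unfolding J prim_hull_def by blast
  qed
  then show ?case by blast
next
  case (UN K)
  then obtain J where J: "\<And>k. k \<in> K \<Longrightarrow> k = Prim cs - prim_hull (J k)" by metis
  have "\<Union>K = Prim cs - prim_hull (\<Union>k\<in>K. J k)"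
  proof (intro equalityI subsetI)
    fix P assume "P \<in> \<Union>K"
    then show "P \<in> Prim cs - prim_hull (\<Union>k\<in>K. J k)" using J unfolding prim_hull_def by blast
  next
    fix P assume "P \<in> Prim cs - prim_hull (\<Union>k\<in>K. J k)"
    then obtain k where k: "k \<in> K" "P \<in> Prim cs" "\<not> J k \<subseteq> P" unfolding prim_hull_def by blast
    then have "P \<in> k" using J[OF k(1)] unfolding prim_hull_def by blast
    then show "P \<in> \<Union>K" using k by blast
  qed
  then show ?case by blast
next
  case (Basis s)
  then show ?case unfolding prim_hull_def by blast
qed

lemma topspace_jacobson: "topspace PrimX = Prim cs"
proof
  show "topspace PrimX \<subseteq> Prim cs" using openin_jacobson[OF openin_topspace] by blast
  have "prim_hull {1} = {}" using Prim_1 by (auto simp: prim_hull_def)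
  then show "Prim cs \<subseteq> topspace PrimX" using openin_subset[OF openin_hull_compl[of "{1}"]] by simp
qed

text \<open>The algebraic ideal, not its closure: membership means a finite sum. Complex scalars can
  be absorbed into \<open>a\<close>, so the real span is an ideal of the complex algebra.\<close>

definition two_sided :: "'a set \<Rightarrow> 'a set" where
  "two_sided S = span {a * x * b | a x b. x \<in> S}"

lemma two_sided_left: "x \<in> two_sided S \<Longrightarrow> c * x \<in> two_sided S"
  unfolding two_sided_def
proof (induction x rule: span_induct_alt)
  case (step r x y)
  then obtain a z b where "x = a * z * b" "z \<in> S" by blast
  then have "c * x = (c * a) * z * b" "z \<in> S" by (simp_all add: mult.assoc)
  then have "c * x \<in> {a * x * b | a x b. x \<in> S}" by blast
  then show ?case using step by (simp add: distrib_left span_add span_scale span_base)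
qed (simp add: span_zero)

lemma two_sided_right: "x \<in> two_sided S \<Longrightarrow> x * c \<in> two_sided S"
  unfolding two_sided_def
proof (induction x rule: span_induct_alt)
  case (step r x y)
  then obtain a z b where "x = a * z * b" "z \<in> S" by blast
  then have "x * c = a * z * (b * c)" "z \<in> S" by (simp_all add: mult.assoc)
  then have "x * c \<in> {a * x * b | a x b. x \<in> S}" by blast
  then show ?case using step by (simp add: distrib_right span_add span_scale span_base)
qed (simp add: span_zero)

lemma two_sided_base: "x \<in> S \<Longrightarrow> x \<in> two_sided S"
  unfolding two_sided_def by (rule span_base) (force intro: exI[of _ 1])

lemma Prim_subspace: "P \<in> Prim cs \<Longrightarrow> subspace P"
  using Prim_0 Prim_add Prim_left[of P _ "emb (of_real _)"]
  by (auto simp: subspace_def emb_of_real_mult)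

lemma left_ideal_two_sided: "left_ideal cs (two_sided S)"
  unfolding left_ideal_iff using two_sided_left
  by (auto simp: two_sided_def span_zero span_add)

text \<open>A cover by hull complements means that the ideal generated by all the sets
  \<open>J U\<close> lies in no primitive ideal, so it contains 1. A finite expression for 1 names a
  finite subcover.\<close>

theorem compact_jacobson: "compact_space PrimX"
  unfolding compact_space_alt
proof (intro allI impI)
  fix \<U> assume U: "(\<forall>U\<in>\<U>. openin PrimX U) \<and> topspace PrimX \<subseteq> \<Union>\<U>"
  then have "\<forall>U\<in>\<U>. \<exists>J. U = Prim cs - prim_hull J" using openin_jacobson by blast
  then obtain J where J: "\<And>U. U \<in> \<U> \<Longrightarrow> U = Prim cs - prim_hull (J U)" by metis
  let ?S = "\<Union>U\<in>\<U>. J U"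
  have "1 \<in> two_sided ?S"
  proof (rule ccontr)
    assume n: "1 \<notin> two_sided ?S"
    obtain L P where LP: "P \<in> Prim cs" "maximal_left_ideal cs L" "two_sided ?S \<subseteq> L" "P \<subseteq> L" "1 \<notin> L"
      "left_ideal cs L" "P = {a. \<forall>b. a * b \<in> L}"
      by (rule Prim_exists[OF left_ideal_two_sided n], rule that; assumption)
    note L = LP(1) LP(3) LP(7)
    have "?S \<subseteq> P" using L(2) two_sided_base two_sided_right unfolding L(3) by blast
    moreover obtain V where V: "V \<in> \<U>" "P \<in> V" using U L(1) topspace_jacobson by blast
    ultimately show False using J[OF V(1)] V unfolding prim_hull_def by blast
  qed
  then obtain t r where t: "finite t" "t \<subseteq> {a * x * b | a x b. x \<in> ?S}" "(\<Sum>a\<in>t. r a *\<^sub>R a) = 1"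
    unfolding two_sided_def span_explicit by (smt (verit) mem_Collect_eq)
  have "\<forall>y\<in>t. \<exists>V\<in>\<U>. \<exists>a x b. x \<in> J V \<and> y = a * x * b" using t(2) by blast
  then obtain F where F: "\<And>y. y \<in> t \<Longrightarrow> F y \<in> \<U> \<and> (\<exists>a x b. x \<in> J (F y) \<and> y = a * x * b)" by metis
  have "topspace PrimX \<subseteq> \<Union>(F ` t)"
  proof (rule ccontr)
    assume "\<not> ?thesis"
    then obtain P where P: "P \<in> Prim cs" "\<And>y. y \<in> t \<Longrightarrow> P \<notin> F y" by (auto simp: topspace_jacobson)
    have "y \<in> P" if y: "y \<in> t" for y
    proof -
      obtain a x b where x: "x \<in> J (F y)" "y = a * x * b" using F[OF y] by blast
      have "J (F y) \<subseteq> P" using P(2)[OF y] P(1) J[of "F y"] F[OF y] unfolding prim_hull_def by blast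
      then show ?thesis using x Prim_left[OF P(1)] Prim_right[OF P(1)] by blast
    qed
    then have "(\<Sum>a\<in>t. r a *\<^sub>R a) \<in> P"
      using Prim_subspace[OF P(1)] by (intro subspace_sum subspace_scale) auto
    then show False using t(3) Prim_1[OF P(1)] by simp
  qed
  then show "\<exists>\<F>. finite \<F> \<and> \<F> \<subseteq> \<U> \<and> topspace PrimX \<subseteq> \<Union>\<F>"
    using F t(1) by (intro exI[of _ "F ` t"]) auto
qed

section \<open>Central idempotents and central supports\<close>

definition central_idem :: "'a \<Rightarrow> bool" where
  "central_idem e \<longleftrightarrow> e * e = e \<and> (\<forall>x. e * x = x * e)"

lemma central_idemI: "(\<And>x. e * x = x * e) \<Longrightarrow> e * e = e \<Longrightarrow> central_idem e"
  and central_idem_square: "central_idem e \<Longrightarrow> e * e = e"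
  and central_idem_commute: "central_idem e \<Longrightarrow> e * x = x * e"
  unfolding central_idem_def by blast+

text \<open>A Chinese remainder argument: the kernels of \<open>W\<close> and of its complement have
  a sum contained in no primitive ideal, so 1 splits. Products of the two parts lie in every
  primitive ideal and vanish.\<close>

lemma clopen_idempotent:
  assumes W: "openin PrimX W" "closedin PrimX W"
  obtains e where "central_idem e" "\<And>P. P \<in> Prim cs \<Longrightarrow> P \<in> W \<Longrightarrow> 1 - e \<in> P"
    "\<And>P. P \<in> Prim cs \<Longrightarrow> P \<notin> W \<Longrightarrow> e \<in> P"
proof -
  obtain J1 where J1: "W = Prim cs - prim_hull J1" using openin_jacobson[OF W(1)] by blast
  have "openin PrimX (Prim cs - W)" using W(2) by (simp add: closedin_def topspace_jacobson)
  then obtain J2 where J2: "Prim cs - W = Prim cs - prim_hull J2" using openin_jacobson by blast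
  define I where "I = {x. \<forall>P\<in>Prim cs. P \<in> W \<longrightarrow> x \<in> P}"
  define I' where "I' = {x. \<forall>P\<in>Prim cs. P \<notin> W \<longrightarrow> x \<in> P}"
  define N where "N = {x + y | x y. x \<in> I \<and> y \<in> I'}"
  have I0: "0 \<in> I" "0 \<in> I'" using Prim_0 by (auto simp: I_def I'_def)
  have IN: "I \<subseteq> N" "I' \<subseteq> N"
  proof -
    have "x = x + 0" "x = 0 + x" for x :: 'a by simp_all
    then show "I \<subseteq> N" "I' \<subseteq> N" using I0 unfolding N_def by blast+
  qed
  have Ir: "x * b \<in> I" if "x \<in> I" for x b using that Prim_right by (auto simp: I_def)
  have Ir': "x * b \<in> I'" if "x \<in> I'" for x b using that Prim_right by (auto simp: I'_def)
  have "1 \<in> N"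
  proof (rule ccontr)
    assume n: "1 \<notin> N"
    have I_N: "left_ideal cs N" unfolding left_ideal_iff
    proof (intro conjI ballI allI)
      show "0 \<in> N" using I0 IN by blast
      fix z assume "z \<in> N"
      then obtain x y where z: "z = x + y" "x \<in> I" "y \<in> I'" by (auto simp: N_def)
      have "a * x \<in> I" "a * y \<in> I'" for a using z Prim_left by (auto simp: I_def I'_def)
      then show "a * z \<in> N" for a unfolding N_def z(1) distrib_left by blast
      fix z' assume "z' \<in> N"
      then obtain x' y' where z': "z' = x' + y'" "x' \<in> I" "y' \<in> I'" by (auto simp: N_def)
      have "x + x' \<in> I" "y + y' \<in> I'" using z z' Prim_add by (auto simp: I_def I'_def)
      moreover have "z + z' = (x + x') + (y + y')" by (simp add: z z')
      ultimately show "z + z' \<in> N" unfolding N_def by blast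
    qed
    obtain L P where LP: "P \<in> Prim cs" "maximal_left_ideal cs L" "N \<subseteq> L" "P \<subseteq> L" "1 \<notin> L"
      "left_ideal cs L" "P = {a. \<forall>b. a * b \<in> L}"
      by (rule Prim_exists[OF I_N n], rule that; assumption)
    note L = LP(1) LP(3) LP(7)
    have "I \<subseteq> P" "I' \<subseteq> P" using L(2) IN Ir Ir' unfolding L(3) by blast+
    show False
    proof (cases "P \<in> W")
      case True
      then have "\<not> J1 \<subseteq> P" using J1 by (auto simp: prim_hull_def)
      moreover have "J1 \<subseteq> I'" using J1 by (auto simp: I'_def prim_hull_def)
      ultimately show False using \<open>I' \<subseteq> P\<close> by blast
    next
      case False
      then have "\<not> J2 \<subseteq> P" using J2 L(1) by (auto simp: prim_hull_def)
      moreover have "J2 \<subseteq> I" using J2 by (auto simp: I_def prim_hull_def)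
      ultimately show False using \<open>I \<subseteq> P\<close> by blast
    qed
  qed
  then obtain f e where fe: "1 = f + e" "f \<in> I" "e \<in> I'" by (auto simp: N_def)
  have f: "f = 1 - e" using fe(1) by (simp add: algebra_simps)
  have in_e: "\<And>P. P \<in> Prim cs \<Longrightarrow> P \<in> W \<Longrightarrow> 1 - e \<in> P" "\<And>P. P \<in> Prim cs \<Longrightarrow> P \<notin> W \<Longrightarrow> e \<in> P"
    using fe(2,3) by (auto simp: I_def I'_def f)
  have 1: "e * x * (1 - e) = 0" for x
    by (rule semisimple) (metis in_e Prim_left Prim_right mult.assoc)
  have 2: "(1 - e) * x * e = 0" for x
    by (rule semisimple) (metis in_e Prim_left Prim_right mult.assoc)
  have "e * x = x * e" for x
    using 1[of x] 2[of x] by (simp add: right_diff_distrib left_diff_distrib)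
  moreover have "e * e = e" using 1[of 1] by (simp add: right_diff_distrib)
  ultimately have "central_idem e" by (intro central_idemI)
  then show thesis using in_e by (rule that)
qed

end

locale zero_dim_cstar = cstar +
  assumes Hausdorff: "Hausdorff_space (jacobson_topology cs)"
    and totally_disconnected: "totally_disconnected_space (jacobson_topology cs)"
begin

text \<open>Total disconnectedness says only that components are points; in a compact Hausdorff
  space a component has arbitrarily small clopen neighbourhoods.\<close>

lemma clopen_separation:
  assumes "P \<in> Prim cs" "Q \<in> Prim cs" "P \<noteq> Q"
  obtains W where "openin PrimX W" "closedin PrimX W" "P \<in> W" "Q \<notin> W"
proof -
  let ?C = "connected_component_of_set PrimX P"
  have P: "P \<in> topspace PrimX" using assms by (simp add: topspace_jacobson)
  have "\<exists>a. ?C \<subseteq> {a}"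
    using totally_disconnected unfolding totally_disconnected_space_def
    by (simp add: connectedin_connected_component_of)
  then obtain a where "?C \<subseteq> {a}" by (elim exE)
  moreover have "P \<in> ?C" using P by (simp add: connected_component_of_refl)
  ultimately have C: "?C = {P}" by blast
  have "{P} \<in> connected_components_of PrimX"
    using P unfolding connected_components_of_def C[symmetric] by blast
  moreover have "locally_compact_space PrimX"
    using compact_jacobson by (rule compact_imp_locally_compact_space)
  moreover obtain V where V: "openin PrimX V" "P \<in> V" "Q \<notin> V"
    using Hausdorff assms unfolding Hausdorff_space_def topspace_jacobson disjnt_iff by metis
  moreover have "compactin PrimX {P}" using P by simp
  ultimately obtain U U' where U: "openin PrimX U" "openin PrimX U'" "disjnt U U'"
    "U \<union> U' = topspace PrimX" "{P} \<subseteq> U" "U \<subseteq> V"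
    using wilder_locally_compact_component_thm[of PrimX "{P}" V] Hausdorff by blast
  have "topspace PrimX - U = U'" using U(3,4) by (auto simp: disjnt_iff)
  then have "closedin PrimX U" using U openin_subset by (auto simp: closedin_def)
  then show thesis using U V that by blast
qed

text \<open>Since clopen sets separate points, \<open>P0\<close> is the only primitive ideal containing all central
  idempotents of \<open>P0\<close>.\<close>

lemma local_central_support:
  assumes p: "p * p = p" and P0: "P0 \<in> Prim cs" "p \<in> P0"
  obtains f where "central_idem f" "f \<in> P0" "f * p = p"
proof -
  define N where "N = {x * (1 - p) + f * y | x f y. central_idem f \<and> f \<in> P0}"
  have c0: "central_idem 0" by (rule central_idemI) simp_all
  have "1 \<in> N"
  proof (rule ccontr)
    assume n: "1 \<notin> N"
    have I_N: "left_ideal cs N" unfolding left_ideal_iff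
    proof (intro conjI ballI allI)
      have "0 = 0 * (1 - p) + 0 * 0" by simp
      then show "0 \<in> N" using c0 Prim_0[OF P0(1)] unfolding N_def by blast
      fix z assume "z \<in> N"
      then obtain x f y where z: "z = x * (1 - p) + f * y" "central_idem f" "f \<in> P0" by (auto simp: N_def)
      show "a * z \<in> N" for a
      proof -
        have "a * (f * y) = f * (a * y)" using central_idem_commute[OF z(2)] by (metis mult.assoc)
        then have "a * z = (a * x) * (1 - p) + f * (a * y)" by (simp add: z(1) distrib_left mult.assoc)
        then show ?thesis using z unfolding N_def by blast
      qed
      fix z' assume "z' \<in> N"
      then obtain x' f' y' where z': "z' = x' * (1 - p) + f' * y'" "central_idem f'" "f' \<in> P0"
        by (auto simp: N_def)
      \<comment> \<open>The join of \<open>f\<close> and \<open>f'\<close> in the Boolean algebra of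
        central idempotents. It absorbs both, which makes \<open>N\<close> closed under
        addition.\<close>
      define h where "h = f + f' - f * f'"
      note ff = central_idem_square[OF z(2)] central_idem_square[OF z'(2)]
      have f'f: "f' * f = f * f'" by (rule central_idem_commute[OF z'(2)])
      have hf: "h * f = f" "h * f' = f'"
        by (simp_all add: h_def left_diff_distrib distrib_right mult.assoc f'f ff)
           (simp add: ff flip: mult.assoc)
      have "h * x = x * h" for x
      proof -
        have "f * f' * x = x * (f * f')"
          using central_idem_commute[OF z(2)] central_idem_commute[OF z'(2)] by (metis mult.assoc)
        then show ?thesis
          by (simp add: h_def left_diff_distrib distrib_right right_diff_distrib distrib_left
              central_idem_commute[OF z(2), of x] central_idem_commute[OF z'(2), of x])
      qed
      moreover have "h * h = h"
      proof -
        have "h * (f + f' - f * f') = h * f + h * f' - (h * f) * f'"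
          by (simp only: right_diff_distrib distrib_left mult.assoc)
        then show ?thesis unfolding hf by (simp only: h_def[symmetric])
      qed
      ultimately have "central_idem h" by (intro central_idemI)
      moreover have "h \<in> P0" 
      proof -
        have "h = f + (1 - f) * f'" by (simp add: h_def left_diff_distrib)
        then show ?thesis using Prim_add[OF P0(1) z(3) Prim_left[OF P0(1) z'(3)]] by simp
      qed
      moreover have "z + z' = (x + x') * (1 - p) + h * (f * y + f' * y')"
        by (simp add: z(1) z'(1) distrib_right distrib_left hf flip: mult.assoc)
      ultimately show "z + z' \<in> N" unfolding N_def by blast
    qed
    obtain L P where LP: "P \<in> Prim cs" "maximal_left_ideal cs L" "N \<subseteq> L" "P \<subseteq> L" "1 \<notin> L"
      "left_ideal cs L" "P = {a. \<forall>b. a * b \<in> L}"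
      by (rule Prim_exists[OF I_N n], rule that; assumption)
    note L = LP(1) LP(3) LP(7) LP(5) LP(6) LP(4)
    have fP: "f \<in> P" if "central_idem f" "f \<in> P0" for f
    proof -
      have "f * y = 0 * (1 - p) + f * y" for y by simp
      then have "f * y \<in> N" for y using that unfolding N_def by blast
      then show ?thesis using L(2) unfolding L(3) by blast
    qed
    have "P = P0"
    proof (rule ccontr)
      assume "P \<noteq> P0"
      then obtain W where W: "openin PrimX W" "closedin PrimX W" "P \<in> W" "P0 \<notin> W"
        using clopen_separation[OF L(1) P0(1)] by blast
      obtain e where e: "central_idem e" "1 - e \<in> P" "e \<in> P0"
        using clopen_idempotent[OF W(1,2)] W L(1) P0(1) by metis
      then show False using fP Prim_compl[OF L(1)] by blast
    qed
    then have "p \<in> L" using P0 L(6) by blast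
    moreover have "1 - p \<in> L"
    proof -
      have "1 - p = 1 * (1 - p) + 0 * 0" by simp
      then have "1 - p \<in> N" using c0 Prim_0[OF P0(1)] unfolding N_def by blast
      then show ?thesis using L(2) by blast
    qed
    ultimately have "p + (1 - p) \<in> L" using L(5) unfolding left_ideal_iff by blast
    then show False using L(4) by simp
  qed
  then obtain x f y where one: "1 = x * (1 - p) + f * y" and f: "central_idem f" "f \<in> P0"
    by (auto simp: N_def)
  \<comment> \<open>Multiplication by \<open>p\<close> on the right removes the term with
    \<open>1 - p\<close>, so \<open>p\<close> is a multiple of \<open>f\<close> and fixed by
    it.\<close>
  have "p = (x * (1 - p) + f * y) * p" using one by simp
  also have "\<dots> = f * y * p" by (simp add: distrib_right mult.assoc left_diff_distrib p)
  finally have pf: "p = f * (y * p)" by (simp add: mult.assoc)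
  have "f * p = f * (f * (y * p))" using pf by simp
  also have "\<dots> = f * (y * p)" by (simp add: central_idem_square[OF f(1)] flip: mult.assoc)
  finally have "f * p = p" using pf by simp
  then show thesis using f that by blast
qed

text \<open>Where \<open>1 - f\<close> is outside a primitive ideal, primeness puts
  \<open>f\<close>, hence \<open>p = f * p\<close>, inside. So the hull of \<open>p\<close> is open
  as well as closed. Its complement gives \<open>e\<close>, and the ideal generated by
  \<open>p\<close> together with \<open>1 - e\<close> lies in no primitive ideal.\<close>

theorem central_support:
  assumes p: "p * p = p"
  obtains e where "central_idem e" "e * p = p" "e \<in> two_sided {p}"
proof -
  define W where "W = Prim cs - prim_hull {p}"
  have "openin PrimX (prim_hull {p})"
  proof (subst openin_subopen, intro ballI)
    fix P0 assume "P0 \<in> prim_hull {p}"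
    then have P0: "P0 \<in> Prim cs" "p \<in> P0" by (auto simp: prim_hull_def)
    obtain f where f: "central_idem f" "f \<in> P0" "f * p = p" using local_central_support[OF p P0] .
    have "P \<in> prim_hull {p}" if P: "P \<in> Prim cs - prim_hull {1 - f}" for P
    proof -
      have P: "P \<in> Prim cs" "1 - f \<notin> P" using P by (auto simp: prim_hull_def)
      have "(1 - f) * x * f = 0" for x
      proof -
        have "f * x * f = x * f * f" by (simp only: central_idem_commute[OF f(1), of x])
        also have "\<dots> = x * f" by (simp only: mult.assoc central_idem_square[OF f(1)])
        finally show ?thesis by (simp add: left_diff_distrib)
      qed
      then have "f \<in> P" using Prim_prime[OF P(1), of "1 - f" f] Prim_0[OF P(1)] P(2) by auto
      then have "f * p \<in> P" by (rule Prim_right[OF P(1)])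
      then show ?thesis using f P by (simp add: prim_hull_def)
    qed
    moreover have "P0 \<in> Prim cs - prim_hull {1 - f}" using P0 f Prim_compl by (auto simp: prim_hull_def)
    ultimately show "\<exists>T. openin PrimX T \<and> P0 \<in> T \<and> T \<subseteq> prim_hull {p}" using openin_hull_compl by blast
  qed
  moreover have "topspace PrimX - W = prim_hull {p}" by (auto simp: W_def topspace_jacobson prim_hull_def)
  ultimately have "closedin PrimX W" by (simp add: closedin_def W_def topspace_jacobson)
  moreover have "openin PrimX W" unfolding W_def by (rule openin_hull_compl)
  ultimately obtain e where e: "central_idem e" "\<And>P. P \<in> Prim cs \<Longrightarrow> P \<in> W \<Longrightarrow> 1 - e \<in> P"
    "\<And>P. P \<in> Prim cs \<Longrightarrow> P \<notin> W \<Longrightarrow> e \<in> P"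
    by (metis clopen_idempotent)
  have "(1 - e) * p = 0"
  proof (rule semisimple)
    fix P assume P: "P \<in> Prim cs"
    show "(1 - e) * p \<in> P"
    proof (cases "P \<in> W")
      case True
      then show ?thesis using e(2)[OF P] Prim_right[OF P] by blast
    next
      case False
      then have "p \<in> P" using P by (simp add: W_def prim_hull_def)
      then show ?thesis by (rule Prim_left[OF P])
    qed
  qed
  then have ep: "e * p = p" by (simp add: left_diff_distrib)
  define N where "N = {s + (1 - e) * a | s a. s \<in> two_sided {p}}"
  have "1 \<in> N"
  proof (rule ccontr)
    assume n: "1 \<notin> N"
    have I_N: "left_ideal cs N" unfolding left_ideal_iff
    proof (intro conjI ballI allI)
      have "0 = 0 + (1 - e) * 0" by simp
      then show "0 \<in> N" unfolding N_def two_sided_def using span_zero by blast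
      fix z assume "z \<in> N"
      then obtain s a where z: "z = s + (1 - e) * a" "s \<in> two_sided {p}" by (auto simp: N_def)
      show "b * z \<in> N" for b
      proof -
        have "b * e = e * b" by (rule central_idem_commute[OF e(1), symmetric])
        then have "b * z = b * s + (1 - e) * (b * a)"
          by (simp add: z(1) distrib_left left_diff_distrib right_diff_distrib flip: mult.assoc)
        then show ?thesis using two_sided_left[OF z(2)] unfolding N_def by blast
      qed
      fix z' assume "z' \<in> N"
      then obtain s' a' where z': "z' = s' + (1 - e) * a'" "s' \<in> two_sided {p}" by (auto simp: N_def)
      have "z + z' = (s + s') + (1 - e) * (a + a')" by (simp add: z(1) z'(1) distrib_left)
      moreover have "s + s' \<in> two_sided {p}" using z(2) z'(2) unfolding two_sided_def by (rule span_add)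
      ultimately show "z + z' \<in> N" unfolding N_def by blast
    qed
    obtain L P where LP: "P \<in> Prim cs" "maximal_left_ideal cs L" "N \<subseteq> L" "P \<subseteq> L" "1 \<notin> L"
      "left_ideal cs L" "P = {a. \<forall>b. a * b \<in> L}"
      by (rule Prim_exists[OF I_N n], rule that; assumption)
    note L = LP(1) LP(3) LP(7)
    have "p * b \<in> N" for b
    proof -
      have "p * b = p * b + (1 - e) * 0" by simp
      moreover have "p * b \<in> two_sided {p}" by (intro two_sided_right two_sided_base) simp
      ultimately show ?thesis unfolding N_def by blast
    qed
    then have "p \<in> P" using L(2) unfolding L(3) by blast
    then have "P \<notin> W" using L(1) by (simp add: W_def prim_hull_def)
    then have "e \<in> P" using e(3) L(1) by blast
    moreover have "(1 - e) * b \<in> N" for b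
    proof -
      have "(1 - e) * b = 0 + (1 - e) * b" by simp
      moreover have "0 \<in> two_sided {p}" unfolding two_sided_def by (rule span_zero)
      ultimately show ?thesis unfolding N_def by blast
    qed
    then have "1 - e \<in> P" using L(2) unfolding L(3) by blast
    ultimately show False using Prim_compl[OF L(1)] by blast
  qed
  then obtain s a where one: "1 = s + (1 - e) * a" "s \<in> two_sided {p}" by (auto simp: N_def)
  have "e = e * (s + (1 - e) * a)" using one(1) by simp
  also have "\<dots> = e * s" by (simp add: central_idem_square[OF e(1)] distrib_left right_diff_distrib left_diff_distrib flip: mult.assoc)
  finally have "e \<in> two_sided {p}" using two_sided_left[OF one(2)] by metis
  then show thesis using e(1) ep that by blast
qed

end

section \<open>Corners and the main theorem\<close>

context cstar
begin

definition corner_commutators :: "'a \<Rightarrow> 'a set" where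
  "corner_commutators p = {x * y - y * x | x y. p * x * p = x \<and> p * y * p = y}"

definition corner_square_zero :: "'a \<Rightarrow> 'a set" where
  "corner_square_zero p = {x. p * x * p = x \<and> x * x = 0}"

lemma corner_commutators_mult:
  assumes p: "p * p = p"
  shows "(p * a * p) * (p * b * p) - (p * b * p) * (p * a * p) \<in> corner_commutators p"
proof -
  have "p * (p * x * p) * p = p * x * p" for x
    using p by (simp add: mult.assoc) (simp add: p flip: mult.assoc)
  then show ?thesis unfolding corner_commutators_def by blast
qed

text \<open>If \<open>e = \<Sum> x\<^sub>i p y\<^sub>i\<close> is central with \<open>e p = p\<close>, then \<open>x \<mapsto> \<Sum> p y\<^sub>i x x\<^sub>i p\<close> induces a map from
  \<open>A / [A, A]\<close> to \<open>pAp / [pAp, pAp]\<close> that fixes \<open>p\<close>.\<close>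

theorem corner_commutators_dense:
  assumes dense: "closure (span commutators) = UNIV" and p: "p * p = p"
    and e: "central_idem e" "e * p = p" "e \<in> two_sided {p}"
  shows "p \<in> closure (span (corner_commutators p))"
proof -
  obtain t r where t: "finite t" "t \<subseteq> {a * x * b | a x b. x \<in> {p}}" "e = (\<Sum>u\<in>t. r u *\<^sub>R u)"
    using e(3) unfolding two_sided_def span_explicit by (smt (verit) mem_Collect_eq)
  have "\<forall>u\<in>t. \<exists>a b. u = a * p * b" using t(2) by blast
  then obtain a b where ab: "\<And>u. u \<in> t \<Longrightarrow> u = a u * p * b u" by metis
  define X where "X u = r u *\<^sub>R a u" for u
  have e_sum: "e = (\<Sum>u\<in>t. X u * p * b u)"
    unfolding t(3) by (intro sum.cong refl) (metis X_def ab mult_scaleR_left)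
  define \<theta> where "\<theta> x = (\<Sum>u\<in>t. p * b u * x * X u * p)" for x
  define m where "m u v x = p * (b u * x * X v) * p" for u v x
  let ?S = "span (corner_commutators p)"
  have bl: "bounded_linear \<theta>"
    unfolding \<theta>_def
    by (intro bounded_linear_sum bounded_linear_mult_const bounded_linear_const_mult bounded_linear_ident)
  have \<theta>_mult: "\<theta> (x * y) = (\<Sum>u\<in>t. \<Sum>v\<in>t. m u v x * m v u y)" for x y
  proof -
    have "p * b u * (x * y) * X u * p = (\<Sum>v\<in>t. m u v x * m v u y)" for u
    proof -
      \<comment> \<open>The final \<open>p\<close> is replaced by \<open>e * p\<close>; the central
        \<open>e\<close> moves between \<open>x\<close> and \<open>y\<close>, where its expansion
        makes the product factor through the corner.\<close>
      have "p * b u * (x * y) * X u * p = p * b u * (x * y) * X u * (e * p)" by (simp only: e(2))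
      also have "\<dots> = p * b u * x * (y * X u * e) * p" by (simp only: mult.assoc)
      also have "y * X u * e = e * (y * X u)" by (rule central_idem_commute[OF e(1), symmetric])
      also have "p * b u * x * (e * (y * X u)) * p
          = (\<Sum>v\<in>t. p * b u * x * ((X v * p * b v) * (y * X u)) * p)"
        unfolding e_sum by (simp only: sum_distrib_left sum_distrib_right)
      also have "\<dots> = (\<Sum>v\<in>t. m u v x * m v u y)"
      proof (intro sum.cong refl)
        fix v
        have "m u v x * m v u y = p * b u * x * X v * (p * p) * b v * y * X u * p"
          by (simp only: m_def mult.assoc)
        then show "p * b u * x * ((X v * p * b v) * (y * X u)) * p = m u v x * m v u y"
          by (simp only: p mult.assoc)
      qed
      finally show ?thesis .
    qed
    then show ?thesis by (simp add: \<theta>_def)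
  qed
  have \<theta>_comm: "\<theta> z \<in> ?S" if "z \<in> span commutators" for z
    using that
  proof (induction z rule: span_induct_alt)
    case base
    then show ?case using linear_0[OF bounded_linear.linear[OF bl]] by (simp add: span_zero)
  next
    case (step c z w)
    then obtain x y where z: "z = x * y - y * x" by (auto simp: commutators_def)
    \<comment> \<open>Exchanging the summations pairs each term with its factors in the opposite
      order, so the difference is a sum of corner commutators.\<close>
    have "\<theta> (y * x) = (\<Sum>u\<in>t. \<Sum>v\<in>t. m v u y * m u v x)"
      unfolding \<theta>_mult by (rule sum.swap)
    then have "\<theta> z = (\<Sum>u\<in>t. \<Sum>v\<in>t. m u v x * m v u y - m v u y * m u v x)"
      by (simp add: z linear_diff[OF bounded_linear.linear[OF bl]] \<theta>_mult sum_subtractf)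
    also have "\<dots> \<in> ?S"
      unfolding m_def by (intro span_sum span_base corner_commutators_mult p)
    finally show ?case
      using step by (simp add: linear_add[OF bounded_linear.linear[OF bl]]
          linear_cmul[OF bounded_linear.linear[OF bl]] span_add span_scale)
  qed
  have "\<theta> p \<in> closure ?S"
  proof -
    have "p \<in> closure (span commutators)" using dense by simp
    then obtain f where f: "\<And>n. f n \<in> span commutators" "f \<longlonglongrightarrow> p"
      unfolding closure_sequential by blast
    then have "(\<lambda>n. \<theta> (f n)) \<longlonglongrightarrow> \<theta> p" by (intro bounded_linear.tendsto[OF bl])
    moreover have "\<forall>n. \<theta> (f n) \<in> ?S" using f(1) \<theta>_comm by simp
    ultimately show ?thesis
      unfolding closure_sequential by (intro exI[of _ "\<lambda>n. \<theta> (f n)"] conjI)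
  qed
  moreover have "p - \<theta> p \<in> closure ?S"
  proof -
    have 1: "p = (\<Sum>u\<in>t. (p * X u * p) * (p * b u * p))"
    proof -
      have "p = p * (e * p)" by (simp add: e(2) p)
      also have "\<dots> = (\<Sum>u\<in>t. p * (X u * p * b u * p))"
        unfolding e_sum by (simp only: sum_distrib_left sum_distrib_right)
      also have "\<dots> = (\<Sum>u\<in>t. (p * X u * p) * (p * b u * p))"
      proof (intro sum.cong refl)
        fix u
        have "(p * X u * p) * (p * b u * p) = p * X u * (p * p) * b u * p" by (simp only: mult.assoc)
        then show "p * (X u * p * b u * p) = (p * X u * p) * (p * b u * p)" by (simp only: p mult.assoc)
      qed
      finally show ?thesis .
    qed
    have 2: "\<theta> p = (\<Sum>u\<in>t. (p * b u * p) * (p * X u * p))"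
      unfolding \<theta>_def
    proof (intro sum.cong refl)
      fix u
      have "(p * b u * p) * (p * X u * p) = p * b u * (p * p) * X u * p" by (simp only: mult.assoc)
      then show "p * b u * p * X u * p = (p * b u * p) * (p * X u * p)" by (simp only: p)
    qed
    have "p - \<theta> p = (\<Sum>u\<in>t. (p * X u * p) * (p * b u * p) - (p * b u * p) * (p * X u * p))"
      unfolding sum_subtractf 2 using 1 by simp
    also have "\<dots> \<in> ?S" by (intro span_sum span_base corner_commutators_mult p)
    finally show ?thesis using closure_subset by blast
  qed
  ultimately have "\<theta> p + (p - \<theta> p) \<in> closure ?S"
    using subspace_closure[of ?S] by (intro subspace_add) auto
  then show ?thesis by simp
qed

lemma corner_square_zero_emb: "z \<in> span (corner_square_zero p) \<Longrightarrow> emb c * z \<in> span (corner_square_zero p)"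
proof (induction z rule: span_induct_alt)
  case base
  then show ?case by (simp add: span_zero)
next
  case (step r z w)
  then have z: "p * z * p = z" "z * z = 0" by (simp_all add: corner_square_zero_def)
  have "p * (emb c * z) * p = emb c * (p * z * p)" by (simp add: mult.assoc emb_left_commute[of p])
  moreover have "(emb c * z) * (emb c * z) = emb c * (emb c * (z * z))"
    by (simp add: mult.assoc emb_left_commute[of z])
  ultimately have "emb c * z \<in> corner_square_zero p"
    by (simp add: corner_square_zero_def z)
  then show ?case using step by (simp add: distrib_left span_add span_scale span_base)
qed

end

context real_rank_zero_cstar
begin

text \<open>For a projection \<open>q\<close> below \<open>p\<close>, the commutator of
  \<open>x\<close> and \<open>q\<close> is \<open>(p - q) x q - q x (p - q)\<close>, a difference of
  square-zero elements. Real rank zero extends this to all self-adjoint second factors.\<close>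

lemma corner_commutators_square_zero:
  assumes p: "proj p"
  shows "closure (span (corner_commutators p)) \<subseteq> closure (span (corner_square_zero p))"
proof (rule closure_minimal)
  let ?N = "closure (span (corner_square_zero p))"
  have P: "p * p = p" "st p = p" using p by (simp_all add: proj_def)
  have sN: "subspace ?N" by (rule subspace_closure) simp
  have embN: "emb c * z \<in> ?N" if z: "z \<in> ?N" for c z
  proof -
    obtain f where f: "\<And>n. f n \<in> span (corner_square_zero p)" "f \<longlonglongrightarrow> z"
      using z unfolding closure_sequential by blast
    show ?thesis unfolding closure_sequential using f
      by (intro exI[of _ "\<lambda>n. emb c * f n"]) (auto intro!: tendsto_intros corner_square_zero_emb)
  qed
  have proj_comm: "x * q - q * x \<in> ?N" if x: "p * x = x" "x * p = x" and q: "proj q" "p * q = q" "q * p = q" for x q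
  proof -
    have Q: "q * q = q" using q by (simp add: proj_def)
    let ?r = "p - q"
    have rq: "?r * q = 0" "q * ?r = 0" "p * ?r = ?r" "?r * p = ?r"
      by (simp_all add: left_diff_distrib right_diff_distrib Q q P)
    have "p * (?r * x * q) * p = (p * ?r) * x * (q * p)" "(?r * x * q) * (?r * x * q) = ?r * x * (q * ?r) * x * q"
      "p * (q * x * ?r) * p = (p * q) * x * (?r * p)" "(q * x * ?r) * (q * x * ?r) = q * x * (?r * q) * x * ?r"
      by (simp_all only: mult.assoc)
    then have "?r * x * q \<in> corner_square_zero p" "q * x * ?r \<in> corner_square_zero p"
      unfolding corner_square_zero_def by (simp_all only: rq q mem_Collect_eq mult_zero_left mult_zero_right simp_thms)
    then have "?r * x * q - q * x * ?r \<in> ?N"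
      by (intro subsetD[OF closure_subset] span_diff span_base)
    moreover have "?r * x * q - q * x * ?r = x * q - q * x"
      by (simp add: left_diff_distrib right_diff_distrib x mult.assoc)
    ultimately show ?thesis by simp
  qed
  have herm_comm: "x * k - k * x \<in> ?N" if x: "p * x = x" "x * p = x" and k: "st k = k" "p * k * p = k" for x k
  proof (rule closure_of_approximations)
    fix d :: real assume d: "d > 0"
    define d' where "d' = d / (2 * norm x + 1)"
    have pos: "2 * norm x + 1 > 0" by (simp add: add_nonneg_pos)
    have d': "d' > 0" using d pos by (simp add: d'_def)
    obtain I :: "int set" and q l where I: "finite I" "\<And>i. i \<in> I \<Longrightarrow> proj (q i)"
      "\<And>i. i \<in> I \<Longrightarrow> p * q i = q i" "\<And>i. i \<in> I \<Longrightarrow> q i * p = q i"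
      "\<And>i j. i \<in> I \<Longrightarrow> j \<in> I \<Longrightarrow> i \<noteq> j \<Longrightarrow> q i * q j = 0"
      "\<And>i. i \<in> I \<Longrightarrow> \<bar>l i\<bar> \<le> norm k" "norm (k - (\<Sum>i\<in>I. l i *\<^sub>R q i)) < d'"
      by (rule corner_decomposition[OF p k d'], rule that; assumption)
    define s where "s = (\<Sum>i\<in>I. l i *\<^sub>R q i)"
    have "x * s - s * x = (\<Sum>i\<in>I. l i *\<^sub>R (x * q i - q i * x))"
      by (simp add: s_def sum_distrib_left sum_distrib_right sum_subtractf scaleR_diff_right)
    also have "\<dots> \<in> ?N" using I by (intro subspace_sum[OF sN] subspace_scale[OF sN] proj_comm x) auto
    finally have "x * s - s * x \<in> ?N" .
    moreover have "norm ((x * k - k * x) - (x * s - s * x)) < d"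
    proof -
      have "(x * k - k * x) - (x * s - s * x) = x * (k - s) - (k - s) * x" by (simp add: algebra_simps)
      then have "norm ((x * k - k * x) - (x * s - s * x)) \<le> norm (x * (k - s)) + norm ((k - s) * x)"
        by (metis norm_triangle_ineq4)
      also have "\<dots> \<le> norm x * norm (k - s) + norm (k - s) * norm x"
        by (intro add_mono norm_mult_ineq)
      also have "\<dots> \<le> norm (k - s) * (2 * norm x + 1)" by (simp add: algebra_simps)
      also have "\<dots> < d' * (2 * norm x + 1)"
        using I(7) pos by (intro mult_strict_right_mono) (auto simp: s_def)
      also have "\<dots> = d" using pos by (simp add: d'_def)
      finally show ?thesis .
    qed
    ultimately show "\<exists>y\<in>?N. norm ((x * k - k * x) - y) < d" by blast
  qed
  have "x * y - y * x \<in> ?N" if x: "p * x * p = x" and y: "p * y * p = y" for x y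
  proof -
    have x': "p * x = x" "x * p = x" using x corner_iff[OF P(1)] by auto
    obtain h k where hk: "st h = h" "st k = k" "y = h + emb \<i> * k" using hermitian_parts by blast
    let ?h = "p * h * p" and ?k = "p * k * p"
    have c: "st (p * w * p) = p * w * p" if "st w = w" for w
      using that by (simp add: st_mult P mult.assoc)
    have c': "p * (p * w * p) * p = p * w * p" for w
      by (simp add: mult.assoc P) (simp add: P flip: mult.assoc)
    have "y = ?h + emb \<i> * ?k"
      using y unfolding hk(3) by (simp add: distrib_left distrib_right mult.assoc emb_left_commute[of p])
    then have "x * y - y * x = (x * ?h - ?h * x) + emb \<i> * (x * ?k - ?k * x)"
      by (simp add: distrib_left distrib_right right_diff_distrib mult.assoc emb_left_commute[of x])
    also have "\<dots> \<in> ?N"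
      by (intro subspace_add[OF sN] embN herm_comm x' c c' hk)
    finally show ?thesis .
  qed
  then have "corner_commutators p \<subseteq> ?N" unfolding corner_commutators_def by blast
  then show "span (corner_commutators p) \<subseteq> ?N" by (intro span_minimal sN)
qed simp

end

section \<open>Images of projections and preservation of Jordan products\<close>

context spectral_iso
begin

text \<open>Square-zero elements \<open>a\<close> and \<open>b\<close> from complementary corners have a square-zero sum, so \<open>T a\<close> and
  \<open>T b\<close> anticommute; by density so do \<open>T p\<close> and \<open>1 - T p\<close>.\<close>

lemma image_idempotent:
  assumes p: "p * p = p"
    and dense: "p \<in> closure (span (A.corner_square_zero p))"
      "1 - p \<in> closure (span (A.corner_square_zero (1 - p)))"
  shows "T p * T p = T p"
proof -
  define q where "q = 1 - p"
  have q: "q * q = q" and pq: "p * q = 0" "q * p = 0"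
    by (simp_all add: q_def left_diff_distrib right_diff_distrib p)
  define \<Phi> where "\<Phi> a b = T a * T b + T b * T a" for a b
  have cont: "continuous_on UNIV T"
    using bounded_linear_T by (simp add: linear_continuous_on)
  have sub: "subspace {b. \<Phi> a b = 0}" for a
    by (rule subspaceI) (simp_all add: \<Phi>_def T_0 T_add T_scaleR distrib_left distrib_right add.assoc flip: scaleR_add_right,
        metis (no_types, lifting) add.assoc add.commute add_0)
  have closed: "closed {b. \<Phi> a b = 0}" for a
    unfolding \<Phi>_def by (intro closed_Collect_eq continuous_intros cont)
  have 0: "\<Phi> a b = 0" if a: "a \<in> A.corner_square_zero p" and b: "b \<in> A.corner_square_zero q" for a b
  proof -
    have a': "p * a = a" "a * p = a" "a * a = 0" and b': "q * b = b" "b * q = b" "b * b = 0"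
      using a b A.corner_iff[OF p] A.corner_iff[OF q] by (auto simp: A.corner_square_zero_def)
    have "a * b = (a * p) * (q * b)" "b * a = (b * q) * (p * a)" by (simp_all only: a' b')
    then have "a * b = a * (p * q) * b" "b * a = b * (q * p) * a" by (simp_all only: mult.assoc)
    then have ab: "a * b = 0" "b * a = 0" by (simp_all add: pq)
    have "(a + b) * (a + b) = 0" by (simp add: distrib_left distrib_right a' b' ab)
    then have "T (a + b) * T (a + b) = 0" by (rule square_zero)
    then show ?thesis
      using square_zero[OF a'(3)] square_zero[OF b'(3)]
      by (simp add: \<Phi>_def T_add distrib_left distrib_right add.commute)
  qed
  have 1: "\<Phi> a q = 0" if a: "a \<in> A.corner_square_zero p" for a
  proof -
    have "closure (span (A.corner_square_zero q)) \<subseteq> {b. \<Phi> a b = 0}"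
      using 0[OF a] by (intro closure_minimal span_minimal sub closed) auto
    then show ?thesis using dense(2) by (auto simp: q_def)
  qed
  have sym: "\<Phi> a b = \<Phi> b a" for a b by (simp add: \<Phi>_def add.commute)
  have "closure (span (A.corner_square_zero p)) \<subseteq> {a. \<Phi> q a = 0}"
    using 1 by (intro closure_minimal span_minimal sub closed) (auto simp: sym)
  then have "\<Phi> q p = 0" using dense(1) by auto
  then have "T p - T p * T p + (T p - T p * T p) = 0"
    by (simp add: \<Phi>_def q_def T_diff unital left_diff_distrib right_diff_distrib)
  then have "2 *\<^sub>R (T p - T p * T p) = 0" by (simp only: scaleR_2)
  then show ?thesis by simp
qed

text \<open>Idempotency at a sum of two orthogonal projections makes their images anticommute, so
  cross terms drop out of the square of \<open>T\<close> at finite real combinations. Continuity and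
  polarization do the rest.\<close>

theorem jordan_if_idempotents:
  assumes rr0: "real_rank_zero stA" and idem: "\<And>p. A.proj p \<Longrightarrow> T p * T p = T p"
  shows "jordan_isomorphism csA csB T"
proof -
  interpret R: real_rank_zero_cstar csA stA by unfold_locales (rule rr0)
  have orth: "T p * T q + T q * T p = 0" if "A.proj p" "A.proj q" "p * q = 0" for p q
    using idem[OF A.proj_add[OF that]] idem[OF that(1)] idem[OF that(2)]
    by (simp add: T_add distrib_left distrib_right add.commute add.left_commute)
  have sq_fin: "T (\<Sum>i\<in>I. (l i)\<^sup>2 *\<^sub>R q i) = T (\<Sum>i\<in>I. l i *\<^sub>R q i) * T (\<Sum>i\<in>I. l i *\<^sub>R q i)"
    if I: "finite I" "\<And>i. i \<in> I \<Longrightarrow> A.proj (q i)"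
      "\<And>i j. i \<in> I \<Longrightarrow> j \<in> I \<Longrightarrow> i \<noteq> j \<Longrightarrow> q i * q j = 0" for I :: "int set" and q l
  proof -
    let ?c = "\<lambda>i j. l i * l j"
    have T_sum: "T (\<Sum>i\<in>I. c i *\<^sub>R q i) = (\<Sum>i\<in>I. c i *\<^sub>R T (q i))" for c
      by (simp add: linear_sum[OF linear_T] T_scaleR)
    let ?D = "\<Sum>i\<in>I. \<Sum>j\<in>I. ?c i j *\<^sub>R (T (q i) * T (q j))"
    have D: "T (\<Sum>i\<in>I. l i *\<^sub>R q i) * T (\<Sum>i\<in>I. l i *\<^sub>R q i) = ?D"
      unfolding T_sum sum_product by (simp add: mult.commute)
    have "?D = (\<Sum>i\<in>I. \<Sum>j\<in>I. ?c i j *\<^sub>R (T (q j) * T (q i)))"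
      by (subst sum.swap) (simp add: mult.commute)
    \<comment> \<open>The double sum is added to its transpose because only the symmetrized cross
      terms are known to vanish.\<close>
    then have "?D + ?D = (\<Sum>i\<in>I. \<Sum>j\<in>I. ?c i j *\<^sub>R (T (q i) * T (q j) + T (q j) * T (q i)))"
      by (simp add: sum.distrib scaleR_add_right)
    also have "\<dots> = (\<Sum>i\<in>I. \<Sum>j\<in>I. if i = j then 2 *\<^sub>R ((l i)\<^sup>2 *\<^sub>R T (q i)) else 0)"
    proof (intro sum.cong refl)
      fix i j assume ij: "i \<in> I" "j \<in> I"
      show "?c i j *\<^sub>R (T (q i) * T (q j) + T (q j) * T (q i))
        = (if i = j then 2 *\<^sub>R ((l i)\<^sup>2 *\<^sub>R T (q i)) else 0)"
      proof (cases "i = j")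
        case True
        then show ?thesis
          unfolding scaleR_2 using idem[OF I(2)[OF ij(1)]] by (simp add: power2_eq_square scaleR_add_right)
      next
        case False
        then show ?thesis using orth[OF I(2)[OF ij(1)] I(2)[OF ij(2)] I(3)[OF ij False]] by simp
      qed
    qed
    also have "\<dots> = 2 *\<^sub>R T (\<Sum>i\<in>I. (l i)\<^sup>2 *\<^sub>R q i)"
      using I(1) by (simp add: T_sum scaleR_sum_right)
    finally have "2 *\<^sub>R ?D = 2 *\<^sub>R T (\<Sum>i\<in>I. (l i)\<^sup>2 *\<^sub>R q i)" by (simp only: scaleR_2)
    then show ?thesis by (simp add: D)
  qed
  have sq: "T (h * h) = T h * T h" if h: "stA h = h" for h
  proof -
    have "\<exists>s w. norm (h - s) < inverse (real (Suc n)) \<and> norm (h * h - w) < inverse (real (Suc n))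
        \<and> T w = T s * T s" for n
    proof -
      have pos: "0 < inverse (real (Suc n))" by simp
      obtain I :: "int set" and q l where I: "finite I" "\<And>i. i \<in> I \<Longrightarrow> A.proj (q i)"
        "\<And>i j. i \<in> I \<Longrightarrow> j \<in> I \<Longrightarrow> i \<noteq> j \<Longrightarrow> q i * q j = 0"
        "norm (h - (\<Sum>i\<in>I. l i *\<^sub>R q i)) < inverse (real (Suc n))"
        "norm (h * h - (\<Sum>i\<in>I. (l i)\<^sup>2 *\<^sub>R q i)) < inverse (real (Suc n))"
        by (rule R.hermitian_square_approx[OF h pos], rule that; assumption)
      have "T (\<Sum>i\<in>I. (l i)\<^sup>2 *\<^sub>R q i) = T (\<Sum>i\<in>I. l i *\<^sub>R q i) * T (\<Sum>i\<in>I. l i *\<^sub>R q i)"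
        by (rule sq_fin[OF I(1)]) (use I in auto)
      then show ?thesis using I(4,5) by blast
    qed
    then obtain s w where sw: "\<And>n. norm (h - s n) < inverse (real (Suc n))"
      "\<And>n. norm (h * h - w n) < inverse (real (Suc n))" "\<And>n. T (w n) = T (s n) * T (s n)" by metis
    have lim: "v \<longlonglongrightarrow> x" if "\<And>n. norm (x - v n) < inverse (real (Suc n))" for v and x :: 'a
    proof -
      have "(\<lambda>n. x - v n) \<longlonglongrightarrow> 0"
        using that by (intro Lim_null_comparison[OF _ LIMSEQ_inverse_real_of_nat])
          (auto intro!: always_eventually less_imp_le)
      then have "(\<lambda>n. x - (x - v n)) \<longlonglongrightarrow> x - 0" by (intro tendsto_intros)
      then show ?thesis by simp
    qed
    have "(\<lambda>n. T (w n)) \<longlonglongrightarrow> T (h * h)" by (intro bounded_linear.tendsto[OF bounded_linear_T] lim sw)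
    moreover have "(\<lambda>n. T (s n) * T (s n)) \<longlonglongrightarrow> T h * T h"
      by (intro tendsto_mult bounded_linear.tendsto[OF bounded_linear_T] lim sw)
    ultimately show ?thesis using LIMSEQ_unique by (simp add: sw(3))
  qed
  define \<Psi> where "\<Psi> x y = T (x * y + y * x) - (T x * T y + T y * T x)" for x y
  have herm: "\<Psi> h k = 0" if "stA h = h" "stA k = k" for h k
  proof -
    have "T ((h + k) * (h + k)) = T (h + k) * T (h + k)" using that by (intro sq) (simp add: A.st_add)
    then show ?thesis
      using sq[OF that(1)] sq[OF that(2)]
      by (simp add: \<Psi>_def T_add distrib_left distrib_right add_ac)
  qed
  have sym: "\<Psi> x y = \<Psi> y x" for x y by (simp add: \<Psi>_def add.commute)
  have add: "\<Psi> (x + z) y = \<Psi> x y + \<Psi> z y" for x y z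
    by (simp add: \<Psi>_def T_add distrib_left distrib_right algebra_simps)
  have emb: "\<Psi> (A.emb c * x) y = B.emb c * \<Psi> x y" for c x y
    by (simp add: \<Psi>_def T_add T_emb distrib_left right_diff_distrib mult.assoc
        A.emb_left_commute[of y] B.emb_left_commute[of "T y"])
  have left: "\<Psi> x k = 0" if k: "stA k = k" for x k
  proof -
    obtain h h' where hh: "stA h = h" "stA h' = h'" "x = h + A.emb \<i> * h'" using A.hermitian_parts by blast
    show ?thesis unfolding hh(3) add emb using herm hh k by simp
  qed
  have zero: "\<Psi> x y = 0" for x y
  proof -
    obtain k k' where kk: "stA k = k" "stA k' = k'" "y = k + A.emb \<i> * k'" using A.hermitian_parts by blast
    have "\<Psi> k x = 0" "\<Psi> k' x = 0"
      using left[OF kk(1), of x] left[OF kk(2), of x] sym[of x] by simp_all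
    then have "\<Psi> y x = 0" unfolding kk(3) add emb by simp
    then show ?thesis using sym[of x y] by simp
  qed
  have "T (jprod x y) = jprod (T x) (T y)" for x y
    using zero[of x y] by (simp add: \<Psi>_def jprod_def T_scaleR)
  then show ?thesis
    using bij_T isometry by (simp add: jordan_isomorphism_def spectral_isometry_def)
qed

end

theorem theorem5p2:
  fixes csA :: "complex \<Rightarrow> 'a::{real_normed_algebra_1,banach} \<Rightarrow> 'a"
    and stA :: "'a \<Rightarrow> 'a"
    and csB :: "complex \<Rightarrow> 'b::{real_normed_algebra_1,banach} \<Rightarrow> 'b"
    and stB :: "'b \<Rightarrow> 'b"
    and T :: "'a \<Rightarrow> 'b"
  assumes "cstar_algebra csA stA"
    and "real_rank_zero stA"
    and "\<not> (\<exists>\<tau>. tracial_state csA stA \<tau>)"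
    and "Hausdorff_space (jacobson_topology csA)"
    and "totally_disconnected_space (jacobson_topology csA)"
    and "cstar_algebra csB stB"
    and "spectral_isometry csA csB T"
    and "T 1 = 1"
    and "surj T"
  shows "jordan_isomorphism csA csB T"
proof -
  interpret R: real_rank_zero_cstar csA stA
    by unfold_locales (use assms in auto)
  interpret Z: zero_dim_cstar csA stA
    by unfold_locales (use assms in auto)
  interpret S: spectral_iso csA stA csB stB T
    by unfold_locales (use assms in auto)
  have dense: "closure (span R.commutators) = UNIV"
    using assms(3) by (rule R.commutators_dense)
  have sz: "p \<in> closure (span (R.corner_square_zero p))" if p: "R.proj p" for p
  proof -
    have pp: "p * p = p" using p by (simp add: R.proj_def)
    obtain e where "R.central_idem e" "e * p = p" "e \<in> R.two_sided {p}"
      using Z.central_support[OF pp] by blast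
    then have "p \<in> closure (span (R.corner_commutators p))"
      by (intro R.corner_commutators_dense[OF dense pp])
    then show ?thesis using R.corner_commutators_square_zero[OF p] by blast
  qed
  show ?thesis
  proof (rule S.jordan_if_idempotents)
    fix p assume p: "R.proj p"
    then show "T p * T p = T p"
      by (intro S.image_idempotent sz R.proj_compl) (simp_all add: R.proj_def)
  qed (rule assms)
qed

end
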